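(* For every finite simple graph $G$ the following are equivalent. (1) $G$ is line $[B,-]$-perfect. (2) None of the following is an edge-induced subgraph of $G$: $P_5\cup P_2$, $C_4\cup P_2$, $P_6$, $C_5$, the bull, the diamond, or the 3-caterpillar $F_1$. (3) Either every component of $G$ is a double star, a vase of flowers, or an isolated vertex; or $G$ has at most one nontrivial component (component containing an edge) and this component is a double star, a vase of flowers, a candy, a shooting star, a double vase, or an amaryllis.
   Context: All graphs are finite and simple; two edges are adjacent if they share an endpoint. For $X\in\{A,B\}$, $Y\in\{A,B,-\}$ and $k\in\mathbb N$, the $[X,Y]$-edge colouring game with $k$ colours on a graph $G$ is played by Alice (A) and Bob (B), who alternately colour a previously uncoloured edge with one of the $k$ colours so that adjacent edges always get distinct colours; player $X$ moves first; if $Y\in\{A,B\}$, only player $Y$ may skip any of his/her moves, and if $Y=-$ no player may skip. The game ends when no move is possible; Alice wins iff all edges are coloured. $\chi'_{[X,Y]}(G)$ is the least $k\ge0$ for which Alice has a winning strategy. $\omega(L(G))$ is the maximum number of pairwise adjacent edges of $G$. An edge-induced subgraph of $G$ is a subgraph formed by a subset of the edges together with their endpoints; "$H$ is an edge-induced subgraph of $G$" means $G$ has one isomorphic to $H$. $G$ is line $[X,Y]$-perfect if $\chi'_{[X,Y]}(H)=\omega(L(H))$ for every edge-induced subgraph $H$ of $G$. $P_n$, $C_n$ are the path and cycle on $n$ vertices, $\cup$ is disjoint union. The bull is a triangle with pendant edges at two distinct vertices; the diamond is $K_4$ minus an edge. The 3-caterpillar $F_1$ is the tree with vertices $v,u,w_1,w_2,a_1,a_2,b_1,b_2$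 and edges $vu,vw_1,vw_2,w_1a_1,w_1a_2,w_2b_1,w_2b_2$. Permitted types (parameters in $\mathbb N$): a vase of $n$ flowers is a triangle $w_1w_2w_3$ plus $n$ leaves attached to $w_1$. An $(m,n)$-double star is an edge $w_1w_2$ plus $m$ leaves attached to $w_1$ and $n$ leaves attached to $w_2$. For $m\ge1$, an $(m,n_1,n_2)$-candy is $K_{2,m}$ with parts $\{v_1,v_2\}$, $\{w_1,\dots,w_m\}$ plus $n_1$ leaves attached to $v_1$ and $n_2$ leaves attached to $v_2$. An $(m,n)$-shooting star has vertices $v,w,a,b,x_1,\dots,x_m,y_1,\dots,y_n$ and edges $wv,va,ab,wx_i,vy_j$. A double vase of $n$ flowers is two triangles $vx_1x_2$ and $vy_1y_2$ sharing only $v$, plus $n$ leaves attached to $v$. An $(m,n)$-amaryllis has vertices $v,w,c_1,c_2,x_1,\dots,x_m,y_1,\dots,y_n$ and edges $wv,vc_1,c_1c_2,c_2v,wx_i,vy_j$. *)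

theory Defs
  imports Main
begin

section \<open>Finite simple graphs\<close>

record 'a sgraph =
  verts :: "'a set"
  edges :: "'a set set"

definition fin_simple_graph :: "'a sgraph \<Rightarrow> bool" where
  "fin_simple_graph G \<longleftrightarrow>
     finite (verts G) \<and> (\<forall>e\<in>edges G. e \<subseteq> verts G \<and> card e = 2)"

definition adjacent :: "'a set \<Rightarrow> 'a set \<Rightarrow> bool" where
  "adjacent e f \<longleftrightarrow> e \<noteq> f \<and> e \<inter> f \<noteq> {}"

definition omega_line :: "'a sgraph \<Rightarrow> nat" where
  "omega_line G =
     Max {card F | F. F \<subseteq> edges G \<and> (\<forall>e\<in>F. \<forall>f\<in>F. e \<noteq> f \<longrightarrow> adjacent e f)}"

definition edge_graph :: "'a set set \<Rightarrow> 'a sgraph" where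
  "edge_graph F = \<lparr>verts = \<Union>F, edges = F\<rparr>"

definition graph_iso :: "'a sgraph \<Rightarrow> 'b sgraph \<Rightarrow> bool" where
  "graph_iso G H \<longleftrightarrow>
     (\<exists>\<phi>. bij_betw \<phi> (verts G) (verts H) \<and> (\<lambda>e. \<phi> ` e) ` edges G = edges H)"

definition has_edge_induced :: "'a sgraph \<Rightarrow> 'b sgraph \<Rightarrow> bool" where
  "has_edge_induced G H \<longleftrightarrow> (\<exists>F \<subseteq> edges G. graph_iso (edge_graph F) H)"

definition linked :: "'a sgraph \<Rightarrow> 'a \<Rightarrow> 'a \<Rightarrow> bool" where
  "linked G = (\<lambda>u v. {u, v} \<in> edges G)\<^sup>*\<^sup>*"

definition component_of :: "'a sgraph \<Rightarrow> 'a \<Rightarrow> 'a sgraph" where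
  "component_of G v =
     \<lparr>verts = {u \<in> verts G. linked G v u}, edges = {e \<in> edges G. \<forall>u\<in>e. linked G v u}\<rparr>"

definition components :: "'a sgraph \<Rightarrow> 'a sgraph set" where
  "components G = component_of G ` verts G"

definition nontrivial_components :: "'a sgraph \<Rightarrow> 'a sgraph set" where
  "nontrivial_components G = {C \<in> components G. edges C \<noteq> {}}"


section \<open>The edge colouring game\<close>

datatype player = Alice | Bob

datatype 'a move = Paint "'a set" nat | Skip

type_synonym 'a colouring = "'a set \<Rightarrow> nat option"

definition can_paint :: "'a sgraph \<Rightarrow> nat \<Rightarrow> 'a colouring \<Rightarrow> 'a set \<Rightarrow> nat \<Rightarrow> bool" where
  "can_paint G k c e a \<longleftrightarrow>
     e \<in> edges G \<and> c e = None \<and> a < k \<and> (\<forall>f\<in>edges G. adjacent e f \<longrightarrow> c f \<noteq> Some a)"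

definition game_over :: "'a sgraph \<Rightarrow> nat \<Rightarrow> 'a colouring \<Rightarrow> bool" where
  "game_over G k c \<longleftrightarrow> (\<nexists>e a. can_paint G k c e a)"

text \<open>
  The argument \<open>Y\<close> is the player who is allowed to skip; \<open>None\<close> means that nobody is.
  Skipping does not prolong a game in which no edge can be coloured any more.
\<close>

fun legal_move ::
  "'a sgraph \<Rightarrow> nat \<Rightarrow> player option \<Rightarrow> player \<Rightarrow> 'a colouring \<Rightarrow> 'a move \<Rightarrow> bool" where
  "legal_move G k Y p c (Paint e a) \<longleftrightarrow> can_paint G k c e a"
| "legal_move G k Y p c Skip \<longleftrightarrow> Y = Some p \<and> \<not> game_over G k c"

fun apply_move :: "'a move \<Rightarrow> 'a colouring \<Rightarrow> 'a colouring" where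
  "apply_move (Paint e a) c = c(e \<mapsto> a)"
| "apply_move Skip c = c"

text \<open>
  A strategy \<open>\<sigma>\<close> of Alice maps the list of all moves made so far to her next move.
  \<open>play G k X Y \<sigma> h p c\<close> says that, when Alice follows \<open>\<sigma>\<close>, the sequence of moves \<open>h\<close> can
  occur and leads to the partial colouring \<open>c\<close> with player \<open>p\<close> to move.
\<close>

inductive play ::
  "'a sgraph \<Rightarrow> nat \<Rightarrow> player \<Rightarrow> player option \<Rightarrow> ('a move list \<Rightarrow> 'a move) \<Rightarrow>
   'a move list \<Rightarrow> player \<Rightarrow> 'a colouring \<Rightarrow> bool"
  for G k X Y \<sigma> where
  start: "play G k X Y \<sigma> [] X Map.empty"
| alice: "play G k X Y \<sigma> h Alice c \<Longrightarrow> legal_move G k Y Alice c (\<sigma> h) \<Longrightarrow>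
    play G k X Y \<sigma> (h @ [\<sigma> h]) Bob (apply_move (\<sigma> h) c)"
| bob: "play G k X Y \<sigma> h Bob c \<Longrightarrow> legal_move G k Y Bob c m \<Longrightarrow>
    play G k X Y \<sigma> (h @ [m]) Alice (apply_move m c)"

text \<open>
  At most one player may skip, so of any two consecutive moves at least one colours an edge, and
  on a finite graph every play ends. It therefore suffices that \<open>\<sigma>\<close> always provides a legal move
  and that every play that has ended has all edges coloured.
\<close>

definition winning_strategy ::
  "'a sgraph \<Rightarrow> nat \<Rightarrow> player \<Rightarrow> player option \<Rightarrow> ('a move list \<Rightarrow> 'a move) \<Rightarrow> bool" where
  "winning_strategy G k X Y \<sigma> \<longleftrightarrow>
     (\<forall>h p c. play G k X Y \<sigma> h p c \<longrightarrow>
        (if game_over G k c then \<forall>e\<in>edges G. c e \<noteq> None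
         else p = Alice \<longrightarrow> legal_move G k Y Alice c (\<sigma> h)))"

definition game_index :: "player \<Rightarrow> player option \<Rightarrow> 'a sgraph \<Rightarrow> nat" where
  "game_index X Y G = (LEAST k. \<exists>\<sigma>. winning_strategy G k X Y \<sigma>)"

definition line_perfect :: "player \<Rightarrow> player option \<Rightarrow> 'a sgraph \<Rightarrow> bool" where
  "line_perfect X Y G \<longleftrightarrow>
     (\<forall>F \<subseteq> edges G. game_index X Y (edge_graph F) = omega_line (edge_graph F))"


section \<open>Forbidden graphs\<close>

definition path_graph :: "nat \<Rightarrow> nat sgraph" where
  "path_graph n = \<lparr>verts = {..<n}, edges = {{i, i + 1} | i. i + 1 < n}\<rparr>"

definition cycle_graph :: "nat \<Rightarrow> nat sgraph" where
  "cycle_graph n = \<lparr>verts = {..<n}, edges = {{i, (i + 1) mod n} | i. i < n}\<rparr>"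

definition disjoint_union :: "'a sgraph \<Rightarrow> 'b sgraph \<Rightarrow> ('a + 'b) sgraph" where
  "disjoint_union G H =
     \<lparr>verts = Inl ` verts G \<union> Inr ` verts H,
      edges = (\<lambda>e. Inl ` e) ` edges G \<union> (\<lambda>e. Inr ` e) ` edges H\<rparr>"

definition bull :: "nat sgraph" where
  "bull = edge_graph {{0, 1}, {1, 2}, {0, 2}, {0, 3}, {1, 4}}"

definition diamond :: "nat sgraph" where
  "diamond = edge_graph {{0, 1}, {0, 2}, {0, 3}, {1, 2}, {1, 3}}"

text \<open>The vertices \<open>v, u, w\<^sub>1, w\<^sub>2, a\<^sub>1, a\<^sub>2, b\<^sub>1, b\<^sub>2\<close> are numbered \<open>0, \<dots>, 7\<close>.\<close>

definition caterpillar_F1 :: "nat sgraph" where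
  "caterpillar_F1 =
     edge_graph {{0, 1}, {0, 2}, {0, 3}, {2, 4}, {2, 5}, {3, 6}, {3, 7}}"

definition forbidden_free :: "'a sgraph \<Rightarrow> bool" where
  "forbidden_free G \<longleftrightarrow>
     \<not> has_edge_induced G (disjoint_union (path_graph 5) (path_graph 2)) \<and>
     \<not> has_edge_induced G (disjoint_union (cycle_graph 4) (path_graph 2)) \<and>
     \<not> has_edge_induced G (path_graph 6) \<and>
     \<not> has_edge_induced G (cycle_graph 5) \<and>
     \<not> has_edge_induced G bull \<and>
     \<not> has_edge_induced G diamond \<and>
     \<not> has_edge_induced G caterpillar_F1"


section \<open>Permitted graphs\<close>

text \<open>
  \<open>Core i\<close> are the named vertices of a family, \<open>Mid i\<close> the vertices in the \<open>m\<close>-element part of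
  \<open>K\<^bsub>2,m\<^esub>\<close>, and \<open>LeafX i\<close>, \<open>LeafY i\<close> the leaves. None of the graphs has an isolated vertex, so
  each of them is determined by its edges.
\<close>

datatype label = Core nat | Mid nat | LeafX nat | LeafY nat

definition pendants :: "label \<Rightarrow> (nat \<Rightarrow> label) \<Rightarrow> nat \<Rightarrow> label set set" where
  "pendants v l n = {{v, l i} | i. i < n}"

definition vase :: "nat \<Rightarrow> label sgraph" where
  "vase n = edge_graph
     ({{Core 1, Core 2}, {Core 2, Core 3}, {Core 1, Core 3}} \<union> pendants (Core 1) LeafX n)"

definition double_star :: "nat \<Rightarrow> nat \<Rightarrow> label sgraph" where
  "double_star m n = edge_graph
     ({{Core 1, Core 2}} \<union> pendants (Core 1) LeafX m \<union> pendants (Core 2) LeafY n)"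

definition candy :: "nat \<Rightarrow> nat \<Rightarrow> nat \<Rightarrow> label sgraph" where
  "candy m n1 n2 = edge_graph
     ({{v, Mid j} | v j. v \<in> {Core 1, Core 2} \<and> j < m} \<union>
      pendants (Core 1) LeafX n1 \<union> pendants (Core 2) LeafY n2)"

text \<open>Here \<open>v, w, a, b\<close> are \<open>Core 1, \<dots>, Core 4\<close>.\<close>

definition shooting_star :: "nat \<Rightarrow> nat \<Rightarrow> label sgraph" where
  "shooting_star m n = edge_graph
     ({{Core 2, Core 1}, {Core 1, Core 3}, {Core 3, Core 4}} \<union>
      pendants (Core 2) LeafX m \<union> pendants (Core 1) LeafY n)"

text \<open>Here \<open>v, x\<^sub>1, x\<^sub>2, y\<^sub>1, y\<^sub>2\<close> are \<open>Core 1, \<dots>, Core 5\<close>.\<close>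

definition double_vase :: "nat \<Rightarrow> label sgraph" where
  "double_vase n = edge_graph
     ({{Core 1, Core 2}, {Core 2, Core 3}, {Core 3, Core 1},
       {Core 1, Core 4}, {Core 4, Core 5}, {Core 5, Core 1}} \<union>
      pendants (Core 1) LeafX n)"

text \<open>Here \<open>v, w, c\<^sub>1, c\<^sub>2\<close> are \<open>Core 1, \<dots>, Core 4\<close>.\<close>

definition amaryllis :: "nat \<Rightarrow> nat \<Rightarrow> label sgraph" where
  "amaryllis m n = edge_graph
     ({{Core 2, Core 1}, {Core 1, Core 3}, {Core 3, Core 4}, {Core 4, Core 1}} \<union>
      pendants (Core 2) LeafX m \<union> pendants (Core 1) LeafY n)"

definition is_vase :: "'a sgraph \<Rightarrow> bool" where
  "is_vase G \<longleftrightarrow> (\<exists>n. graph_iso G (vase n))"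

definition is_double_star :: "'a sgraph \<Rightarrow> bool" where
  "is_double_star G \<longleftrightarrow> (\<exists>m n. graph_iso G (double_star m n))"

definition is_candy :: "'a sgraph \<Rightarrow> bool" where
  "is_candy G \<longleftrightarrow> (\<exists>m n1 n2. m \<ge> 1 \<and> graph_iso G (candy m n1 n2))"

definition is_shooting_star :: "'a sgraph \<Rightarrow> bool" where
  "is_shooting_star G \<longleftrightarrow> (\<exists>m n. graph_iso G (shooting_star m n))"

definition is_double_vase :: "'a sgraph \<Rightarrow> bool" where
  "is_double_vase G \<longleftrightarrow> (\<exists>n. graph_iso G (double_vase n))"

definition is_amaryllis :: "'a sgraph \<Rightarrow> bool" where
  "is_amaryllis G \<longleftrightarrow> (\<exists>m n. graph_iso G (amaryllis m n))"

definition is_isolated_vertex :: "'a sgraph \<Rightarrow> bool" where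
  "is_isolated_vertex G \<longleftrightarrow> (\<exists>v. G = \<lparr>verts = {v}, edges = {}\<rparr>)"

definition permitted_structure :: "'a sgraph \<Rightarrow> bool" where
  "permitted_structure G \<longleftrightarrow>
     (\<forall>C\<in>components G. is_double_star C \<or> is_vase C \<or> is_isolated_vertex C) \<or>
     (card (nontrivial_components G) \<le> 1 \<and>
      (\<forall>C\<in>nontrivial_components G.
         is_double_star C \<or> is_vase C \<or> is_candy C \<or> is_shooting_star C \<or>
         is_double_vase C \<or> is_amaryllis C))"

end

theory Submission
  imports Defs
begin

text \<open>
  With \<open>k\<close> colours an uncoloured edge can never be blocked once the number of colours at its
  neighbours plus the number of its uncoloured neighbours is below \<open>k\<close>; both numbers together never
  grow. With \<open>k = \<omega>(L(G))\<close> only few edges of a permitted graph can ever be blocked, and Alice protects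
  them by colouring them early or by repeating at one neighbour the colour of another one: on a
  triangle or a pendant path she copies a colour from the centre, on a candy she mirrors Bob's
  colour at the other centre, so that both centres see the same colours. In a disjoint union of
  double stars and vases she can answer, or open, each component separately.

  For the forbidden graphs, whose clique numbers are 2 or 3, Bob wins with at most three
  moves. A graph without forbidden subgraphs and containing a path on five vertices or a 4-cycle has no
  edge disjoint from it, which determines the graph; otherwise each component is a double star or a
  vase. As being free of forbidden subgraphs is inherited by edge-induced subgraphs, it suffices that Alice wins on \<open>G\<close>
  itself.
\<close>

section \<open>The game as a colouring game on the line graph\<close>

text \<open>Two kinds of edges can be blocked, and they need different protection. An edge with at
  most \<open>k\<close> neighbours is out of danger once two of its neighbours share a colour; this
  is why copying works on triangles and pendant paths, and one copy often serves two edges at once.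
  The common edge of two stars may have almost \<open>2 * k\<close> neighbours, where one copy is
  too little: it must be coloured while it still sees few colours. A lone unsafe edge can wait for
  one round if it sees at most \<open>k - 2\<close> colours, because Bob adds at most one. This
  slack is missing for \<open>k = 2\<close> in shooting stars and for \<open>k = 3\<close> in
  amaryllises, hence the extra cases there. In a disjoint union the difficulty is tempo: nobody may
  skip, so a move of Bob that needs no answer forces Alice to move somewhere, possibly in an
  untouched component. The invariant must therefore survive her own opening moves as well as Bob's.
  Since the clique number bounds the number of colours from below, the game index enters only
  through the question who wins with exactly that many colours.\<close>

definition paintable ::
  "'b set \<Rightarrow> ('b \<Rightarrow> 'b \<Rightarrow> bool) \<Rightarrow> nat \<Rightarrow> ('b \<Rightarrow> nat option) \<Rightarrow> 'b \<Rightarrow> nat \<Rightarrow> bool" where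
  "paintable V adj k c e a \<longleftrightarrow>
     e \<in> V \<and> c e = None \<and> a < k \<and> (\<forall>f\<in>V. adj e f \<longrightarrow> c f \<noteq> Some a)"

text \<open>A win as a property of positions instead of histories. The rule \<open>bob\<close> asks
  for a legal move, since otherwise a blocked position would be vacuously won by Alice. Vertices and
  adjacency are abstract, so that the same game can be played on edges and on list
  positions.\<close>

inductive alice_wins ::
  "'b set \<Rightarrow> ('b \<Rightarrow> 'b \<Rightarrow> bool) \<Rightarrow> nat \<Rightarrow> player \<Rightarrow> ('b \<Rightarrow> nat option) \<Rightarrow> bool"
  for V adj k where
  full: "\<forall>e\<in>V. c e \<noteq> None \<Longrightarrow> alice_wins V adj k p c"
| alice: "paintable V adj k c e a \<Longrightarrow> alice_wins V adj k Bob (c(e \<mapsto> a)) \<Longrightarrow>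
    alice_wins V adj k Alice c"
| bob: "\<exists>e a. paintable V adj k c e a \<Longrightarrow>
    (\<And>e a. paintable V adj k c e a \<Longrightarrow> alice_wins V adj k Alice (c(e \<mapsto> a))) \<Longrightarrow>
    alice_wins V adj k Bob c"

lemma can_paint_eq: "can_paint G k c e a = paintable (edges G) adjacent k c e a"
  by (simp add: can_paint_def paintable_def)

lemma legal_None:
  "legal_move G k None p c m \<longleftrightarrow> (\<exists>e a. m = Paint e a \<and> paintable (edges G) adjacent k c e a)"
  by (cases m) (auto simp: can_paint_eq)

lemma card_uncoloured_less:
  assumes "finite V" "paintable V adj k c e a"
  shows "card {f \<in> V. (c(e \<mapsto> a)) f = None} < card {f \<in> V. c f = None}"
  using assms by (intro psubset_card_mono) (auto simp: paintable_def)

text \<open>A strategy may use the whole history, \<open>alice_wins\<close> only the current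
  colouring. Induction on the number of uncoloured edges forgets the history: every position that is
  reachable under \<open>\<sigma>\<close> is won.\<close>

lemma winning_strategy_imp_alice_wins:
  assumes fin: "finite (edges G)" and win: "winning_strategy G k X None \<sigma>"
    and "play G k X None \<sigma> h p c"
  shows "alice_wins (edges G) adjacent k p c"
  using assms(3)
proof (induction "card {e \<in> edges G. c e = None}" arbitrary: h p c rule: less_induct)
  case less
  note w = win[unfolded winning_strategy_def, rule_format, OF less.prems]
  show ?case
  proof (cases "game_over G k c")
    case True
    with w show ?thesis by (auto intro: alice_wins.full)
  next
    case False
    show ?thesis
    proof (cases p)
      case Alice
      with w False have l: "legal_move G k None Alice c (\<sigma> h)" by simp
      then obtain e a where ea: "\<sigma> h = Paint e a" "paintable (edges G) adjacent k c e a"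
        by (auto simp: legal_None)
      have "play G k X None \<sigma> (h @ [\<sigma> h]) Bob (c(e \<mapsto> a))"
        using play.alice[OF less.prems[unfolded Alice] l] ea(1) by simp
      from less.hyps[OF card_uncoloured_less[OF fin ea(2)] this]
      show ?thesis unfolding Alice using ea(2) by (rule alice_wins.alice[rotated])
    next
      case Bob
      show ?thesis unfolding Bob
      proof (rule alice_wins.bob)
        show "\<exists>e a. paintable (edges G) adjacent k c e a"
          using False by (simp add: game_over_def can_paint_eq)
      next
        fix e a assume p: "paintable (edges G) adjacent k c e a"
        have "play G k X None \<sigma> (h @ [Paint e a]) Alice (apply_move (Paint e a) c)"
          using less.prems[unfolded Bob] p by (intro play.bob) (auto simp: can_paint_eq)
        then have "play G k X None \<sigma> (h @ [Paint e a]) Alice (c(e \<mapsto> a))" by simp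
        from less.hyps[OF card_uncoloured_less[OF fin p] this]
        show "alice_wins (edges G) adjacent k Alice (c(e \<mapsto> a))" .
      qed
    qed
  qed
qed

text \<open>Replaying the history recovers the colouring, so a choice of a winning move for each won
  position becomes a strategy on histories.\<close>

definition optimal_strategy :: "'a sgraph \<Rightarrow> nat \<Rightarrow> 'a move list \<Rightarrow> 'a move" where
  "optimal_strategy G k h =
     (SOME m. \<exists>e a. m = Paint e a \<and> paintable (edges G) adjacent k (fold apply_move h Map.empty) e a \<and>
        alice_wins (edges G) adjacent k Bob (apply_move m (fold apply_move h Map.empty)))"

lemma optimal_strategy:
  assumes "alice_wins (edges G) adjacent k Alice c" "c = fold apply_move h Map.empty"
    "\<not> game_over G k c"
  shows "legal_move G k None Alice c (optimal_strategy G k h)"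
    "alice_wins (edges G) adjacent k Bob (apply_move (optimal_strategy G k h) c)"
proof -
  have "\<exists>e a. paintable (edges G) adjacent k c e a \<and> alice_wins (edges G) adjacent k Bob (c(e \<mapsto> a))"
    using assms(1)
  proof cases
    case full
    with assms(3) show ?thesis by (auto simp: game_over_def can_paint_def)
  qed auto
  then have "\<exists>m e a. m = Paint e a \<and> paintable (edges G) adjacent k c e a \<and>
        alice_wins (edges G) adjacent k Bob (apply_move m c)" by auto
  then have "\<exists>e a. optimal_strategy G k h = Paint e a \<and> paintable (edges G) adjacent k c e a \<and>
        alice_wins (edges G) adjacent k Bob (apply_move (optimal_strategy G k h) c)"
    unfolding optimal_strategy_def assms(2)[symmetric] by (rule someI_ex)
  then show "legal_move G k None Alice c (optimal_strategy G k h)"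
    "alice_wins (edges G) adjacent k Bob (apply_move (optimal_strategy G k h) c)"
    by (auto simp: legal_None)
qed

lemma play_optimal_strategy:
  assumes "play G k X None (optimal_strategy G k) h p c"
    and "alice_wins (edges G) adjacent k X Map.empty"
  shows "c = fold apply_move h Map.empty \<and> alice_wins (edges G) adjacent k p c"
  using assms
proof (induction rule: play.induct)
  case (alice h c)
  then have "\<not> game_over G k c"
    by (auto simp: game_over_def legal_None can_paint_eq)
  with alice optimal_strategy show ?case by fastforce
next
  case (bob h c m)
  then have "alice_wins (edges G) adjacent k Bob c" by blast
  then have "alice_wins (edges G) adjacent k Alice (apply_move m c)"
  proof cases
    case full
    with bob(2) show ?thesis by (auto simp: legal_None paintable_def)
  next
    case bob': bob
    with bob(2) show ?thesis by (auto simp: legal_None)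
  qed
  with bob show ?case by simp
qed auto

theorem winning_strategy_iff_alice_wins:
  assumes "finite (edges G)"
  shows "(\<exists>\<sigma>. winning_strategy G k X None \<sigma>) \<longleftrightarrow> alice_wins (edges G) adjacent k X Map.empty"
proof
  assume "\<exists>\<sigma>. winning_strategy G k X None \<sigma>"
  then show "alice_wins (edges G) adjacent k X Map.empty"
    using winning_strategy_imp_alice_wins[OF assms] play.start by blast
next
  assume a: "alice_wins (edges G) adjacent k X Map.empty"
  have "winning_strategy G k X None (optimal_strategy G k)"
    unfolding winning_strategy_def
  proof (intro allI impI)
    fix h p c assume "play G k X None (optimal_strategy G k) h p c"
    from play_optimal_strategy[OF this a]
    have c: "c = fold apply_move h Map.empty" and w: "alice_wins (edges G) adjacent k p c" by auto
    show "if game_over G k c then \<forall>e\<in>edges G. c e \<noteq> None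
          else p = Alice \<longrightarrow> legal_move G k None Alice c (optimal_strategy G k h)"
    proof (cases "game_over G k c")
      case True
      from w True show ?thesis
        by cases (auto simp: game_over_def can_paint_eq)
    next
      case False
      with optimal_strategy(1)[OF _ c False] w show ?thesis by auto
    qed
  qed
  then show "\<exists>\<sigma>. winning_strategy G k X None \<sigma>" by blast
qed

section \<open>The clique number as a lower bound for the game index\<close>

definition proper :: "'b set \<Rightarrow> ('b \<Rightarrow> 'b \<Rightarrow> bool) \<Rightarrow> nat \<Rightarrow> ('b \<Rightarrow> nat option) \<Rightarrow> bool" where
  "proper V adj k c \<longleftrightarrow> (\<forall>e\<in>V. \<forall>a. c e = Some a \<longrightarrow>
     a < k \<and> (\<forall>f\<in>V. e \<noteq> f \<and> adj e f \<longrightarrow> c f \<noteq> Some a))"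

lemma proper_empty: "proper V adj k Map.empty"
  by (simp add: proper_def)

lemma proper_paint:
  assumes "proper V adj k c" "paintable V adj k c e a" and "symp adj"
  shows "proper V adj k (c(e \<mapsto> a))"
  unfolding proper_def
proof (intro ballI allI impI conjI)
  fix e' a' assume e': "e' \<in> V" "(c(e \<mapsto> a)) e' = Some a'"
  then show "a' < k"
    using assms(1,2) unfolding proper_def paintable_def by (cases "e' = e") auto
  fix f assume f: "f \<in> V" "e' \<noteq> f \<and> adj e' f"
  with assms(3) have "adj f e'" by (blast dest: sympD)
  consider "e' = e" | "f = e" | "e' \<noteq> e" "f \<noteq> e" by blast
  then show "(c(e \<mapsto> a)) f \<noteq> Some a'"
  proof cases
    case 1
    with e' f assms(2) show ?thesis by (auto simp: paintable_def)
  next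
    case 2
    with e' f \<open>adj f e'\<close> assms(2) show ?thesis by (auto simp: paintable_def)
  next
    case 3
    with e' have "c e' = Some a'" by simp
    with e'(1) f assms(1) have "c f \<noteq> Some a'" unfolding proper_def by blast
    with 3 show ?thesis by simp
  qed
qed

text \<open>Following any single play from a won position to its end produces a proper colouring of
  all of \<open>V\<close>; this is what bounds \<open>k\<close> from below by the clique
  number.\<close>

lemma alice_wins_proper_colouring:
  assumes "alice_wins V adj k p c" "proper V adj k c" "symp adj"
  shows "\<exists>d. proper V adj k d \<and> (\<forall>e\<in>V. d e \<noteq> None)"
  using assms
proof (induction rule: alice_wins.induct)
  case (alice c e a)
  note p = proper_paint[OF alice.prems(1) alice.hyps(1) alice.prems(2)]
  show ?case by (rule alice.IH[OF p alice.prems(2)])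
next
  case (bob c)
  then obtain e a where ea: "paintable V adj k c e a" by blast
  note p = proper_paint[OF bob.prems(1) ea bob.prems(2)]
  show ?case by (rule bob.IH[OF ea p bob.prems(2)])
next
  case (full c p)
  then show ?case by blast
qed

lemma finite_cliques:
  assumes "finite E"
  shows "finite {card F | F. F \<subseteq> E \<and> (\<forall>e\<in>F. \<forall>f\<in>F. e \<noteq> f \<longrightarrow> adjacent e f)}"
  by (rule finite_subset[of _ "card ` Pow E"]) (use assms in auto)

lemma omega_line_ge:
  assumes "finite (edges G)" "F \<subseteq> edges G" "\<And>e f. e \<in> F \<Longrightarrow> f \<in> F \<Longrightarrow> e \<noteq> f \<Longrightarrow> adjacent e f"
  shows "card F \<le> omega_line G"
  unfolding omega_line_def by (rule Max_ge) (use finite_cliques assms in blast)+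

lemma omega_line_attained:
  assumes "finite (edges G)"
  obtains F where "F \<subseteq> edges G" "\<And>e f. e \<in> F \<Longrightarrow> f \<in> F \<Longrightarrow> e \<noteq> f \<Longrightarrow> adjacent e f"
    "card F = omega_line G"
proof -
  have "omega_line G \<in> {card F | F. F \<subseteq> edges G \<and> (\<forall>e\<in>F. \<forall>f\<in>F. e \<noteq> f \<longrightarrow> adjacent e f)}"
    unfolding omega_line_def by (rule Max_in) (use finite_cliques assms in blast)+
  then obtain F where "omega_line G = card F" "F \<subseteq> edges G"
    "\<forall>e\<in>F. \<forall>f\<in>F. e \<noteq> f \<longrightarrow> adjacent e f" by blast
  then show ?thesis by (intro that[of F]) simp_all
qed

lemma symp_adjacent: "symp adjacent"
  by (rule sympI) (auto simp: adjacent_def)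

lemma omega_line_le_if_alice_wins:
  assumes "finite (edges G)" "alice_wins (edges G) adjacent k p Map.empty"
  shows "omega_line G \<le> k"
proof -
  obtain d where d: "proper (edges G) adjacent k d" "\<forall>e\<in>edges G. d e \<noteq> None"
    using alice_wins_proper_colouring[OF assms(2) proper_empty symp_adjacent] by blast
  obtain F where F: "F \<subseteq> edges G" "\<And>e f. e \<in> F \<Longrightarrow> f \<in> F \<Longrightarrow> e \<noteq> f \<Longrightarrow> adjacent e f"
    "card F = omega_line G" using omega_line_attained[OF assms(1)] by blast
  have col: "\<exists>a<k. d e = Some a" if "e \<in> F" for e
  proof -
    from that F(1) have "e \<in> edges G" by blast
    moreover from this d(2) obtain a where "d e = Some a" by blast
    ultimately show ?thesis using d(1) unfolding proper_def by blast
  qed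
  have "inj_on (\<lambda>e. the (d e)) F"
  proof (rule inj_onI, rule ccontr)
    fix e f assume ef: "e \<in> F" "f \<in> F" "the (d e) = the (d f)" "e \<noteq> f"
    then obtain a where "d e = Some a" "d f = Some a"
      using col[of e] col[of f] by auto
    with ef F(1) F(2)[of e f] d(1) show False unfolding proper_def by blast
  qed
  moreover have "(\<lambda>e. the (d e)) ` F \<subseteq> {..<k}" using col by fastforce
  ultimately have "card F \<le> card {..<k}" by (intro card_inj_on_le[of "\<lambda>e. the (d e)"]) auto
  with F show ?thesis by simp
qed

text \<open>Guarantees that the \<open>LEAST\<close> in the game index is attained. The other edges
  show at most \<open>card V - 1\<close> colours, so an uncoloured edge always has a colour
  left.\<close>

lemma alice_wins_many_colours:
  assumes "finite V" "card V \<le> k"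
  shows "alice_wins V adj k p c"
proof (induction "card {f \<in> V. c f = None}" arbitrary: p c rule: less_induct)
  case less
  have wins: "alice_wins V adj k q (c(e \<mapsto> a))" if "paintable V adj k c e a" for e a q
    using less.hyps card_uncoloured_less[OF assms(1) that] by blast
  show ?case
  proof (cases "\<forall>e\<in>V. c e \<noteq> None")
    case True
    then show ?thesis by (rule alice_wins.full)
  next
    case False
    then obtain e where e: "e \<in> V" "c e = None" by blast
    let ?S = "{a. \<exists>f\<in>V - {e}. c f = Some a}"
    have "?S \<subseteq> (\<lambda>f. the (c f)) ` (V - {e})" by force
    then have S: "finite ?S" and "card ?S \<le> card (V - {e})"
      using assms(1) by (auto intro: surj_card_le finite_subset)
    note this(2)
    also have "card (V - {e}) < card V" using assms(1) e(1) by (rule card_Diff1_less)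
    finally have "card ?S < k" using assms(2) by simp
    then have "\<not> {..<k} \<subseteq> ?S" using card_mono[OF S, of "{..<k}"] by auto
    then obtain a where "a < k" "a \<notin> ?S" by auto
    then have ea: "paintable V adj k c e a" using e by (auto simp: paintable_def)
    show ?thesis
    proof (cases p)
      case Alice
      with alice_wins.alice[OF ea wins[OF ea]] show ?thesis by simp
    next
      case Bob
      have "alice_wins V adj k Bob c"
        by (rule alice_wins.bob) (use wins ea in blast)+
      with Bob show ?thesis by simp
    qed
  qed
qed

text \<open>No smaller number of colours can suffice, so \<open>omega_line G\<close> is the least
  winning number as soon as it is a winning number at all.\<close>

theorem game_index_eq_omega_iff:
  assumes "finite (edges G)"
  shows "game_index X None G = omega_line G \<longleftrightarrow>
    alice_wins (edges G) adjacent (omega_line G) X Map.empty"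
proof -
  have gi: "game_index X None G = (LEAST k. alice_wins (edges G) adjacent k X Map.empty)"
    unfolding game_index_def winning_strategy_iff_alice_wins[OF assms] ..
  show ?thesis
  proof
    assume "game_index X None G = omega_line G"
    with LeastI[of "\<lambda>k. alice_wins (edges G) adjacent k X Map.empty", OF
        alice_wins_many_colours[OF assms order_refl]] gi
    show "alice_wins (edges G) adjacent (omega_line G) X Map.empty" by simp
  next
    assume "alice_wins (edges G) adjacent (omega_line G) X Map.empty"
    then show "game_index X None G = omega_line G"
      unfolding gi using omega_line_le_if_alice_wins[OF assms] by (intro Least_equality) auto
  qed
qed

section \<open>Uncoloured edges that can never be blocked\<close>

locale colouring_game =
  fixes V :: "'b set" and adj :: "'b \<Rightarrow> 'b \<Rightarrow> bool" and k :: nat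
  assumes finite_V: "finite V"
    and adj_sym: "adj e f \<Longrightarrow> adj f e"
    and adj_irrefl: "\<not> adj e e"
begin

abbreviation legal :: "('b \<Rightarrow> nat option) \<Rightarrow> 'b \<Rightarrow> nat \<Rightarrow> bool" where
  "legal \<equiv> paintable V adj k"

abbreviation wins :: "player \<Rightarrow> ('b \<Rightarrow> nat option) \<Rightarrow> bool" where
  "wins \<equiv> alice_wins V adj k"

definition nbrs :: "'b \<Rightarrow> 'b set" where
  "nbrs e = {f \<in> V. adj e f}"

definition seen :: "('b \<Rightarrow> nat option) \<Rightarrow> 'b \<Rightarrow> nat set" where
  "seen c e = {a. \<exists>f\<in>nbrs e. c f = Some a}"

definition blank_nbrs :: "('b \<Rightarrow> nat option) \<Rightarrow> 'b \<Rightarrow> 'b set" where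
  "blank_nbrs c e = {f \<in> nbrs e. c f = None}"

definition safe :: "('b \<Rightarrow> nat option) \<Rightarrow> 'b \<Rightarrow> bool" where
  "safe c e \<longleftrightarrow> card (seen c e) + card (blank_nbrs c e) < k"

lemma finite_nbrs: "finite (nbrs e)"
  using finite_V by (simp add: nbrs_def)

lemma finite_blank_nbrs: "finite (blank_nbrs c e)"
  using finite_nbrs by (simp add: blank_nbrs_def)

lemma finite_seen: "finite (seen c e)"
proof (rule finite_subset)
  show "seen c e \<subseteq> (\<lambda>f. the (c f)) ` nbrs e" by (force simp: seen_def)
qed (simp add: finite_nbrs)

lemma legal_iff: "legal c e a \<longleftrightarrow> e \<in> V \<and> c e = None \<and> a < k \<and> a \<notin> seen c e"
  by (auto simp: paintable_def seen_def nbrs_def)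

lemma seen_upd_subset: "seen (c(e \<mapsto> a)) f \<subseteq> insert a (seen c f)"
  by (auto simp: seen_def)

lemma card_seen_upd_le: "card (seen (c(e \<mapsto> a)) f) \<le> Suc (card (seen c f))"
  using card_mono[OF _ seen_upd_subset, of a c f e] card_insert_le_m1[of "Suc (card (seen c f))" "seen c f" a]
    finite_seen by (simp add: card_insert_if split: if_splits)

lemma seen_upd_nonadj: "\<not> adj f e \<Longrightarrow> seen (c(e \<mapsto> a)) f = seen c f"
  by (auto simp: seen_def nbrs_def)

lemma blank_nbrs_upd: "blank_nbrs (c(e \<mapsto> a)) f = blank_nbrs c f - {e}"
  by (auto simp: blank_nbrs_def)

lemma safe_upd:
  assumes "legal c e a" "safe c f"
  shows "safe (c(e \<mapsto> a)) f"
proof (cases "adj f e")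
  case True
  with assms(1) have "e \<in> blank_nbrs c f"
    by (auto simp: blank_nbrs_def nbrs_def legal_iff)
  then have "card (blank_nbrs (c(e \<mapsto> a)) f) < card (blank_nbrs c f)"
    unfolding blank_nbrs_upd by (intro card_Diff1_less finite_blank_nbrs)
  with card_seen_upd_le[of c e a f] assms(2) show ?thesis by (simp add: safe_def)
next
  case False
  then have "e \<notin> blank_nbrs c f" by (auto simp: blank_nbrs_def nbrs_def)
  with False assms(2) show ?thesis by (simp add: safe_def seen_upd_nonadj blank_nbrs_upd)
qed

lemma seen_blank_coloured:
  "card (seen c e) \<le> card {f \<in> nbrs e. c f \<noteq> None}"
  "card {f \<in> nbrs e. c f \<noteq> None} + card (blank_nbrs c e) = card (nbrs e)"
proof -
  have "seen c e = (\<lambda>f. the (c f)) ` {f \<in> nbrs e. c f \<noteq> None}"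
    by (force simp: seen_def)
  then show "card (seen c e) \<le> card {f \<in> nbrs e. c f \<noteq> None}"
    using finite_nbrs by (simp add: card_image_le)
  show "card {f \<in> nbrs e. c f \<noteq> None} + card (blank_nbrs c e) = card (nbrs e)"
    unfolding blank_nbrs_def using finite_nbrs
    by (subst card_Un_disjoint[symmetric]) (auto intro!: arg_cong[of _ _ card])
qed

lemma safe_few_nbrs: "card (nbrs e) < k \<Longrightarrow> safe c e"
  using seen_blank_coloured[where c = c and e = e] by (simp add: safe_def)

text \<open>An edge with at most \<open>k\<close> neighbours can be blocked only if these end up
  showing \<open>k\<close> different colours. As \<open>f\<close> and \<open>g\<close> agree,
  \<open>f\<close> can be left out when the colours are counted, which gains the one that
  \<open>safe\<close> requires.\<close>

lemma safe_repeated_colour: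
  assumes "f \<in> nbrs e" "g \<in> nbrs e" "f \<noteq> g" "c f = Some a" "c g = Some a" "card (nbrs e) \<le> k"
  shows "safe c e"
proof -
  let ?C = "{f \<in> nbrs e. c f \<noteq> None}"
  have "seen c e \<subseteq> (\<lambda>f. the (c f)) ` (?C - {f})"
  proof
    fix b assume "b \<in> seen c e"
    then obtain h where h: "h \<in> nbrs e" "c h = Some b" by (auto simp: seen_def)
    show "b \<in> (\<lambda>f. the (c f)) ` (?C - {f})"
    proof (cases "h = f")
      case True
      with h assms(2-5) show ?thesis by (intro image_eqI[of _ _ g]) auto
    next
      case False
      with h show ?thesis by (intro image_eqI[of _ _ h]) auto
    qed
  qed
  then have "card (seen c e) \<le> card (?C - {f})"
    using finite_nbrs by (intro surj_card_le) auto
  also have "\<dots> < card ?C"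
    using assms finite_nbrs by (intro card_Diff1_less) auto
  finally show ?thesis using seen_blank_coloured(2)[where c = c and e = e] assms(6) by (simp add: safe_def)
qed

lemma ex_legal:
  assumes "e \<in> V" "c e = None" "card (seen c e) < k"
  shows "\<exists>a. legal c e a"
proof -
  have "\<not> {..<k} \<subseteq> seen c e"
    using card_mono[OF finite_seen, of "{..<k}" c e] assms(3) by auto
  with assms show ?thesis by (auto simp: legal_iff)
qed

lemma safe_ex_legal: "e \<in> V \<Longrightarrow> c e = None \<Longrightarrow> safe c e \<Longrightarrow> \<exists>a. legal c e a"
  by (rule ex_legal) (auto simp: safe_def)

section \<open>Components that need no immediate attention, and disjoint unions\<close>

definition calm :: "('b \<Rightarrow> nat option) \<Rightarrow> 'b set \<Rightarrow> bool" where
  "calm c K \<longleftrightarrow> (\<forall>e\<in>K. c e = None \<longrightarrow> safe c e)"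

text \<open>\<open>d\<close> is the only edge that may still be blocked. Seeing at most
  \<open>k - 2\<close> colours, it keeps a free colour even after one further move of Bob, so Alice
  can colour it in reply to his first move in the component.\<close>

definition tense :: "('b \<Rightarrow> nat option) \<Rightarrow> 'b set \<Rightarrow> bool" where
  "tense c K \<longleftrightarrow> (\<exists>d\<in>K. c d = None \<and> Suc (card (seen c d)) < k \<and> (\<forall>e\<in>K. c e = None \<longrightarrow> e = d \<or> safe c e))"

text \<open>A vase with at least one leaf, seen in the line graph: \<open>p\<close> and
  \<open>q\<close> are the triangle edges at the centre, \<open>g\<close> is the third triangle edge
  and \<open>L\<close> consists of the pendant edges. Only \<open>p\<close> and \<open>q\<close> can
  be blocked; they have \<open>card L + 2\<close> neighbours each.\<close>

definition vase_like :: "'b set \<Rightarrow> bool" where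
  "vase_like K \<longleftrightarrow> (\<exists>p q g L. K = {p, q, g} \<union> L \<and> L \<noteq> {} \<and> p \<noteq> q \<and> g \<noteq> p \<and> g \<noteq> q \<and>
     p \<notin> L \<and> q \<notin> L \<and> g \<notin> L \<and> 3 \<le> k \<and> card L + 2 \<le> k \<and>
     nbrs p = K - {p} \<and> nbrs q = K - {q} \<and> nbrs g = {p, q} \<and> (\<forall>l\<in>L. nbrs l = {p, q} \<union> L - {l}))"

text \<open>A component is settled if Alice may leave it to Bob: whatever he colours in it, she can restore
  this state, and if she has to open it herself, she can do so without losing it.\<close>

definition settled :: "('b \<Rightarrow> nat option) \<Rightarrow> 'b set \<Rightarrow> bool" where
  "settled c K \<longleftrightarrow> calm c K \<or> tense c K \<or> (\<forall>e\<in>K. c e = None) \<and> vase_like K"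

lemma calm_upd: "legal c e a \<Longrightarrow> calm c K \<Longrightarrow> calm (c(e \<mapsto> a)) K"
  unfolding calm_def using safe_upd by (metis fun_upd_apply option.distinct(1))

text \<open>Used when Alice has a free move and cannot skip. A calm component stays calm under any
  move, and in a tense one she colours the critical edge. In a fresh vase she colours
  \<open>p\<close>; then \<open>q\<close> is the only unsafe edge and sees one colour, so
  \<open>3 <= k\<close> makes the vase tense.\<close>

lemma settled_alice:
  assumes "settled c K" "K \<subseteq> V" "e \<in> K" "c e = None"
  shows "\<exists>e\<in>K. \<exists>a. legal c e a \<and> settled (c(e \<mapsto> a)) K"
proof -
  from assms(1)[unfolded settled_def] show ?thesis
  proof (elim disjE conjE)
  assume calm: "calm c K"
  with assms safe_ex_legal[of e c] obtain a where "legal c e a" by (auto simp: calm_def)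
  with calm assms(3) show ?thesis using calm_upd settled_def by blast
next
  assume "tense c K"
  then obtain d where d: "d \<in> K" "c d = None" "Suc (card (seen c d)) < k"
    "\<forall>e\<in>K. c e = None \<longrightarrow> e = d \<or> safe c e" by (auto simp: tense_def)
  with assms(2) ex_legal[of d c] obtain a where a: "legal c d a" by auto
  then have "calm (c(d \<mapsto> a)) K" using d safe_upd[OF a] by (auto simp: calm_def)
  with a d(1) show ?thesis using settled_def by blast
next
  assume fresh: "\<forall>e\<in>K. c e = None" and "vase_like K"
  then obtain p q g L where K: "K = {p, q, g} \<union> L" and ne: "p \<noteq> q" "g \<noteq> p" "g \<noteq> q"
     "p \<notin> L" "q \<notin> L" "g \<notin> L" and k: "3 \<le> k" "card L + 2 \<le> k"
    and nb: "nbrs p = K - {p}" "nbrs q = K - {q}" "nbrs g = {p, q}"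
      "\<And>l. l \<in> L \<Longrightarrow> nbrs l = {p, q} \<union> L - {l}"
    unfolding vase_like_def by metis
  have finL: "finite L" using K assms(2) finite_V by (auto intro: finite_subset)
  have sl: "safe c' l" if "l \<in> L" for c' l
    using that ne k nb(4)[OF that] finL by (intro safe_few_nbrs) (simp add: card_Diff_singleton_if card_gt_0_iff)
  have sg: "safe c' g" for c' using nb(3) k ne by (intro safe_few_nbrs) simp
  have leg: "legal c p 0"
    using K assms(2) fresh k nb(1) by (auto simp: legal_iff seen_def)
  have "seen (c(p \<mapsto> 0)) q = {0}" using nb(2) K fresh ne by (auto simp: seen_def)
  then have "tense (c(p \<mapsto> 0)) K"
    unfolding tense_def using K ne k sl sg fresh by (intro bexI[of _ q]) auto
  with leg K show ?thesis unfolding settled_def by blast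
  qed
qed

text \<open>In a fresh vase Alice answers \<open>p\<close> with \<open>q\<close> and conversely. She
  answers \<open>g\<close> with a leaf, and a leaf with \<open>g\<close>, in the colour just used:
  these edges are not adjacent to each other, while \<open>p\<close> and \<open>q\<close> are
  adjacent to both and now see a repeated colour.\<close>

lemma settled_bob:
  assumes "settled c K" "K \<subseteq> V" "e \<in> K" and leg: "legal c e a"
  shows "settled (c(e \<mapsto> a)) K \<or>
    (\<exists>f\<in>K. \<exists>b. legal (c(e \<mapsto> a)) f b \<and> settled (c(e \<mapsto> a, f \<mapsto> b)) K)"
proof -
  from assms(1)[unfolded settled_def] show ?thesis
  proof (elim disjE conjE)
  assume calm: "calm c K"
  from calm_upd[OF leg this] show ?thesis by (simp add: settled_def)
next
  assume "tense c K"
  then obtain d where d: "d \<in> K" "c d = None" "Suc (card (seen c d)) < k"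
    "\<forall>e\<in>K. c e = None \<longrightarrow> e = d \<or> safe c e" by (auto simp: tense_def)
  show ?thesis
  proof (cases "e = d")
    case True
    then have "calm (c(e \<mapsto> a)) K" using d safe_upd[OF leg] by (auto simp: calm_def)
    then show ?thesis by (simp add: settled_def)
  next
    case False
    let ?c = "c(e \<mapsto> a)"
    have "card (seen ?c d) < k" using card_seen_upd_le[of c e a d] d(3) by simp
    with ex_legal[of d ?c] d assms(2) False obtain b where b: "legal ?c d b" by auto
    then have "calm (?c(d \<mapsto> b)) K"
      using d safe_upd[OF b] safe_upd[OF leg] by (auto simp: calm_def)
    with b d(1) show ?thesis unfolding settled_def by blast
  qed
next
  assume fresh: "\<forall>e\<in>K. c e = None" and "vase_like K"
  then obtain p q g L where K: "K = {p, q, g} \<union> L" and "L \<noteq> {}" and ne: "p \<noteq> q" "g \<noteq> p" "g \<noteq> q"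
     "p \<notin> L" "q \<notin> L" "g \<notin> L" and k: "3 \<le> k" "card L + 2 \<le> k"
    and nb: "nbrs p = K - {p}" "nbrs q = K - {q}" "nbrs g = {p, q}"
      "\<And>l. l \<in> L \<Longrightarrow> nbrs l = {p, q} \<union> L - {l}"
    unfolding vase_like_def by metis
  have finL: "finite L" using K assms(2) finite_V by (auto intro: finite_subset)
  have cK: "card (K - {x}) \<le> k" if "x \<in> {p, q}" for x
    using that K finL ne k by (auto simp: card_insert_if insert_Diff_if)
  have sl: "safe c' l" if "l \<in> L" for c' l
    using that ne k nb(4)[OF that] finL by (intro safe_few_nbrs) (simp add: card_Diff_singleton_if card_gt_0_iff)
  have sg: "safe c' g" for c' using nb(3) k ne by (intro safe_few_nbrs) simp
  let ?c = "c(e \<mapsto> a)"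
  have ak: "a < k" using leg by (simp add: legal_iff)
  have seen: "seen ?c f \<subseteq> {a}" if "f \<in> K" for f
    using that fresh K nb by (auto simp: seen_def split: if_splits)
  have pq: ?thesis if "e \<in> {p, q}" "f \<in> {p, q}" "e \<noteq> f" for f
  proof -
    have "card (seen ?c f) \<le> 1" using card_mono[OF _ seen[of f]] that(2) K by auto
    then have "card (seen ?c f) < k" using k by simp
    moreover have "f \<in> V" "?c f = None" using that fresh K assms(2) by auto
    ultimately obtain b where b: "legal ?c f b" using ex_legal by blast
    have "calm (?c(f \<mapsto> b)) K" unfolding calm_def using sl sg that K by auto
    then show ?thesis using b that(2) K unfolding settled_def by blast
  qed
  have gl: ?thesis if "e = g \<and> f \<in> L \<or> e \<in> L \<and> f = g" for f
  proof -
    have b: "legal ?c f a"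
      using that ne K nb(3) nb(4) fresh assms(2) ak by (auto simp: legal_iff seen_def split: if_splits)
    have "safe (?c(f \<mapsto> a)) x" if "x \<in> {p, q}" for x
      by (rule safe_repeated_colour[of e _ f])
        (use that \<open>e = g \<and> f \<in> L \<or> e \<in> L \<and> f = g\<close> nb cK[OF that] ne K in auto)
    then have "calm (?c(f \<mapsto> a)) K" unfolding calm_def using sl sg K by auto
    then show ?thesis using b that K unfolding settled_def by blast
  qed
  from assms(3) K consider "e = p" | "e = q" | "e = g" | "e \<in> L" by blast
  then show ?thesis
  proof cases
    case 1
    with pq[of q] ne show ?thesis by blast
  next
    case 2
    with pq[of p] ne show ?thesis by blast
  next
    case 3
    with gl \<open>L \<noteq> {}\<close> show ?thesis by blast
  next
    case 4
    with gl[of g] show ?thesis by blast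
  qed
  qed
qed

text \<open>Neighbourhoods do not leave \<open>K\<close>, so a move outside \<open>K\<close> changes
  neither the colours seen nor the blank neighbours inside.\<close>

lemma settled_cong:
  assumes "\<And>f. f \<in> K \<Longrightarrow> nbrs f \<subseteq> K" "e \<notin> K"
  shows "settled (c(e \<mapsto> a)) K = settled c K"
proof -
  have "seen (c(e \<mapsto> a)) f = seen c f" "blank_nbrs (c(e \<mapsto> a)) f = blank_nbrs c f" if "f \<in> K" for f
    using assms(1)[OF that] assms(2) unfolding seen_def blank_nbrs_def by auto
  then have "safe (c(e \<mapsto> a)) f = safe c f" "seen (c(e \<mapsto> a)) f = seen c f" "(c(e \<mapsto> a)) f = c f"
    if "f \<in> K" for f using that assms(2) by (auto simp: safe_def)
  then show ?thesis unfolding settled_def calm_def tense_def by (simp cong: ball_cong bex_cong)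
qed

text \<open>The invariant is that all components are settled whenever Bob is to move. If his move
  spoils a component, Alice repairs it there; if it does not, she spends her move in any component
  that still has an uncoloured edge.\<close>

theorem settled_wins:
  assumes "\<Union>\<K> = V"
    and closed: "\<And>K f. K \<in> \<K> \<Longrightarrow> f \<in> K \<Longrightarrow> nbrs f \<subseteq> K"
    and disj: "\<And>K L. K \<in> \<K> \<Longrightarrow> L \<in> \<K> \<Longrightarrow> K \<noteq> L \<Longrightarrow> K \<inter> L = {}"
    and "\<forall>K\<in>\<K>. settled c K"
  shows "wins Bob c"
  using assms(4)
proof (induction "card {f \<in> V. c f = None}" arbitrary: c rule: less_induct)
  case less
  have upd: "\<forall>K\<in>\<K>. settled (c'(e \<mapsto> a)) K"
    if "\<forall>L\<in>\<K>. L \<noteq> K \<longrightarrow> settled c' L" "K \<in> \<K>" "e \<in> K" "settled (c'(e \<mapsto> a)) K" for c' K e a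
  proof
    fix L assume L: "L \<in> \<K>"
    show "settled (c'(e \<mapsto> a)) L"
    proof (cases "L = K")
      case False
      with disj[OF L that(2)] that(3) have "e \<notin> L" by blast
      with settled_cong[OF closed[OF L]] that(1) L False show ?thesis by blast
    qed (use that in simp)
  qed
  have alice: "\<exists>e a. legal c' e a \<and> (\<forall>K\<in>\<K>. settled (c'(e \<mapsto> a)) K)"
    if "\<forall>K\<in>\<K>. settled c' K" "\<not> (\<forall>e\<in>V. c' e \<noteq> None)" for c'
  proof -
    from that(2) assms(1) obtain e K where eK: "e \<in> K" "K \<in> \<K>" "c' e = None" by blast
    with settled_alice[of c' K e] that(1) assms(1)
    obtain f a where "f \<in> K" "legal c' f a" "settled (c'(f \<mapsto> a)) K" by blast
    with upd[of K c' f a] that(1) eK(2) show ?thesis by blast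
  qed
  show ?case
  proof (cases "\<forall>e\<in>V. c e \<noteq> None")
    case True
    then show ?thesis by (rule alice_wins.full)
  next
    case False
    show ?thesis
    proof (rule alice_wins.bob)
      show "\<exists>e a. legal c e a" using alice[OF less.prems False] by blast
      fix e a assume leg: "legal c e a"
      let ?c = "c(e \<mapsto> a)"
      have reply: "wins Alice ?c" if "legal ?c f b" "\<forall>K\<in>\<K>. settled (?c(f \<mapsto> b)) K" for f b
      proof -
        have "card {g \<in> V. (?c(f \<mapsto> b)) g = None} < card {f \<in> V. c f = None}"
          using card_uncoloured_less[OF finite_V leg] card_uncoloured_less[OF finite_V that(1)] by simp
        from less.hyps[OF this that(2)] that(1) show ?thesis by (rule alice_wins.alice[rotated])
      qed
      from leg assms(1) obtain K where K: "K \<in> \<K>" "e \<in> K" by (auto simp: legal_iff)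
      with settled_bob[of c K e a] less.prems assms(1) leg
      consider "settled ?c K" | f b where "f \<in> K" "legal ?c f b" "settled (?c(f \<mapsto> b)) K" by blast
      then show "wins Alice ?c"
      proof cases
        case 1
        from upd[OF _ K 1] less.prems have set: "\<forall>K\<in>\<K>. settled ?c K" by blast
        show ?thesis
        proof (cases "\<forall>e\<in>V. ?c e \<noteq> None")
          case True
          then show ?thesis by (rule alice_wins.full)
        next
          case False
          from alice[OF set this] reply show ?thesis by blast
        qed
      next
        case (2 f b)
        have "\<forall>L\<in>\<K>. L \<noteq> K \<longrightarrow> settled ?c L"
        proof (intro ballI impI)
          fix L assume L: "L \<in> \<K>" "L \<noteq> K"
          with disj[OF L(1) K(1)] K(2) have "e \<notin> L" by blast
          with settled_cong[OF closed[OF L(1)]] less.prems L show "settled ?c L" by blast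
        qed
        from upd[OF this K(1) 2(1,3)] reply[OF 2(2)] show ?thesis by blast
      qed
    qed
  qed
qed

lemma settled_V_wins: "settled c V \<Longrightarrow> wins Bob c"
  by (rule settled_wins[of "{V}"]) (auto simp: nbrs_def)

lemma wins_AliceI: "legal c e a \<Longrightarrow> wins Bob (c(e \<mapsto> a)) \<Longrightarrow> wins Alice c"
  by (rule alice_wins.alice)

lemma calm_wins:
  assumes "\<And>e. e \<in> V \<Longrightarrow> c e = None \<Longrightarrow> safe c e"
  shows "wins p c"
proof -
  have calm: "calm c V" using assms by (simp add: calm_def)
  then have bob: "wins Bob c" by (simp add: settled_V_wins settled_def)
  show ?thesis
  proof (cases p)
    case Alice
    have "wins Alice c"
    proof (cases "\<forall>e\<in>V. c e \<noteq> None")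
      case True
      then show ?thesis by (rule alice_wins.full)
    next
      case False
      then obtain e where e: "e \<in> V" "c e = None" by blast
      with assms safe_ex_legal obtain a where a: "legal c e a" by blast
      have "settled (c(e \<mapsto> a)) V" using calm_upd[OF a calm] by (simp add: settled_def)
      with a show ?thesis by (metis wins_AliceI settled_V_wins)
    qed
    with Alice show ?thesis by simp
  qed (use bob in simp)
qed

lemma tense_wins:
  assumes "\<And>e. e \<in> V \<Longrightarrow> c e = None \<Longrightarrow> e = d \<or> safe c e" "Suc (card (seen c d)) < k"
  shows "wins Bob c"
proof (cases "d \<in> V \<and> c d = None")
  case True
  with assms have "tense c V" by (auto simp: tense_def)
  then show ?thesis by (simp add: settled_V_wins settled_def)
next
  case False
  with assms show ?thesis by (intro calm_wins) blast
qed

end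

section \<open>Shooting stars, amaryllises and double vases\<close>

context colouring_game
begin

lemma wins_AliceI_bound:
  assumes "e \<in> V" "c e = None" "card (seen c e) < k" "\<And>a. a < k \<Longrightarrow> wins Bob (c(e \<mapsto> a))"
  shows "wins Alice c"
proof -
  obtain a where a: "legal c e a" using ex_legal[OF assms(1-3)] by blast
  then have "a < k" by (simp add: legal_iff)
  from wins_AliceI[OF a assms(4)[OF this]] show ?thesis .
qed

lemma wins_BobI_start:
  assumes "V \<noteq> {}" "0 < k" "\<And>e a. e \<in> V \<Longrightarrow> a < k \<Longrightarrow> wins Alice [e \<mapsto> a]"
  shows "wins Bob Map.empty"
proof (rule alice_wins.bob)
  show "\<exists>e a. legal Map.empty e a"
    using assms(1,2) by (auto simp: legal_iff seen_def)
qed (use assms(3) in \<open>auto simp: legal_iff\<close>)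

lemma card_seen_le1: "seen c e \<subseteq> {a} \<Longrightarrow> card (seen c e) \<le> 1"
  using card_mono[of "{a}"] by fastforce

lemma card_seen_le2: "seen c e \<subseteq> {a, b} \<Longrightarrow> card (seen c e) \<le> 2"
  using card_mono[of "{a, b}" "seen c e"] card_insert_le_m1[of 2 "{b}" a] by simp

lemma seen_single: "seen [e \<mapsto> a] f \<subseteq> {a}"
  by (auto simp: seen_def split: if_splits)

lemma seen_upd_notin: "e \<notin> nbrs f \<Longrightarrow> seen (c(e \<mapsto> a)) f = seen c f"
  by (auto simp: seen_def)

lemma seen_double: "seen [e \<mapsto> a, f \<mapsto> b] g \<subseteq> {a, b}"
  by (auto simp: seen_def split: if_splits)

text \<open>In the shooting star, \<open>S\<close> and \<open>T\<close> are the stars at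
  \<open>v\<close> and \<open>w\<close>, \<open>e0\<close> is \<open>wv\<close>, \<open>p\<close> is
  \<open>va\<close> and \<open>g\<close> is \<open>ab\<close>. Only \<open>e0\<close> and
  \<open>p\<close> can have \<open>k\<close> or more neighbours. The edge \<open>p\<close> has
  exactly \<open>card S\<close> of them, so it matters only if \<open>card S = k\<close>, and then
  one repeated colour at \<open>p\<close> protects it.\<close>

lemma shooting_star_wins:
  assumes V: "V = S \<union> T \<union> {g}" and ST: "S \<inter> T = {e0}" "g \<notin> S" "g \<notin> T" "p \<in> S" "p \<noteq> e0" "T \<noteq> {e0}"
    and nb: "nbrs e0 = S \<union> T - {e0}" "nbrs p = insert g (S - {p})" "nbrs g = {p}"
      "\<And>y. y \<in> S - {e0, p} \<Longrightarrow> nbrs y = S - {y}" "\<And>t. t \<in> T - {e0} \<Longrightarrow> nbrs t = T - {t}"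
    and k: "card S \<le> k" "card T \<le> k"
  shows "wins Bob Map.empty"
proof -
  have e0: "e0 \<in> S" "e0 \<in> T" "g \<noteq> e0" "g \<noteq> p" "p \<notin> T" using ST by auto
  have fin: "finite S" "finite T" using V finite_V by auto
  have "{e0, p} \<subseteq> S" using e0 ST by auto
  from card_mono[OF fin(1) this] ST(5) have S2: "2 \<le> card S" by simp
  then have k2: "2 \<le> k" using k by simp
  have sg: "safe c g" and sy: "y \<in> S - {e0, p} \<Longrightarrow> safe c y" and st: "t \<in> T - {e0} \<Longrightarrow> safe c t" for c y t
    using k k2 S2 nb fin card_Diff1_less[OF fin(1), of y] card_Diff1_less[OF fin(2), of t]
    by (auto intro!: safe_few_nbrs)
  have cases: "e = e0 \<or> e = p \<or> e = g \<or> e \<in> S - {e0, p} \<or> e \<in> T - {e0}" if "e \<in> V" for e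
    using that V by blast
  have calmI: "wins P c" if "c e0 = None \<Longrightarrow> safe c e0" "c p = None \<Longrightarrow> safe c p" for P c
  proof (rule calm_wins)
    fix e assume "e \<in> V" "c e = None"
    then show "safe c e" using cases[of e] that sg[of c] sy[of e c] st[of e c] by auto
  qed
  have tense_e0: "wins Bob c" if "c p = None \<Longrightarrow> safe c p" "Suc (card (seen c e0)) < k" for c
  proof (rule tense_wins[of _ e0])
    fix e assume "e \<in> V" "c e = None"
    then show "e = e0 \<or> safe c e" using cases[of e] that sg[of c] sy[of e c] st[of e c] by auto
  qed (rule that(2))
  have tense_p: "wins Bob c" if "c e0 = None \<Longrightarrow> safe c e0" "Suc (card (seen c p)) < k" for c
  proof (rule tense_wins[of _ p])
    fix e assume "e \<in> V" "c e = None"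
    then show "e = p \<or> safe c e" using cases[of e] that sg[of c] sy[of e c] st[of e c] by auto
  qed (rule that(2))
  have card_p: "card (nbrs p) = card S"
    using nb(2) ST fin S2 by simp
  have rep: "safe c p" if "s \<in> S - {p}" "c s = Some a" "c g = Some a" for c s a
    by (rule safe_repeated_colour[of s _ g]) (use that nb(2) ST card_p k in auto)
  have paint_e0: "wins Alice [e \<mapsto> a]" if "e \<noteq> e0" "\<And>b. b < k \<Longrightarrow> wins Bob [e \<mapsto> a, e0 \<mapsto> b]" for e a
    by (rule wins_AliceI_bound[of e0])
      (use that e0 V card_seen_le1[OF seen_single, of e a e0] k2 in auto)
  show ?thesis
  proof (rule wins_BobI_start)
    fix e a assume e: "e \<in> V" and a: "a < k"
    from V have inV: "e0 \<in> V" "p \<in> V" "g \<in> V" using e0 ST by auto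
    show "wins Alice [e \<mapsto> a]"
    proof (cases "card S < k")
      case True
      then have "safe c p" for c using card_p by (intro safe_few_nbrs) simp
      then show ?thesis
        using calmI[of "[e \<mapsto> a]"] calmI[of "[e \<mapsto> a, e0 \<mapsto> b]" for b] paint_e0[of e a] by (cases "e = e0") auto
    next
      case False
      then have cS: "card S = k" using k by simp
      show ?thesis
      proof (cases "e \<in> {e0, g}")
        case True
        \<comment> \<open>\<open>e0\<close> and \<open>g\<close> are nonadjacent neighbours of
          \<open>p\<close>. Giving both the same colour protects \<open>p\<close> and disposes of
          \<open>e0\<close> at the same time.\<close>
        define f where "f = (if e = g then e0 else g)"
        have "legal [e \<mapsto> a] f a"
          using True inV a e0 nb(1,3) ST by (auto simp: legal_iff f_def seen_def)
        moreover have "wins Bob [e \<mapsto> a, f \<mapsto> a]"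
          by (rule calmI) (use rep[of e0] True e0 ST in \<open>auto simp: f_def\<close>)
        ultimately show ?thesis by (rule wins_AliceI)
      next
        case ne: False
        show ?thesis
        proof (cases "e = p")
          case True
          then show ?thesis using ne by (intro paint_e0 calmI) auto
        next
          case ne_p: False
          show ?thesis
          \<comment> \<open>With two colours an edge that sees one colour is not
            \<open>tense\<close>, so the general replies fail. Here \<open>e0\<close> has just the
            two neighbours \<open>p\<close> and \<open>e\<close>, and giving them the same colour
            leaves the other colour for \<open>e0\<close>.\<close>
          proof (cases "k = 2")
            case k2: True
            then have "S = {e0, p}"
              using card_subset_eq[OF fin(1) \<open>{e0, p} \<subseteq> S\<close>] ST(5) cS by simp
            with e ne ne_p cases have e': "e \<in> T - {e0}" by auto
            then have "card {e0, e} \<le> card T" using e0 fin by (intro card_mono) auto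
            then have "T = {e0, e}"
              using card_subset_eq[OF fin(2), of "{e0, e}"] e' e0 k k2 by auto
            with nb(1) \<open>S = _\<close> e' ne_p have nb0: "nbrs e0 = {p, e}" using ST by auto
            have "legal [e \<mapsto> a] p a"
              using inV a nb(2) ST e' ne ne_p by (auto simp: legal_iff seen_def)
            moreover have "wins Bob [e \<mapsto> a, p \<mapsto> a]"
              by (rule calmI) (use safe_repeated_colour[of p e0 e] nb0 ne_p k2 in auto)
            ultimately show ?thesis by (rule wins_AliceI)
          next
            case False
            with k2 \<open>2 \<le> k\<close> have k3: "3 \<le> k" by simp
            show ?thesis
            proof (cases "e \<in> T")
              case True
              show ?thesis
              \<comment> \<open>The edge \<open>e\<close> of \<open>T\<close> is not adjacent to
                \<open>p\<close>, so once \<open>e0\<close> is coloured, \<open>p\<close> sees a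
                single colour and can wait.\<close>
              proof (rule paint_e0)
                fix b
                have "seen [e \<mapsto> a, e0 \<mapsto> b] p \<subseteq> {b}"
                  using nb(2) ST True ne by (auto simp: seen_def)
                from card_seen_le1[OF this] k3 show "wins Bob [e \<mapsto> a, e0 \<mapsto> b]"
                  by (intro tense_p) auto
              qed (use ne in simp)
            next
              case False
              with e ne ne_p cases have e': "e \<in> S - {e0, p}" by auto
              \<comment> \<open>Copying the leaf's colour to \<open>g\<close> protects
                \<open>p\<close>. The edge \<open>e0\<close> is not adjacent to \<open>g\<close>,
                sees only \<open>a\<close> and can wait.\<close>
              have "legal [e \<mapsto> a] g a"
                using inV a nb(3) ne ne_p by (auto simp: legal_iff seen_def)
              moreover have "wins Bob [e \<mapsto> a, g \<mapsto> a]"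
              proof (rule tense_e0)
                show "safe [e \<mapsto> a, g \<mapsto> a] p" using rep[of e] e' ne by auto
                have "seen [e \<mapsto> a, g \<mapsto> a] e0 \<subseteq> {a}" by (auto simp: seen_def)
                from card_seen_le1[OF this] k3 show "Suc (card (seen [e \<mapsto> a, g \<mapsto> a] e0)) < k" by simp
              qed
              ultimately show ?thesis by (rule wins_AliceI)
            qed
          qed
        qed
      qed
    qed
  qed (use V k2 in auto)
qed

text \<open>In the amaryllis, \<open>S\<close> and \<open>T\<close> are the stars at
  \<open>v\<close> and \<open>w\<close>, \<open>e0\<close> is \<open>wv\<close>, \<open>p\<close>
  and \<open>q\<close> are the triangle edges at \<open>v\<close> and \<open>g\<close> is the third
  triangle edge. Only \<open>e0\<close>, \<open>p\<close> and \<open>q\<close> can be blocked. A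
  colour shared by \<open>g\<close> and an edge of \<open>S\<close> other than \<open>p\<close> and
  \<open>q\<close> protects both \<open>p\<close> and \<open>q\<close>. An edge of \<open>T\<close>
  besides \<open>e0\<close> is needed as a place for a copy when \<open>k = 3\<close>.\<close>

lemma amaryllis_wins:
  assumes V: "V = S \<union> T \<union> {g}" and ST: "S \<inter> T = {e0}" "g \<notin> S" "g \<notin> T" "p \<in> S" "q \<in> S" "p \<noteq> e0" "q \<noteq> e0" "p \<noteq> q"
      "T \<noteq> {e0}"
    and nb: "nbrs e0 = S \<union> T - {e0}" "nbrs p = insert g (S - {p})" "nbrs q = insert g (S - {q})" "nbrs g = {p, q}"
      "\<And>y. y \<in> S - {e0, p, q} \<Longrightarrow> nbrs y = S - {y}" "\<And>t. t \<in> T - {e0} \<Longrightarrow> nbrs t = T - {t}"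
    and k: "card S \<le> k" "card T \<le> k"
  shows "wins Bob Map.empty"
proof -
  have e0: "e0 \<in> S" "e0 \<in> T" "g \<noteq> e0" "g \<noteq> p" "g \<noteq> q" "p \<notin> T" "q \<notin> T" using ST by auto
  have fin: "finite S" "finite T" using V finite_V by auto
  have sub: "{e0, p, q} \<subseteq> S" using e0 ST by auto
  from card_mono[OF fin(1) this] ST(6-8) have S3: "3 \<le> card S" by simp
  then have k3: "3 \<le> k" using k by simp
  from V have inV: "e0 \<in> V" "p \<in> V" "q \<in> V" "g \<in> V" using e0 ST by auto
  have sg: "safe c g" and sy: "y \<in> S - {e0, p, q} \<Longrightarrow> safe c y" and st: "t \<in> T - {e0} \<Longrightarrow> safe c t" for c y t
    using k k3 nb fin ST card_Diff1_less[OF fin(1), of y] card_Diff1_less[OF fin(2), of t]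
    by (auto intro!: safe_few_nbrs)
  have cases: "e = e0 \<or> e = p \<or> e = q \<or> e = g \<or> e \<in> S - {e0, p, q} \<or> e \<in> T - {e0}" if "e \<in> V" for e
    using that V by blast
  have calmI: "wins P c" if "c e0 = None \<Longrightarrow> safe c e0" "\<And>x. x \<in> {p, q} \<Longrightarrow> c x = None \<Longrightarrow> safe c x" for P c
  proof (rule calm_wins)
    fix e assume "e \<in> V" "c e = None"
    then show "safe c e" using cases[of e] that sg[of c] sy[of e c] st[of e c] by auto
  qed
  have tenseI: "wins Bob c" if "d \<in> {e0, p, q}"
    "\<And>x. x \<in> {e0, p, q} \<Longrightarrow> x \<noteq> d \<Longrightarrow> c x = None \<Longrightarrow> safe c x" "Suc (card (seen c d)) < k" for c d
  proof (rule tense_wins[of _ d])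
    fix e assume "e \<in> V" "c e = None"
    then show "e = d \<or> safe c e" using cases[of e] that(2)[of e] sg[of c] sy[of e c] st[of e c] by auto
  qed (rule that(3))
  have nbx: "nbrs x = insert g (S - {x})" if "x \<in> {p, q}" for x using nb that by auto
  have card_x: "card (nbrs x) = card S" if "x \<in> {p, q}" for x
    using nbx[OF that] that ST(2,4,5) fin S3 by auto
  have rep: "safe c x" if "x \<in> {p, q}" "s \<in> S - {x}" "c s = Some a" "c g = Some a" for c s a x
    by (rule safe_repeated_colour[of s _ g]) (use that nbx ST card_x k in auto)
  have paint_e0: "wins Alice [e \<mapsto> a]" if "e \<noteq> e0" "\<And>b. b < k \<Longrightarrow> wins Bob [e \<mapsto> a, e0 \<mapsto> b]" for e a
    by (rule wins_AliceI_bound[of e0])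
      (use that inV card_seen_le1[OF seen_single, of e a e0] k3 in auto)
  have pair: "\<exists>x'. {x, x'} = {p, q} \<and> x' \<noteq> x" if "x \<in> {p, q}" for x
    using that ST by auto
  \<comment> \<open>With three colours there are no further edges at the centre of \<open>S\<close>, and Alice has to prepare
    the colour of \<open>e0\<close> by repeating the colour of \<open>p\<close> or \<open>q\<close> on \<open>T\<close>.\<close>
  have three: "wins Bob c"
    if c: "c = (\<lambda>e. if e = x \<or> e = t then Some a else None)" and x: "x \<in> {p, q}" and t: "t \<in> T - {e0}"
      and "k = 3" "card S = 3" "a < k" for c x t a
  proof -
    have S: "S = {e0, p, q}"
      using card_subset_eq[OF fin(1) sub] ST(6-8) \<open>card S = 3\<close> by simp
    obtain x' where x': "{x, x'} = {p, q}" "x' \<noteq> x" using pair[OF x] by blast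
    then have S': "S = {e0, x, x'}" and x'pq: "x' \<in> {p, q}" using S by auto
    have xx': "y = x \<or> y = x'" if "y \<in> {p, q}" for y using that x'(1) by blast
    have neq: "x \<noteq> e0" "x' \<noteq> e0" "x \<noteq> t" "x' \<noteq> t" "g \<noteq> x" "g \<noteq> x'" "g \<noteq> t" "t \<noteq> e0" "t \<notin> S"
      using x x'pq t ST e0 by auto
    have tV: "t \<in> V" "x \<in> V" "x' \<in> V" using t x x'pq inV V by auto
    have nbg: "nbrs g = {x, x'}" using nb(4) x'(1) by simp
    show ?thesis
    proof (rule alice_wins.bob)
      have "legal c x' (if a = 0 then 1 else 0)"
        using tV neq k3 x'(2) nbx[OF x'pq] S' unfolding c by (auto simp: legal_iff seen_def)
      then show "\<exists>e a. legal c e a" by blast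
      fix e b assume leg: "legal c e b"
      then have e: "e \<in> V" "e \<noteq> x" "e \<noteq> t" "b < k" by (auto simp: legal_iff c split: if_splits)
      have ab: "b \<noteq> a" if "x \<in> nbrs e \<or> t \<in> nbrs e" using leg that neq by (auto simp: legal_iff seen_def c)
      let ?c = "c(e \<mapsto> b)"
      consider "e \<in> {e0, g}" | "e = x'" | "e \<in> T - {e0}" using cases[OF e(1)] S S' e(2) by blast
      then show "wins Alice ?c"
      proof cases
        case 1
        \<comment> \<open>The colour \<open>b\<close> on both \<open>e0\<close> and \<open>g\<close>
          protects \<open>x'\<close>, the last edge of \<open>S\<close> in danger.\<close>
        define f where "f = (if e = g then e0 else g)"
        have "b \<noteq> a" using 1 ab nb(1) nbg S' neq by auto
        have "c e0 = None" "c g = None" using neq unfolding c by simp_all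
        moreover have "f \<in> {e0, g}" "f \<noteq> e" "f \<in> V" using 1 e0 inV by (auto simp: f_def)
        moreover have "e \<notin> nbrs f" using 1 nb(1) nbg neq x'(2) e0 ST unfolding f_def by auto
        then have "seen ?c f = seen c f" by (rule seen_upd_notin)
        moreover have "seen c f \<subseteq> {a}" unfolding c by (auto simp: seen_def split: if_splits)
        ultimately have "legal ?c f b" using \<open>b \<noteq> a\<close> e(4) by (auto simp: legal_iff)
        moreover have vals: "(?c(f \<mapsto> b)) e0 = Some b" "(?c(f \<mapsto> b)) g = Some b"
          using 1 e0 by (auto simp: f_def)
        have "wins Bob (?c(f \<mapsto> b))"
        proof (rule calmI)
          fix y assume "y \<in> {p, q}"
          moreover from this have "e0 \<in> S - {y}" using e0 ST by blast
          ultimately show "safe (?c(f \<mapsto> b)) y" using rep vals by blast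
        qed (use vals in simp)
        ultimately show ?thesis by (rule wins_AliceI)
      next
        case 2
        \<comment> \<open>This is the benefit of the copy: \<open>x\<close> and \<open>t\<close>
          share the colour \<open>a\<close>, so even with \<open>x'\<close> coloured
          \<open>e0\<close> sees only two of the three colours.\<close>
        have "seen ?c e0 \<subseteq> {a, b}" by (auto simp: seen_def c split: if_splits)
        note le = card_seen_le2[OF this]
        show ?thesis
        proof (rule wins_AliceI_bound[of e0])
          fix d show "wins Bob (?c(e0 \<mapsto> d))"
          proof (rule calmI)
            fix y assume "y \<in> {p, q}" "(?c(e0 \<mapsto> d)) y = None"
            with xx'[of y] 2 show "safe (?c(e0 \<mapsto> d)) y" by (auto simp: c split: if_splits)
          qed simp
        next
          show "?c e0 = None" using 2 neq by (simp add: c)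
        qed (use le inV \<open>k = 3\<close> in simp_all)
      next
        case 3
        have "t \<in> nbrs e" using nb(6)[OF 3] t e by simp
        then have "b \<noteq> a" using ab by blast
        \<comment> \<open>Since \<open>card T <= 3\<close>, Bob's move uses up \<open>T\<close>.
          Giving \<open>x'\<close> his colour \<open>b\<close> leaves \<open>e0\<close> with four
          coloured neighbours that show only \<open>a\<close> and \<open>b\<close>.\<close>
        have "card {e0, e, t} \<le> card T" using 3 t fin e0 by (intro card_mono) auto
        then have T: "T = {e0, e, t}"
          using card_subset_eq[OF fin(2), of "{e0, e, t}"] 3 t e e0 k \<open>k = 3\<close> by auto
        have nb0: "nbrs e0 = {x, x', e, t}" using nb(1) S' T neq 3 e by auto
        have eS: "e \<notin> S" using 3 ST by auto
        have "legal ?c x' b"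
          using tV e \<open>b \<noteq> a\<close> x'(2) neq nbx[OF x'pq] S' 3 ST eS unfolding c by (auto simp: legal_iff seen_def)
        moreover have "wins Bob (?c(x' \<mapsto> b))"
        proof (rule calmI)
          have "seen (?c(x' \<mapsto> b)) e0 \<subseteq> {a, b}" by (auto simp: seen_def c split: if_splits)
          moreover have "blank_nbrs (?c(x' \<mapsto> b)) e0 = {}"
            using neq by (auto simp: blank_nbrs_def nb0 c)
          ultimately show "safe (?c(x' \<mapsto> b)) e0"
            using card_seen_le2[of "?c(x' \<mapsto> b)" e0 a b] \<open>k = 3\<close> unfolding safe_def by simp
        next
          fix y assume "y \<in> {p, q}" "(?c(x' \<mapsto> b)) y = None"
          with xx'[of y] show "safe (?c(x' \<mapsto> b)) y" by (auto simp: c split: if_splits)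
        qed
        ultimately show ?thesis by (rule wins_AliceI)
      qed
    qed
  qed
  show ?thesis
  proof (rule wins_BobI_start)
    fix e a assume e: "e \<in> V" and a: "a < k"
    show "wins Alice [e \<mapsto> a]"
    proof (cases "card S < k")
      case True
      then have "safe c x" if "x \<in> {p, q}" for c x using card_x[OF that] by (intro safe_few_nbrs) simp
      then show ?thesis
        using calmI[of "[e \<mapsto> a]"] calmI[of "[e \<mapsto> a, e0 \<mapsto> b]" for b] paint_e0[of e a] by (cases "e = e0") auto
    next
      case False
      then have cS: "card S = k" using k by simp
      \<comment> \<open>Bob opens with one of the two edges \<open>x\<close> and \<open>t\<close>,
        and Alice copies his colour to the other to reach the position treated in
        \<open>three\<close>.\<close>
      have three': "wins Alice [e \<mapsto> a]" if "e = x \<and> f = t \<or> e = t \<and> f = x" "x \<in> {p, q}" "t \<in> T - {e0}" "k = 3" for f x t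
      proof (rule wins_AliceI)
        have "x \<noteq> t" "t \<in> V" "x \<in> V" "x \<notin> T" "t \<notin> S" "t \<noteq> g" using that e0 ST inV V by auto
        then show "legal [e \<mapsto> a] f a"
          using that(1) a nbx[OF that(2)] nb(6)[OF that(3)] by (auto simp: legal_iff seen_def)
        show "wins Bob [e \<mapsto> a, f \<mapsto> a]"
          by (rule three[of _ x t a]) (use that cS a in auto)
      qed
      from cases[OF e] consider "e \<in> {e0, g}" | "e \<in> {p, q}" | "e \<in> S - {e0, p, q}" | "e \<in> T - {e0}" by blast
      then show ?thesis
      proof cases
        case 1
        define f where "f = (if e = g then e0 else g)"
        have "legal [e \<mapsto> a] f a"
          using 1 inV a e0 nb(1,4) ST by (auto simp: legal_iff f_def seen_def)
        moreover have vals: "[e \<mapsto> a, f \<mapsto> a] e0 = Some a" "[e \<mapsto> a, f \<mapsto> a] g = Some a"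
          using 1 e0 by (auto simp: f_def)
        have "wins Bob [e \<mapsto> a, f \<mapsto> a]"
        proof (rule calmI)
          fix y assume "y \<in> {p, q}"
          moreover from this have "e0 \<in> S - {y}" using e0 ST by blast
          ultimately show "safe [e \<mapsto> a, f \<mapsto> a] y" using rep vals by blast
        qed (use vals in simp)
        ultimately show ?thesis by (rule wins_AliceI)
      next
        case 2
        show ?thesis
        proof (cases "k = 3")
          case True
          from ST(9) e0(2) obtain t where "t \<in> T - {e0}" by blast
          with three'[of e t t] 2 True show ?thesis by blast
        next
          case False
          obtain x' where x': "{e, x'} = {p, q}" "x' \<noteq> e" using pair[OF 2] by blast
          show ?thesis
          \<comment> \<open>With \<open>e\<close> and \<open>e0\<close> coloured only
            \<open>x'\<close> is unsafe. It sees at most two of at least four colours.\<close>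
          proof (rule paint_e0)
            fix b show "wins Bob [e \<mapsto> a, e0 \<mapsto> b]"
            proof (rule tenseI[of x'])
              show "Suc (card (seen [e \<mapsto> a, e0 \<mapsto> b] x')) < k"
                using card_seen_le2[OF seen_double, of e a e0 b x'] False k3 by simp
            next
              fix x assume x: "x \<in> {e0, p, q}" "x \<noteq> x'" "[e \<mapsto> a, e0 \<mapsto> b] x = None"
              then have "x \<in> {p, q}" by auto
              then have "x = e" using x'(1) x(2) by blast
              with x(3) show "safe [e \<mapsto> a, e0 \<mapsto> b] x" by (simp split: if_splits)
            next
              show "x' \<in> {e0, p, q}" using x'(1) by blast
            qed
          qed (use 2 ST in auto)
        qed
      next
        case 3
        \<comment> \<open>A pendant edge in \<open>S\<close> besides the three named ones forces
          \<open>k >= 4\<close>. So after the copy to \<open>g\<close> has protected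
          \<open>p\<close> and \<open>q\<close>, the edge \<open>e0\<close> can wait.\<close>
        have "{e0, p, q, e} \<subseteq> S" using 3 sub by auto
        moreover have "card {e0, p, q, e} = 4" using 3 ST(6-8) by auto
        ultimately have k4: "4 \<le> k" using card_mono[OF fin(1)] cS by metis
        have "legal [e \<mapsto> a] g a"
          using inV a nb(4) 3 ST by (auto simp: legal_iff seen_def)
        moreover have "wins Bob [e \<mapsto> a, g \<mapsto> a]"
        proof (rule tenseI[of e0])
          fix x assume "x \<in> {e0, p, q}" "x \<noteq> e0"
          then have "x \<in> {p, q}" "e \<in> S - {x}" "e \<noteq> g" using 3 ST(2) by auto
          then show "safe [e \<mapsto> a, g \<mapsto> a] x" using rep[of x e "[e \<mapsto> a, g \<mapsto> a]" a] by simp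
        next
          show "Suc (card (seen [e \<mapsto> a, g \<mapsto> a] e0)) < k"
            using card_seen_le2[OF seen_double, of e a g a e0] k4 by simp
        qed simp
        ultimately show ?thesis by (rule wins_AliceI)
      next
        case 4
        show ?thesis
        proof (cases "k = 3")
          case True
          with three'[of p p e] 4 show ?thesis by blast
        next
          case False
          have eS: "e \<notin> S" "e \<noteq> g" "e \<noteq> p" "e \<noteq> q" using 4 ST by auto
          \<comment> \<open>The pendant edge \<open>y\<close> at the centre of \<open>S\<close> is a
            reserve: if Bob colours \<open>g\<close> differently from \<open>e0\<close>, Alice
            repeats that colour on \<open>y\<close>.\<close>
          have "\<not> S \<subseteq> {e0, p, q}"
            using card_mono[of "{e0, p, q}" S] cS False k3 by (auto simp: card_insert_if split: if_splits)
          then obtain y where y: "y \<in> S - {e0, p, q}" by blast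
          show ?thesis
          proof (rule paint_e0)
            fix b assume b: "b < k"
            let ?c = "[e \<mapsto> a, e0 \<mapsto> b]"
            show "wins Bob ?c"
            \<comment> \<open>Both \<open>p\<close> and \<open>q\<close> are still unsafe, so this
              position is not tense and Bob's second move has to be analysed. The aim is to copy the
              colour of \<open>e0\<close> to \<open>g\<close>, or else to colour the second of
              \<open>p\<close> and \<open>q\<close> once Bob has coloured the first.\<close>
            proof (rule alice_wins.bob)
              have "legal ?c g 0" using inV k3 nb(4) eS e0 ST by (auto simp: legal_iff seen_def)
              then show "\<exists>x d. legal ?c x d" by blast
              fix x d assume leg: "legal ?c x d"
              then have x: "x \<in> V" "x \<noteq> e" "x \<noteq> e0" "d < k" by (auto simp: legal_iff split: if_splits)
              let ?d = "?c(x \<mapsto> d)"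
              consider "x = g" "d = b" | "x = g" "d \<noteq> b" | "x \<in> {p, q}" | "x \<notin> {p, q, g}" by blast
              then show "wins Alice ?d"
              proof cases
                case 1
                show ?thesis
                proof (rule calmI)
                  fix z assume "z \<in> {p, q}"
                  moreover from this have "e0 \<in> S - {z}" using e0 ST by blast
                  moreover have "?d e0 = Some b" "?d g = Some b" using 1 e0 by simp_all
                  ultimately show "safe ?d z" by (rule rep)
                qed (use e0 1 in auto)
              next
                case 2
                have y': "y \<in> S" "y \<noteq> e0" "y \<noteq> e" "y \<noteq> g" using y eS ST(2) by auto
                then have "y \<in> V" "?d y = None" using V 2 by simp_all
                moreover have "seen ?d y \<subseteq> {b}"
                  using nb(5)[OF y] eS(1) ST(2) 2(1) by (auto simp: seen_def split: if_splits)
                ultimately have "legal ?d y d" using x(4) 2(2) by (auto simp: legal_iff)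
                moreover have "wins Bob (?d(y \<mapsto> d))"
                proof (rule calmI)
                  fix z assume "z \<in> {p, q}"
                  moreover from this have "y \<in> S - {z}" using y by auto
                  moreover have "y \<noteq> g" using y ST(2) by auto
                  then have "(?d(y \<mapsto> d)) y = Some d" "(?d(y \<mapsto> d)) g = Some d" using 2 by simp_all
                  ultimately show "safe (?d(y \<mapsto> d)) z" by (rule rep)
                qed (use e0 2 y' in auto)
                ultimately show ?thesis by (rule wins_AliceI)
              next
                case 3
                obtain x' where x': "{x, x'} = {p, q}" "x' \<noteq> x" using pair[OF 3] by blast
                then have x'pq: "x' \<in> {p, q}" by blast
                then have "seen ?d x' \<subseteq> {b, d}"
                  using nbx[of x'] eS ST by (auto simp: seen_def split: if_splits)
                note le = card_seen_le2[OF this]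
                show ?thesis
                proof (rule wins_AliceI_bound[of x'])
                  fix j show "wins Bob (?d(x' \<mapsto> j))"
                  proof (rule calmI)
                    fix z assume "z \<in> {p, q}" "(?d(x' \<mapsto> j)) z = None"
                    moreover from this(1) x'(1) have "z = x \<or> z = x'" by blast
                    ultimately show "safe (?d(x' \<mapsto> j)) z" by (auto split: if_splits)
                  qed (simp split: if_splits)
                next
                  show "x' \<in> V" using x'pq inV by blast
                  show "?d x' = None" using x'(2) x'pq eS ST by auto
                  show "card (seen ?d x') < k" using le k3 False by simp
                qed
              next
                case 4
                have "legal ?d g b" using inV b 4 nb(4) eS e0 ST x by (auto simp: legal_iff seen_def)
                moreover have "wins Bob (?d(g \<mapsto> b))"
                proof (rule calmI)
                  fix z assume "z \<in> {p, q}"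
                  moreover from this have "e0 \<in> S - {z}" using e0 ST by blast
                  moreover have "(?d(g \<mapsto> b)) e0 = Some b" "(?d(g \<mapsto> b)) g = Some b" using x e0 by simp_all
                  ultimately show "safe (?d(g \<mapsto> b)) z" by (rule rep)
                qed (simp split: if_splits)
                ultimately show ?thesis by (rule wins_AliceI)
              qed
            qed
          qed (use 4 in simp)
        qed
      qed
    qed
  qed (use V k3 in auto)
qed

text \<open>\<open>S\<close> is the star at the centre; \<open>p\<close>, \<open>q\<close> belong to
  the triangle with third edge \<open>g\<close>, and \<open>r\<close>, \<open>s\<close> to the one
  with third edge \<open>h\<close>. Only these four sides can be blocked. If Bob opens on a
  triangle, a copy of his colour in the other triangle protects two sides of one of them and leaves
  a single unsafe side, which can wait because \<open>4 <= k\<close>.\<close>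

lemma double_vase_wins:
  assumes V: "V = S \<union> {g, h}" and S: "g \<notin> S" "h \<notin> S" "g \<noteq> h" "{p, q, r, s} \<subseteq> S" "distinct [p, q, r, s]"
    and nb: "nbrs p = insert g (S - {p})" "nbrs q = insert g (S - {q})" "nbrs g = {p, q}"
      "nbrs r = insert h (S - {r})" "nbrs s = insert h (S - {s})" "nbrs h = {r, s}"
      "\<And>y. y \<in> S - {p, q, r, s} \<Longrightarrow> nbrs y = S - {y}"
    and k: "card S \<le> k"
  shows "wins Bob Map.empty"
proof -
  have fin: "finite S" using V finite_V by auto
  from card_mono[OF fin S(4)] S(5) have S4: "4 \<le> card S" by simp
  then have k4: "4 \<le> k" using k by simp
  \<comment> \<open>\<open>half x x' f\<close>: the edges \<open>x, x'\<close> at the centre and \<open>f\<close> form one of the two triangles.\<close>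
  define half where "half x x' f \<longleftrightarrow> {x, x'} = {p, q} \<and> f = g \<or> {x, x'} = {r, s} \<and> f = h" for x x' f
  have SV: "\<And>x. x \<in> S \<Longrightarrow> x \<in> V" "g \<in> V" "h \<in> V" using V by auto
  have half: "x \<in> S" "x' \<in> S" "x \<noteq> x'" "f \<notin> S" "nbrs x = insert f (S - {x})" "nbrs x' = insert f (S - {x'})"
    "nbrs f = {x, x'}" "half x' x f" if "half x x' f" for x x' f
    using that S nb unfolding half_def by (auto simp: doubleton_eq_iff)
  have halves: "half p q g" "half r s h" by (auto simp: half_def)
  have other: "\<exists>y y' f'. half y y' f' \<and> {f, f'} = {g, h} \<and> f' \<noteq> f \<and> {p, q, r, s} = {x, x'} \<union> {y, y'} \<and>
      {x, x'} \<inter> {y, y'} = {}" if "half x x' f" for x x' f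
  proof (cases "f = g")
    case True
    with that S(3) have "{x, x'} = {p, q}" by (auto simp: half_def)
    have "{p, q, r, s} = {p, q} \<union> {r, s}" "{p, q} \<inter> {r, s} = {}" using S(5) by auto
    moreover have "{f, h} = {g, h}" "h \<noteq> f" using True S(3) by auto
    ultimately show ?thesis using \<open>{x, x'} = {p, q}\<close> halves(2)
      by (intro exI[of _ r] exI[of _ s] exI[of _ h]) simp
  next
    case False
    with that have "{x, x'} = {r, s}" "f = h" by (auto simp: half_def)
    have "{p, q, r, s} = {r, s} \<union> {p, q}" "{r, s} \<inter> {p, q} = {}" using S(5) by auto
    moreover have "{f, g} = {g, h}" "g \<noteq> f" using \<open>f = h\<close> S(3) by auto
    ultimately show ?thesis using \<open>{x, x'} = {r, s}\<close> halves(1)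
      by (intro exI[of _ p] exI[of _ q] exI[of _ g]) simp
  qed
  have card_x: "card (nbrs x) = card S" if "half x x' f" for x x' f
    using half[OF that] fin S4 by simp
  have safe_f: "safe c f" if "half x x' f" for x x' f c
    using half(3,7)[OF that] k4 by (intro safe_few_nbrs) auto
  have safe_y: "safe c z" if "z \<in> S" "nbrs z = S - {z}" for c z
    using that k card_Diff1_less[OF fin that(1)] by (intro safe_few_nbrs) simp
  have rep: "safe c x" if "half x x' f" "z \<in> S - {x}" "c z = Some a" "c f = Some a" for c a z x x' f
    by (rule safe_repeated_colour[of z _ f]) (use that half[OF that(1)] card_x[OF that(1)] k in auto)
  have safe_rest: "safe c z" if "z \<in> V" "z \<notin> {p, q, r, s}" for c z
    using that V safe_f[OF halves(1)] safe_f[OF halves(2)] safe_y[of z] nb(7)[of z] by auto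
  have calmI: "wins P c" if "\<And>z. z \<in> {p, q, r, s} \<Longrightarrow> c z = None \<Longrightarrow> safe c z" for P c
  proof (rule calm_wins)
    fix e assume "e \<in> V" "c e = None"
    then show "safe c e" using that[of e] safe_rest[of e c] by blast
  qed
  have tenseI: "wins Bob c"
    if "\<And>z. z \<in> {p, q, r, s} \<Longrightarrow> z \<noteq> d \<Longrightarrow> c z = None \<Longrightarrow> safe c z" "Suc (card (seen c d)) < k" for c d
  proof (rule tense_wins[of _ d])
    fix e assume "e \<in> V" "c e = None"
    then show "e = d \<or> safe c e" using that(1)[of e] safe_rest[of e c] by blast
  qed (rule that(2))
  show ?thesis
  proof (rule wins_BobI_start)
    fix e a assume e: "e \<in> V" and a: "a < k"
    show "wins Alice [e \<mapsto> a]"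
    proof (cases "card S < k")
      case True
      have "safe c z" if z: "z \<in> {p, q, r, s}" for c z
      proof -
        obtain z' f where "half z z' f"
          using z halves half(8)[OF halves(1)] half(8)[OF halves(2)] by auto
        then show ?thesis using card_x True by (intro safe_few_nbrs) simp
      qed
      then show ?thesis by (intro calmI)
    next
      case False
      then have cS: "card S = k" using k by simp
      consider (tip) x x' f where "half x x' f" "e = f" | (side) x x' f where "half x x' f" "e = x"
        | (leaf) "e \<in> S - {p, q, r, s}"
        using e V halves half(8) by blast
      then show ?thesis
      proof cases
        case tip
        obtain y y' f' where y: "half y y' f'" "{f, f'} = {g, h}" "f' \<noteq> f" "{p, q, r, s} = {x, x'} \<union> {y, y'}"
          "{x, x'} \<inter> {y, y'} = {}" using other[OF tip(1)] by blast
        note hx = half[OF tip(1)] and hy = half[OF y(1)]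
        let ?c = "[e \<mapsto> a, y \<mapsto> a]"
        have "legal [e \<mapsto> a] y a"
          using tip(2) a hx hy y(3) SV by (auto simp: legal_iff seen_def)
        moreover have "wins Bob ?c"
        proof (rule tenseI[of y'])
          fix z assume "z \<in> {p, q, r, s}" "z \<noteq> y'" "?c z = None"
          then have "z \<in> {x, x'}" using y(4) by auto
          then have "\<exists>z'. half z z' f" "y \<in> S - {z}" using tip(1) hx(8) hy(1) y(5) by auto
          then show "safe ?c z" using rep[of z _ f y ?c a] tip(2) by auto
        next
          show "Suc (card (seen ?c y')) < k" using card_seen_le2[OF seen_double, of e a y a y'] k4 by simp
        qed
        ultimately show ?thesis by (rule wins_AliceI)
      next
        case side
        obtain y y' f' where y: "half y y' f'" "{f, f'} = {g, h}" "f' \<noteq> f" "{p, q, r, s} = {x, x'} \<union> {y, y'}"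
          "{x, x'} \<inter> {y, y'} = {}" using other[OF side(1)] by blast
        note hx = half[OF side(1)] and hy = half[OF y(1)]
        let ?c = "[e \<mapsto> a, f' \<mapsto> a]"
        have f': "f' \<in> V" "f' \<noteq> e" using y(2) SV side(2) hx hy by (auto simp: doubleton_eq_iff)
        then have "legal [e \<mapsto> a] f' a"
          using side(2) a hy y(5) by (auto simp: legal_iff seen_def)
        moreover have "wins Bob ?c"
        proof (rule tenseI[of x'])
          fix z assume "z \<in> {p, q, r, s}" "z \<noteq> x'" "?c z = None"
          then have "z \<in> {y, y'}" using y(4) side(2) by (auto split: if_splits)
          then have "\<exists>z'. half z z' f'" "e \<in> S - {z}" using y(1) hy(8) hx(1) y(5) side(2) by auto
          then show "safe ?c z" using rep[of z _ f' e ?c a] f'(2) by auto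
        next
          show "Suc (card (seen ?c x')) < k" using card_seen_le2[OF seen_double, of e a f' a x'] k4 by simp
        qed
        ultimately show ?thesis by (rule wins_AliceI)
      next
        case leaf
        \<comment> \<open>The copy to \<open>g\<close> protects \<open>p\<close> and
          \<open>q\<close>, but \<open>r\<close> and \<open>s\<close> both remain unsafe. Hence
          Bob's second move is needed before Alice can finish the other triangle.\<close>
        let ?c = "[e \<mapsto> a, g \<mapsto> a]"
        have egh: "e \<noteq> g" "e \<noteq> h" using leaf S by auto
        have rs: "r \<in> S" "s \<in> S" "r \<noteq> s" "r \<noteq> g" "s \<noteq> g" "r \<noteq> h" "s \<noteq> h" "r \<noteq> e" "s \<noteq> e" using S leaf by auto
        have safe_pq: "safe c z" if "z \<in> {p, q}" "c e = Some a" "c g = Some a" for c z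
        proof -
          have "\<exists>z'. half z z' g" using that(1) by (auto simp: half_def)
          then show ?thesis using rep[of z _ g e c a] that leaf by auto
        qed
        have safe_rs: "safe c z" if "z \<in> {r, s}" "c y = Some b" "c h = Some b" "y \<in> S - {r, s}" for c z y b
        proof -
          have "\<exists>z'. half z z' h" using that(1) by (auto simp: half_def)
          then show ?thesis using rep[of z _ h y c b] that by auto
        qed
        have "legal [e \<mapsto> a] g a"
          using a egh S leaf nb(3) SV by (auto simp: legal_iff seen_def)
        moreover have "wins Bob ?c"
        proof (rule alice_wins.bob)
          have "legal ?c h 0" using egh S(3) nb(6) SV k4 rs by (auto simp: legal_iff seen_def)
          then show "\<exists>x b. legal ?c x b" by blast
          fix x b assume leg: "legal ?c x b"
          then have x: "x \<in> V" "x \<noteq> e" "x \<noteq> g" "b < k" by (auto simp: legal_iff split: if_splits)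
          let ?d = "?c(x \<mapsto> b)"
          have pq_d: "safe ?d z" if "z \<in> {p, q}" for z using safe_pq[OF that, of ?d] x egh by simp
          have pq_dd: "safe (?d(y \<mapsto> j)) z" if "z \<in> {p, q}" "y \<noteq> e" "y \<noteq> g" for z y j
            using safe_pq[OF that(1), of "?d(y \<mapsto> j)"] that x egh by simp
          consider "x = h" "b = a" | "x = h" "b \<noteq> a" | y where "{x, y} = {r, s}" "x \<noteq> y" | "x \<notin> {h, r, s}"
            using rs(3) by blast
          then show "wins Alice ?d"
          proof cases
            case 1
            show ?thesis
            proof (rule calmI)
              fix z assume "z \<in> {p, q, r, s}"
              then show "safe ?d z" using pq_d safe_rs[of z ?d e a] 1 egh leaf by auto
            qed
          next
            case 2
            \<comment> \<open>\<open>p\<close> is adjacent to \<open>r\<close> and \<open>s\<close>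
              but not to \<open>h\<close>, so it can repeat the colour that Bob put on
              \<open>h\<close> and thereby protect \<open>r\<close> and \<open>s\<close>.\<close>
            have pS: "p \<in> S - {r, s}" "p \<noteq> e" "p \<noteq> g" "p \<noteq> h" using S leaf by auto
            then have "legal ?d p b"
              using x 2 nb(1) SV S egh by (auto simp: legal_iff seen_def)
            moreover have "wins Bob (?d(p \<mapsto> b))"
            proof (rule calmI)
              fix z assume "z \<in> {p, q, r, s}"
              then show "safe (?d(p \<mapsto> b)) z"
                using pq_dd[of z p b] safe_rs[of z "?d(p \<mapsto> b)" p b] 2 pS by auto
            qed
            ultimately show ?thesis by (rule wins_AliceI)
          next
            case (3 y)
            then have y: "y \<in> {r, s}" "y \<in> S" "y \<noteq> e" "y \<noteq> g" using rs by auto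
            then have "nbrs y = insert h (S - {y})" using nb(4,5) by blast
            then have "seen ?d y \<subseteq> {a, b}" by (auto simp: seen_def split: if_splits)
            note le = card_seen_le2[OF this]
            show ?thesis
            proof (rule wins_AliceI_bound[of y])
              fix j show "wins Bob (?d(y \<mapsto> j))"
              proof (rule calmI)
                fix z assume "z \<in> {p, q, r, s}" "(?d(y \<mapsto> j)) z = None"
                then have "z \<in> {p, q}" using 3 by (auto split: if_splits)
                then show "safe (?d(y \<mapsto> j)) z" using pq_dd y by blast
              qed
            qed (use le k4 y SV 3 in auto)
          next
            case 4
            have "legal ?d h a" using SV a nb(6) rs egh 4 S(3) by (auto simp: legal_iff seen_def)
            moreover have "wins Bob (?d(h \<mapsto> a))"
            proof (rule calmI)
              fix z assume "z \<in> {p, q, r, s}"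
              then show "safe (?d(h \<mapsto> a)) z"
                using pq_dd[of z h a] safe_rs[of z "?d(h \<mapsto> a)" e a] egh leaf x S(3) by auto
            qed
            ultimately show ?thesis by (rule wins_AliceI)
          qed
        qed
        ultimately show ?thesis by (rule wins_AliceI)
      qed
    qed
  qed (use V k4 in auto)
qed

end

section \<open>Candies\<close>

text \<open>\<open>A\<close> and \<open>B\<close> are the stars at the two centres of the candy. An
  edge has at most one neighbour in the other star, its partner, which leads to the same middle
  vertex.\<close>

locale candy_game = colouring_game +
  fixes A B :: "'a set"
  assumes V_eq: "V = A \<union> B" and disj: "A \<inter> B = {}"
    and clique_A: "e \<in> A \<Longrightarrow> nbrs e \<inter> A = A - {e}"
    and clique_B: "e \<in> B \<Longrightarrow> nbrs e \<inter> B = B - {e}"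
    and partner_A: "e \<in> A \<Longrightarrow> f \<in> B \<Longrightarrow> f' \<in> B \<Longrightarrow> adj e f \<Longrightarrow> adj e f' \<Longrightarrow> f = f'"
    and partner_B: "f \<in> B \<Longrightarrow> e \<in> A \<Longrightarrow> e' \<in> A \<Longrightarrow> adj f e \<Longrightarrow> adj f e' \<Longrightarrow> e = e'"
begin

lemma swap: "candy_game V adj B A"
  by unfold_locales (use V_eq disj clique_A clique_B partner_A partner_B in auto)

definition col :: "('a \<Rightarrow> nat option) \<Rightarrow> 'a set \<Rightarrow> nat set" where
  "col c X = {a. \<exists>e\<in>X. c e = Some a}"

definition blank :: "('a \<Rightarrow> nat option) \<Rightarrow> 'a set \<Rightarrow> 'a set" where
  "blank c X = {e \<in> X. c e = None}"

text \<open>If \<open>k = card A = card B\<close> and only two partners are left, Bob colours one with the last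
  colour and thereby blocks the other.\<close>

definition dead_end :: "('a \<Rightarrow> nat option) \<Rightarrow> bool" where
  "dead_end c \<longleftrightarrow> card A = card B \<and> (\<exists>x y. blank c A = {x} \<and> blank c B = {y} \<and> adj x y)"

text \<open>The two equations between cardinalities say that no colour occurs twice within one star.
  Equal colour sets ensure that a colour which is new at one centre is also new at the
  other.\<close>

definition mirrored :: "('a \<Rightarrow> nat option) \<Rightarrow> bool" where
  "mirrored c \<longleftrightarrow> col c A = col c B \<and> card (col c A) + card (blank c A) = card A \<and>
     card (col c B) + card (blank c B) = card B \<and> \<not> dead_end c"

lemma V_iff: "e \<in> V \<longleftrightarrow> e \<in> A \<or> e \<in> B"
  by (simp add: V_eq)

lemma nbrs_subset: "nbrs e \<subseteq> A \<union> B"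
  by (auto simp: nbrs_def V_iff)

lemma finite_AB: "finite A" "finite B"
  using V_eq finite_V by auto

lemma finite_col: "X \<subseteq> V \<Longrightarrow> finite (col c X)"
  by (rule finite_subset[of _ "(\<lambda>e. the (c e)) ` X"])
    (use finite_subset[OF _ finite_V] in \<open>force simp: col_def\<close>)+

lemma col_insert:
  assumes "e \<in> X" "c e = None"
  shows "col (c(e \<mapsto> a)) X = insert a (col c X)"
proof
  show "insert a (col c X) \<subseteq> col (c(e \<mapsto> a)) X"
  proof
    fix b assume "b \<in> insert a (col c X)"
    then obtain f where "f \<in> X" "f = e \<and> b = a \<or> c f = Some b" using assms(1) by (auto simp: col_def)
    then show "b \<in> col (c(e \<mapsto> a)) X" using assms(2) unfolding col_def by (intro CollectI bexI[of _ f]) auto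
  qed
qed (auto simp: col_def split: if_splits)

lemma col_notin: "e \<notin> X \<Longrightarrow> col (c(e \<mapsto> a)) X = col c X"
  by (auto simp: col_def split: if_splits)

lemma blank_upd: "blank (c(e \<mapsto> a)) X = blank c X - {e}"
  by (auto simp: blank_def)

lemma mirrored_swap: "candy_game.mirrored adj B A c = mirrored c"
proof -
  interpret swap: candy_game V adj k B A by (rule swap)
  have "swap.dead_end c = dead_end c"
    unfolding dead_end_def swap.dead_end_def swap.blank_def blank_def using adj_sym by auto
  then show ?thesis
    unfolding mirrored_def swap.mirrored_def swap.blank_def blank_def swap.col_def col_def by auto
qed

lemma legal_not_col:
  assumes "e \<in> A" "legal c e a"
  shows "a \<notin> col c A"
proof
  assume "a \<in> col c A"
  then obtain f where f: "f \<in> A" "c f = Some a" by (auto simp: col_def)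
  then have "f \<in> A - {e}" using assms(2) by (auto simp: legal_iff)
  then have "f \<in> nbrs e" using clique_A[OF assms(1)] by blast
  with f assms(2) show False by (auto simp: legal_iff seen_def)
qed

text \<open>Bob's colour is new in \<open>A\<close>, hence also in \<open>B\<close>. It is therefore
  legal on every blank edge of \<open>B\<close> that is not the partner of \<open>e\<close>, and
  using it there restores equality of the colour sets.\<close>

lemma mirrored_reply:
  assumes m: "mirrored c" and e: "e \<in> A" "legal c e a" and f: "f \<in> blank c B" "\<not> adj e f"
    and "\<not> dead_end (c(e \<mapsto> a, f \<mapsto> a))"
  shows "legal (c(e \<mapsto> a)) f a \<and> mirrored (c(e \<mapsto> a, f \<mapsto> a))"
proof
  have a: "a \<notin> col c A" "a \<notin> col c B" using legal_not_col[OF e] m by (auto simp: mirrored_def)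
  have eB: "e \<notin> B" "f \<notin> A" "e \<noteq> f" "f \<in> B" "c f = None" "c e = None" "f \<in> V" "a < k"
    using e f disj by (auto simp: blank_def legal_iff V_iff)
  have "a \<notin> seen (c(e \<mapsto> a)) f"
  proof
    assume "a \<in> seen (c(e \<mapsto> a)) f"
    then obtain g where g: "g \<in> nbrs f" "(c(e \<mapsto> a)) g = Some a" by (auto simp: seen_def)
    then have "g \<noteq> e" using f(2) adj_sym by (auto simp: nbrs_def)
    with g a show False using nbrs_subset[of f] by (auto simp: col_def)
  qed
  with eB show "legal (c(e \<mapsto> a)) f a" by (simp add: legal_iff)
  have count: "card (col c' X) + card (blank c' X) = card X"
    if "col c' X = insert a (col c X)" "a \<notin> col c X" "blank c' X = blank c X - {x}" "x \<in> blank c X"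
      "X \<subseteq> V" "card (col c X) + card (blank c X) = card X" for c' X x
  proof -
    have "finite (blank c X)" using that(5) finite_V by (auto simp: blank_def intro: finite_subset)
    then have "Suc (card (blank c' X)) = card (blank c X)" using that(3,4) by (metis card_Suc_Diff1)
    moreover have "card (col c' X) = Suc (card (col c X))" using that(1,2) finite_col[OF that(5)] by simp
    ultimately show ?thesis using that(6) by simp
  qed
  let ?c = "c(e \<mapsto> a, f \<mapsto> a)"
  have A: "col ?c A = insert a (col c A)" "blank ?c A = blank c A - {e}" "e \<in> blank c A"
    using eB e by (auto simp: col_insert col_notin blank_def)
  have B: "col ?c B = insert a (col c B)" "blank ?c B = blank c B - {f}"
    using eB by (auto simp: col_insert col_notin blank_def)
  show "mirrored ?c" unfolding mirrored_def
  proof (intro conjI)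
    show "col ?c A = col ?c B" using A(1) B(1) m by (simp add: mirrored_def)
    show "card (col ?c A) + card (blank ?c A) = card A"
      by (rule count[OF A(1) a(1) A(2,3)]) (use m V_eq in \<open>auto simp: mirrored_def\<close>)
    show "card (col ?c B) + card (blank ?c B) = card B"
      by (rule count[OF B(1) a(2) B(2) f(1)]) (use m V_eq in \<open>auto simp: mirrored_def\<close>)
  qed (rule assms(6))
qed

text \<open>The blank edges of \<open>B\<close> exceed those of \<open>A\<close> by
  \<open>card B - card A\<close>. Two blank edges of \<open>B\<close> already contain one that is
  not the partner of \<open>e\<close>. A dead end can arise only for stars of equal size with at
  most two blank edges on each side, which is why these cases are separate.\<close>

lemma mirrored_answer:
  assumes m: "mirrored c" and e: "e \<in> A" "legal c e a" and "card A \<le> card B"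
  shows "\<exists>f. legal (c(e \<mapsto> a)) f a \<and> mirrored (c(e \<mapsto> a, f \<mapsto> a))"
proof -
  have fin: "finite (blank c A)" "finite (blank c B)" using finite_AB by (auto simp: blank_def)
  have eA: "e \<in> blank c A" using e by (auto simp: blank_def legal_iff)
  then have nA: "1 \<le> card (blank c A)" using fin by (simp add: Suc_le_eq card_gt_0_iff) blast
  have eq: "card (blank c B) + card A = card (blank c A) + card B"
  proof -
    have "col c A = col c B" "card (col c A) + card (blank c A) = card A"
      "card (col c B) + card (blank c B) = card B" using m by (auto simp: mirrored_def)
    then show ?thesis by simp
  qed
  have uniq: "f = f'" if "f \<in> blank c B" "f' \<in> blank c B" "adj x f" "adj x f'" "x \<in> A" for f f' x
    using partner_A[of x f f'] that by (auto simp: blank_def)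
  have uniq': "x = x'" if "f \<in> blank c B" "adj x f" "adj x' f" "x \<in> A" "x' \<in> A" for f x x'
    using partner_B[of f x x'] that adj_sym by (auto simp: blank_def)
  have two: "\<exists>f\<in>blank c B. \<not> adj e f" if "2 \<le> card (blank c B)"
  proof (rule ccontr)
    assume "\<not> ?thesis"
    with uniq[OF _ _ _ _ e(1)] have "\<forall>f\<in>blank c B. \<forall>f'\<in>blank c B. f = f'" by blast
    with that fin show False using card_le_Suc0_iff_eq[OF fin(2)] by simp
  qed
  have "\<exists>f\<in>blank c B. \<not> adj e f \<and> \<not> dead_end (c(e \<mapsto> a, f \<mapsto> a))"
  proof (cases "card A = card B \<and> card (blank c A) \<le> 2")
    case False
    then have "2 \<le> card (blank c B)" using eq nA assms(4) by linarith
    then obtain f where f: "f \<in> blank c B" "\<not> adj e f" using two by blast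
    have "\<not> dead_end (c(e \<mapsto> a, f \<mapsto> a))"
    proof
      assume d: "dead_end (c(e \<mapsto> a, f \<mapsto> a))"
      then obtain x where x: "blank c A - {e} - {f} = {x}" and "card A = card B"
        by (auto simp: dead_end_def blank_upd)
      have "f \<notin> blank c A" using f disj by (auto simp: blank_def)
      with x have "blank c A - {e} = {x}" by blast
      with card_Suc_Diff1[OF fin(1) eA] have "card (blank c A) \<le> 2" by simp
      with False \<open>card A = card B\<close> show False by simp
    qed
    with f show ?thesis by blast
  next
    case True
    then have AB: "card (blank c B) = card (blank c A)" "card A = card B" using eq by auto
    show ?thesis
    proof (cases "card (blank c A) = 1")
      case True
      \<comment> \<open>With one blank edge on each side, the invariant itself excludes that these
        two are partners.\<close>
      then obtain f where A1: "blank c A = {e}" and B1: "blank c B = {f}"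
        using eA AB by (metis card_1_singletonE singletonD)
      then have "\<not> adj e f" using m AB(2) by (auto simp: mirrored_def dead_end_def)
      moreover have "\<not> dead_end (c(e \<mapsto> a, f \<mapsto> a))"
        using A1 by (auto simp: dead_end_def blank_upd)
      ultimately show ?thesis using B1 by blast
    next
      case False
      with True nA have "card (blank c A) = 2" by linarith
      then obtain e' where A2: "blank c A = {e, e'}" "e' \<noteq> e" using eA
        by (metis card_2_iff insertE insert_commute singletonD)
      obtain f1 f2 where B2: "blank c B = {f1, f2}" "f1 \<noteq> f2"
        using AB(1) \<open>card (blank c A) = 2\<close> by (metis card_2_iff)
      have e': "e' \<in> A" using A2 by (auto simp: blank_def)
      have alive: "\<not> dead_end (c(e \<mapsto> a, f \<mapsto> a))" if "{f, f'} = {f1, f2}" "\<not> adj e' f'" for f f'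
      proof
        assume "dead_end (c(e \<mapsto> a, f \<mapsto> a))"
        then obtain x y where xy: "blank c A - {e} - {f} = {x}" "blank c B - {e} - {f} = {y}" "adj x y"
          by (auto simp: dead_end_def blank_upd)
        with A2 have "x = e'" by blast
        moreover from xy(2) B2(1) that(1) have "y = f'" by blast
        ultimately show False using xy(3) that(2) by simp
      qed
      have f12: "f1 \<in> blank c B" "f2 \<in> blank c B" using B2 by auto
      show ?thesis
      \<comment> \<open>Partners form a matching: if \<open>e\<close>, \<open>f1\<close> or
        \<open>e'\<close>, \<open>f2\<close> are partners, then the crosswise pairs
        \<open>e\<close>, \<open>f2\<close> and \<open>e'\<close>, \<open>f1\<close> are not. So one
        of the two pairings allows both the present reply and the last one.\<close>
      proof (cases "adj e f1 \<or> adj e' f2")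
        case True
        then have "\<not> adj e f2" "\<not> adj e' f1"
          using uniq[OF f12 _ _ e(1)] uniq[OF f12 _ _ e'] uniq'[OF f12(1) _ _ e(1) e'] uniq'[OF f12(2) _ _ e(1) e'] A2(2) B2(2)
          by auto
        with alive[of f2 f1] f12 show ?thesis by blast
      next
        case False
        with alive[of f1 f2] f12 show ?thesis by blast
      qed
    qed
  qed
  with mirrored_reply[OF m e] show ?thesis by blast
qed

lemma card_nbrs_le:
  "e \<in> A \<Longrightarrow> card (nbrs e) \<le> card A" "e \<in> B \<Longrightarrow> card (nbrs e) \<le> card B"
proof -
  have *: "card (nbrs e) \<le> card X"
    if "e \<in> X" "nbrs e \<inter> X = X - {e}" "nbrs e \<subseteq> X \<union> Y" "\<forall>f\<in>nbrs e \<inter> Y. \<forall>g\<in>nbrs e \<inter> Y. f = g" "finite X" for X Y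
  proof -
    have "card (nbrs e) \<le> card (X - {e}) + card (nbrs e \<inter> Y)"
      using that(2,3) card_Un_le[of "X - {e}" "nbrs e \<inter> Y"] by (metis Int_Un_distrib inf.orderE)
    moreover have "card (nbrs e \<inter> Y) \<le> 1"
      using that(4) card_le_Suc0_iff_eq[of "nbrs e \<inter> Y"] finite_nbrs by simp
    moreover have "Suc (card (X - {e})) = card X" using that(1,5) by (rule card_Suc_Diff1[rotated])
    ultimately show ?thesis by linarith
  qed
  note sub = nbrs_subset[of e]
  show "card (nbrs e) \<le> card A" if "e \<in> A"
    by (rule *[OF that clique_A[OF that] sub]) (use partner_A[OF that] finite_AB in \<open>auto simp: nbrs_def\<close>)
  show "card (nbrs e) \<le> card B" if "e \<in> B"
    by (rule *[OF that clique_B[OF that], of A]) (use sub partner_B[OF that] finite_AB in \<open>auto simp: nbrs_def\<close>)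
qed

text \<open>Mirroring fails only when nothing but the partner of Bob's edge is blank in
  \<open>A\<close>. Then the partner \<open>g\<close> of any other blank edge \<open>y\<close> of
  \<open>B\<close> is coloured, and its colour also occurs on some \<open>h\<close> in
  \<open>B\<close> by mirroring. So \<open>y\<close> sees it twice and is safe, while edges of
  \<open>A\<close> have fewer than \<open>k\<close> neighbours anyway.\<close>

lemma exhausted_calm:
  assumes m: "mirrored c" and e: "e \<in> B" "legal c e a"
    and lt: "card A < card B" "card B \<le> k" and all: "\<forall>f\<in>blank c A. adj e f"
  shows "wins P (c(e \<mapsto> a))"
proof (rule calm_wins)
  fix y assume y: "y \<in> V" "(c(e \<mapsto> a)) y = None"
  then have cy: "c y = None" "y \<noteq> e" by (auto split: if_splits)
  have "safe c y"
  proof (cases "y \<in> A")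
    case True
    with card_nbrs_le(1)[OF this] lt show ?thesis by (intro safe_few_nbrs) simp
  next
    case False
    with y have yB: "y \<in> B" by (simp add: V_iff)
    show ?thesis
    proof (cases "nbrs y \<inter> A = {}")
      case True
      then have "nbrs y = B - {y}" using clique_B[OF yB] nbrs_subset[of y] by blast
      with card_Diff1_less[OF finite_AB(2) yB] lt(2) show ?thesis by (intro safe_few_nbrs) simp
    next
      case False
      then obtain g where g: "g \<in> nbrs y" "g \<in> A" by blast
      then have "adj g y" using adj_sym by (auto simp: nbrs_def)
      have "g \<notin> blank c A"
      proof
        assume "g \<in> blank c A"
        with all have "adj g e" using adj_sym by blast
        with partner_A[OF g(2) yB e(1) \<open>adj g y\<close>] cy(2) show False by blast
      qed
      with g(2) obtain j where j: "c g = Some j" by (auto simp: blank_def)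
      with g(2) m have "j \<in> col c B" by (auto simp: mirrored_def col_def)
      then obtain h where h: "h \<in> B" "c h = Some j" by (auto simp: col_def)
      then have "h \<in> B - {y}" using cy(1) by auto
      then have "h \<in> nbrs y" using clique_B[OF yB] by blast
      moreover have "g \<noteq> h" using g(2) h(1) disj by blast
      ultimately show ?thesis
        using safe_repeated_colour[OF g(1) _ _ j h(2)] card_nbrs_le(2)[OF yB] lt(2) by simp
    qed
  qed
  then show "safe (c(e \<mapsto> a)) y" by (rule safe_upd[OF e(2)])
qed

text \<open>A move in the smaller star can always be mirrored. A move in a strictly larger one can
  be mirrored until \<open>A\<close> offers only the partner, and then \<open>exhausted_calm\<close>
  ends the game. Stars of equal size are symmetric.\<close>

lemma mirrored_wins:
  assumes "mirrored c" and AB: "card A \<le> card B" "card B \<le> k"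
  shows "wins Bob c"
  using assms(1)
proof (induction "card {f \<in> V. c f = None}" arbitrary: c rule: less_induct)
  case less
  note m = less.prems
  show ?case
  proof (cases "\<forall>e\<in>V. c e \<noteq> None")
    case True
    then show ?thesis by (rule alice_wins.full)
  next
    case False
    then obtain e where e: "e \<in> V" "c e = None" by blast
    \<comment> \<open>Bob must have a legal move. An uncoloured edge sees only colours of the common
      set, and this set has fewer than \<open>k\<close> elements as long as some edge is
      blank.\<close>
    have "card (seen c e) < k"
    proof -
      have "seen c e \<subseteq> col c A \<union> col c B"
        using nbrs_subset[of e] by (auto simp: seen_def col_def)
      then have "seen c e \<subseteq> col c A" "seen c e \<subseteq> col c B" using m by (simp_all add: mirrored_def)
      then have le: "card (seen c e) \<le> card (col c A)" "card (seen c e) \<le> card (col c B)"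
        using finite_col[of A c] finite_col[of B c] V_eq by (auto intro: card_mono)
      have "blank c A \<noteq> {} \<or> blank c B \<noteq> {}" using e by (auto simp: blank_def V_iff)
      then have "0 < card (blank c A) \<or> 0 < card (blank c B)"
        using finite_AB by (auto simp: card_gt_0_iff blank_def)
      with le m AB show ?thesis unfolding mirrored_def by linarith
    qed
    from ex_legal[of e c, OF e this] have ex: "\<exists>e a. legal c e a" by blast
    have reply: "wins Alice (c(e \<mapsto> a))"
      if "legal c e a" "legal (c(e \<mapsto> a)) f b" "mirrored (c(e \<mapsto> a, f \<mapsto> b))" for e a f b
    proof -
      have "card {g \<in> V. (c(e \<mapsto> a, f \<mapsto> b)) g = None} < card {f \<in> V. c f = None}"
        using card_uncoloured_less[OF finite_V that(1)] card_uncoloured_less[OF finite_V that(2)] by simp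
      from less.hyps[OF this that(3)] that(2) show ?thesis by (rule wins_AliceI[rotated])
    qed
    interpret swap: candy_game V adj k B A by (rule swap)
    have m': "swap.mirrored c" using m mirrored_swap by simp
    show ?thesis
    proof (rule alice_wins.bob[OF ex])
      fix e a assume leg: "legal c e a"
      then have "e \<in> A \<or> e \<in> B" by (simp add: legal_iff V_iff)
      then show "wins Alice (c(e \<mapsto> a))"
      proof
        assume "e \<in> A"
        from mirrored_answer[OF m this leg AB(1)] reply[OF leg] show ?thesis by blast
      next
        assume eB: "e \<in> B"
        show ?thesis
        proof (cases "card A = card B")
          case True
          with swap.mirrored_answer[OF m' eB leg] reply[OF leg] mirrored_swap show ?thesis by auto
        next
          case False
          with AB have lt: "card A < card B" by simp
          show ?thesis
          proof (cases "\<forall>f\<in>blank c A. adj e f")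
            case True
            from exhausted_calm[OF m eB leg lt AB(2) True] show ?thesis .
          next
            case ex: False
            then obtain f where f: "f \<in> blank c A" "\<not> adj e f" by blast
            then have f': "f \<in> swap.blank c A" by (simp add: blank_def swap.blank_def)
            have "\<not> swap.dead_end (c(e \<mapsto> a, f \<mapsto> a))" using lt by (simp add: swap.dead_end_def)
            from swap.mirrored_reply[OF m' eB leg f' f(2) this] reply[OF leg] mirrored_swap
            show ?thesis by auto
          qed
        qed
      qed
    qed
  qed
qed

text \<open>If \<open>card B < k\<close>, no edge has \<open>k\<close> neighbours. Otherwise
  \<open>card B = k >= 2\<close>, so the empty colouring is not a dead end and mirroring can
  start.\<close>

lemma candy_wins_le:
  assumes "card A \<le> card B" "card B \<le> k" "2 \<le> k"
  shows "wins Bob Map.empty"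
proof (cases "card B < k")
  case True
  have "safe c e" if "e \<in> V" for c e
    using that card_nbrs_le[of e] True assms(1) by (intro safe_few_nbrs) (auto simp: V_iff)
  then show ?thesis by (intro calm_wins)
next
  case False
  with assms have "card B \<noteq> 1" by simp
  then have "\<nexists>y. B = {y}" by auto
  then have "mirrored Map.empty" by (auto simp: mirrored_def dead_end_def blank_def col_def)
  then show ?thesis using assms(1,2) by (rule mirrored_wins)
qed

lemma candy_wins:
  assumes "card A \<le> k" "card B \<le> k" "2 \<le> k"
  shows "wins Bob Map.empty"
  using candy_wins_le candy_game.candy_wins_le[OF swap] assms by (cases "card A \<le> card B") auto

end

section \<open>Winning strategies of Bob\<close>

text \<open>Allows a win on the edges of an embedded pattern to be read as a win on the positions of
  the list that describes it.\<close>

lemma alice_wins_transfer: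
  assumes "alice_wins V adj k p c" "bij_betw h W V"
    and "\<And>x y. x \<in> W \<Longrightarrow> y \<in> W \<Longrightarrow> adj' x y \<longleftrightarrow> adj (h x) (h y)"
    and "\<forall>x\<in>W. c' x = c (h x)"
  shows "alice_wins W adj' k p c'"
proof -
  have V: "V = h ` W" and inj: "inj_on h W" using assms(2) by (auto simp: bij_betw_def)
  have paint: "paintable W adj' k c' x a \<longleftrightarrow> paintable V adj k c (h x) a"
    if "\<forall>x\<in>W. c' x = c (h x)" "x \<in> W" for c c' x a
    using that assms(3) unfolding paintable_def V by auto
  have upd: "\<forall>y\<in>W. (c'(x \<mapsto> a)) y = (c(h x \<mapsto> a)) (h y)"
    if "\<forall>x\<in>W. c' x = c (h x)" "x \<in> W" for c c' x a
    using that inj by (auto simp: inj_on_eq_iff)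
  show ?thesis
    using assms(1,4)
  proof (induction arbitrary: c' rule: alice_wins.induct)
    case (full c p)
    then show ?case by (intro alice_wins.full) (auto simp: V)
  next
    case (alice c e a)
    then obtain x where x: "x \<in> W" "e = h x" by (auto simp: paintable_def V)
    have "paintable W adj' k c' x a" using paint[OF alice.prems x(1)] alice.hyps(1) x(2) by simp
    moreover have "alice_wins W adj' k Bob (c'(x \<mapsto> a))"
      by (rule alice.IH) (use upd[OF alice.prems x(1)] x(2) in blast)
    ultimately show ?case by (rule alice_wins.alice)
  next
    case (bob c)
    show ?case
    proof (rule alice_wins.bob)
      from bob.hyps(1) obtain e a where "paintable V adj k c e a" by blast
      then obtain x where x: "x \<in> W" "paintable V adj k c (h x) a" by (auto simp: paintable_def V)
      with paint[OF bob.prems x(1)] show "\<exists>x a. paintable W adj' k c' x a" by blast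
    next
      fix x a assume p: "paintable W adj' k c' x a"
      then have x: "x \<in> W" by (simp add: paintable_def)
      show "alice_wins W adj' k Alice (c'(x \<mapsto> a))"
        by (rule bob.IH[of "h x" a]) (use paint[OF bob.prems x] p upd[OF bob.prems x] in blast)+
    qed
  qed
qed

lemma alice_wins_Alice_cases:
  "alice_wins V adj k Alice c \<Longrightarrow>
    (\<forall>e\<in>V. c e \<noteq> None) \<or> (\<exists>e a. paintable V adj k c e a \<and> alice_wins V adj k Bob (c(e \<mapsto> a)))"
  by (erule alice_wins.cases) auto

lemma alice_wins_Bob_cases:
  "alice_wins V adj k Bob c \<Longrightarrow> paintable V adj k c e a \<Longrightarrow> alice_wins V adj k Alice (c(e \<mapsto> a))"
  by (erule alice_wins.cases) (auto simp: paintable_def)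

text \<open>Colours are never removed, so a blocked edge stays blocked and uncoloured, whereas every
  won play ends with all edges coloured.\<close>

lemma alice_loses_if_blocked:
  assumes "alice_wins V adj k p c" "e \<in> V" "c e = None" "\<forall>a<k. \<exists>f\<in>V. adj e f \<and> c f = Some a"
  shows False
  using assms
proof (induction rule: alice_wins.induct)
  case (alice c f a)
  then have "f \<noteq> e" by (auto simp: paintable_def)
  moreover have "\<forall>b<k. \<exists>g\<in>V. adj e g \<and> (c(f \<mapsto> a)) g = Some b"
    using alice.hyps(1) alice.prems(3) by (fastforce simp: paintable_def)
  ultimately show ?case using alice.IH alice.prems by simp
next
  case (bob c)
  then obtain f a where f: "paintable V adj k c f a" by blast
  with bob have "f \<noteq> e" by (auto simp: paintable_def)
  moreover have "\<forall>b<k. \<exists>g\<in>V. adj e g \<and> (c(f \<mapsto> a)) g = Some b"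
    using f bob.prems(3) by (fastforce simp: paintable_def)
  ultimately show ?case using bob.IH[OF f] bob.prems by simp
qed blast

section \<open>Finite patterns and an executable search for Bob's wins\<close>

type_synonym pattern = "(nat \<times> nat) list"

definition shares_end :: "pattern \<Rightarrow> nat \<Rightarrow> nat \<Rightarrow> bool" where
  "shares_end es p q \<longleftrightarrow> p \<noteq> q \<and>
     (case es ! p of (a, b) \<Rightarrow> case es ! q of (c, d) \<Rightarrow> a = c \<or> a = d \<or> b = c \<or> b = d)"

text \<open>A partial colouring is given by a list that assigns \<open>Suc a\<close> to the edges of colour \<open>a\<close> and
  \<open>0\<close> to the uncoloured edges.\<close>

definition decode :: "nat list \<Rightarrow> nat \<Rightarrow> nat option" where
  "decode cs p = (if cs ! p = 0 then None else Some (cs ! p - 1))"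

definition blockedb :: "pattern \<Rightarrow> nat \<Rightarrow> nat list \<Rightarrow> bool" where
  "blockedb es k cs \<longleftrightarrow> (\<exists>p\<in>set [0..<length es]. cs ! p = 0 \<and>
     (\<forall>a\<in>set [0..<k]. \<exists>q\<in>set [0..<length es]. cs ! q = Suc a \<and> shares_end es p q))"

definition legalb :: "pattern \<Rightarrow> nat list \<Rightarrow> nat \<Rightarrow> nat \<Rightarrow> bool" where
  "legalb es cs p a \<longleftrightarrow> cs ! p = 0 \<and> (\<forall>q\<in>set [0..<length es]. cs ! q \<noteq> Suc a \<or> \<not> shares_end es p q)"

text \<open>The number bounds Bob's remaining moves. The clause that demands an uncoloured edge
  keeps a completely coloured position, in which Alice has no reply either, from counting as a win
  of Bob through the empty quantifier.\<close>

fun bob_beats :: "pattern \<Rightarrow> nat \<Rightarrow> nat \<Rightarrow> nat list \<Rightarrow> bool" where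
  "bob_beats es k 0 cs \<longleftrightarrow> blockedb es k cs"
| "bob_beats es k (Suc n) cs \<longleftrightarrow> blockedb es k cs \<or>
     (\<exists>p\<in>set [0..<length es]. \<exists>a\<in>set [0..<k]. legalb es cs p a \<and>
       (let cs' = cs[p := Suc a] in blockedb es k cs' \<or>
        (\<exists>q\<in>set [0..<length es]. cs' ! q = 0) \<and>
        (\<forall>q\<in>set [0..<length es]. \<forall>b\<in>set [0..<k]. \<not> legalb es cs' q b \<or> bob_beats es k n (cs'[q := Suc b]))))"

lemma blockedb_loses:
  assumes "blockedb es k cs"
  shows "\<not> alice_wins {..<length es} (shares_end es) k p (decode cs)"
proof
  assume a: "alice_wins {..<length es} (shares_end es) k p (decode cs)"
  from assms obtain e where "e < length es" "cs ! e = 0"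
    "\<forall>a<k. \<exists>q<length es. cs ! q = Suc a \<and> shares_end es e q"
    by (auto simp: blockedb_def Ball_def Bex_def)
  then show False
    by (intro alice_loses_if_blocked[OF a, of e]) (fastforce simp: decode_def)+
qed

lemma legalb_iff:
  assumes "p < length es" "a < k"
  shows "paintable {..<length es} (shares_end es) k (decode cs) p a \<longleftrightarrow> legalb es cs p a"
proof -
  have "decode cs f \<noteq> Some a \<longleftrightarrow> cs ! f \<noteq> Suc a" for f by (auto simp: decode_def)
  then show ?thesis using assms by (auto simp: paintable_def legalb_def decode_def)
qed

lemma decode_upd: "p < length cs \<Longrightarrow> (decode cs)(p \<mapsto> a) = decode (cs[p := Suc a])"
  by (auto simp: decode_def fun_eq_iff nth_list_update)

lemma bob_beats_loses:
  assumes "bob_beats es k n cs" "length cs = length es"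
  shows "\<not> alice_wins {..<length es} (shares_end es) k Bob (decode cs)"
  using assms
proof (induction n arbitrary: cs)
  case 0
  then show ?case using blockedb_loses by simp
next
  case (Suc n)
  show ?case
  proof
    assume w: "alice_wins {..<length es} (shares_end es) k Bob (decode cs)"
    then have "\<not> blockedb es k cs" using blockedb_loses by blast
    with Suc.prems obtain p a where p: "p < length es" "a < k" "legalb es cs p a"
      and rest: "blockedb es k (cs[p := Suc a]) \<or> (\<exists>q<length es. cs[p := Suc a] ! q = 0) \<and>
        (\<forall>q<length es. \<forall>b<k. legalb es (cs[p := Suc a]) q b \<longrightarrow> bob_beats es k n (cs[p := Suc a, q := Suc b]))"
      unfolding bob_beats.simps Let_def set_upt Bex_def Ball_def atLeastLessThan_iff by blast
    let ?cs = "cs[p := Suc a]"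
    have w: "alice_wins {..<length es} (shares_end es) k Alice (decode ?cs)"
      using alice_wins_Bob_cases[OF w] p Suc.prems(2) by (metis decode_upd legalb_iff)
    with rest blockedb_loses obtain q where q: "q < length es" "?cs ! q = 0"
      and all: "\<And>q b. q < length es \<Longrightarrow> b < k \<Longrightarrow> legalb es ?cs q b \<Longrightarrow> bob_beats es k n (?cs[q := Suc b])" by blast
    from q have "\<not> (\<forall>e\<in>{..<length es}. decode ?cs e \<noteq> None)" by (auto simp: decode_def)
    with alice_wins_Alice_cases[OF w] obtain r b where r:
      "paintable {..<length es} (shares_end es) k (decode ?cs) r b"
      "alice_wins {..<length es} (shares_end es) k Bob ((decode ?cs)(r \<mapsto> b))"
      by blast
    then have rb: "r < length es" "b < k" by (auto simp: paintable_def)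
    with r(1) have "legalb es ?cs r b" by (simp add: legalb_iff)
    from Suc.IH[OF all[OF rb this]] r(2) rb Suc.prems(2) show False by (simp add: decode_upd)
  qed
qed

definition cliqueb :: "pattern \<Rightarrow> nat list \<Rightarrow> bool" where
  "cliqueb es S \<longleftrightarrow> (\<forall>p\<in>set S. \<forall>q\<in>set S. p = q \<or> shares_end es p q)"

text \<open>Listing every edge with \<open>i < j\<close> makes \<open>distinct es\<close> mean that
  the edges are distinct. The two conditions on \<open>subseqs\<close> say that the largest clique
  of the line graph has size \<open>k\<close>; the constant 3 is the number of moves granted to
  Bob.\<close>

definition bad_pattern :: "pattern \<Rightarrow> nat \<Rightarrow> nat \<Rightarrow> bool" where
  "bad_pattern es n k \<longleftrightarrow>
     list_all (\<lambda>(i, j). i < n \<and> j < n \<and> i < j) es \<and> distinct es \<and>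
     list_all (\<lambda>S. length S \<le> k \<or> \<not> cliqueb es S) (subseqs [0..<length es]) \<and>
     list_ex (\<lambda>S. cliqueb es S \<and> length S = k) (subseqs [0..<length es]) \<and>
     bob_beats es k 3 (replicate (length es) 0)"

definition pattern_edge :: "(nat \<Rightarrow> 'a) \<Rightarrow> nat \<times> nat \<Rightarrow> 'a set" where
  "pattern_edge g = (\<lambda>(i, j). {g i, g j})"

definition embeds :: "'a set set \<Rightarrow> nat \<Rightarrow> pattern \<Rightarrow> bool" where
  "embeds E n es \<longleftrightarrow> (\<exists>g. inj_on g {..<n} \<and> pattern_edge g ` set es \<subseteq> E)"

lemma filter_in_subseqs: "filter P xs \<in> set (subseqs xs)"
  by (induction xs) (auto simp: Let_def)

text \<open>The image of the pattern is one of the edge sets \<open>F\<close> that line perfection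
  quantifies over, and its clique number is \<open>k\<close>. Perfection would let Alice win there
  with \<open>k\<close> colours, and the transfer to list positions contradicts the search.\<close>

lemma bad_pattern_not_perfect:
  assumes bad: "bad_pattern es n k" and "embeds (edges G) n es"
  shows "\<not> line_perfect Bob None G"
proof
  assume perfect: "line_perfect Bob None G"
  from assms(2) obtain g where g: "inj_on g {..<n}" and sub: "pattern_edge g ` set es \<subseteq> edges G"
    by (auto simp: embeds_def)
  define h where "h p = pattern_edge g (es ! p)" for p
  let ?F = "pattern_edge g ` set es"
  let ?n = "length es"
  have F: "?F = h ` {..<?n}"
    unfolding h_def set_conv_nth by blast
  have ends: "case es ! p of (i, j) \<Rightarrow> i < n \<and> j < n \<and> i < j" if "p < ?n" for p
    using bad that unfolding bad_pattern_def list_all_iff by (metis nth_mem)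
  have h_eq: "h p = h q \<longleftrightarrow> p = q" and h_adj: "shares_end es p q \<longleftrightarrow> adjacent (h p) (h q)"
    if "p < ?n" "q < ?n" for p q
  proof -
    obtain a b c d where abcd: "es ! p = (a, b)" "es ! q = (c, d)" by (metis surj_pair)
    have lt: "a < n" "b < n" "c < n" "d < n" "a < b" "c < d"
      using ends[OF that(1)] ends[OF that(2)] abcd by auto
    have ge: "g x = g y \<longleftrightarrow> x = y" if "x < n" "y < n" for x y
      using inj_on_eq_iff[OF g] that by simp
    show eq: "h p = h q \<longleftrightarrow> p = q"
    proof
      assume "h p = h q"
      then have "es ! p = es ! q"
        unfolding h_def pattern_edge_def abcd using lt by (auto simp: doubleton_eq_iff ge)
      then show "p = q" using that bad by (simp add: bad_pattern_def nth_eq_iff_index_eq)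
    qed simp
    show "shares_end es p q \<longleftrightarrow> adjacent (h p) (h q)"
      unfolding adjacent_def eq unfolding shares_end_def h_def pattern_edge_def abcd
      using lt by (auto simp: ge)
  qed
  have inj: "inj_on h {..<?n}" using h_eq by (auto intro: inj_onI)
  have fin: "finite (edges (edge_graph ?F))" by (simp add: edge_graph_def)
  have "omega_line (edge_graph ?F) = k"
  proof (rule antisym)
    obtain C where C: "C \<subseteq> ?F" "\<And>e f. e \<in> C \<Longrightarrow> f \<in> C \<Longrightarrow> e \<noteq> f \<Longrightarrow> adjacent e f"
      "card C = omega_line (edge_graph ?F)"
      using omega_line_attained[OF fin] by (auto simp: edge_graph_def)
    \<comment> \<open>The clique is listed by increasing positions, so that it occurs among the
      \<open>subseqs\<close> that the check enumerates.\<close>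
    define S where "S = filter (\<lambda>p. h p \<in> C) [0..<?n]"
    have "h ` set S = C" using C(1) F by (auto simp: S_def)
    moreover have "inj_on h (set S)" using inj by (auto simp: S_def intro: inj_on_subset)
    ultimately have "card C = length S"
      by (metis S_def card_image distinct_card distinct_filter distinct_upt)
    moreover have "p = q \<or> shares_end es p q" if "p \<in> set S" "q \<in> set S" for p q
      using that C(2)[of "h p" "h q"] h_adj[of p q] h_eq[of p q] by (auto simp: S_def)
    then have "cliqueb es S" by (simp add: cliqueb_def)
    moreover have "S \<in> set (subseqs [0..<?n])" unfolding S_def by (simp add: filter_in_subseqs)
    ultimately show "omega_line (edge_graph ?F) \<le> k"
      using bad C(3) unfolding bad_pattern_def list_all_iff by metis
  next
    from bad obtain S where S: "S \<in> set (subseqs [0..<?n])" "cliqueb es S" "length S = k"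
      by (auto simp: bad_pattern_def list_ex_iff)
    have "set S \<in> set ` set (subseqs [0..<?n])" using S(1) by (rule imageI)
    then have sub: "set S \<subseteq> {..<?n}" unfolding subseqs_powset by auto
    have "distinct S" using subseqs_distinctD[OF S(1)] by simp
    then have "card (h ` set S) = k"
      using S(3) sub inj by (metis card_image distinct_card inj_on_subset)
    moreover have "card (h ` set S) \<le> omega_line (edge_graph ?F)"
      by (rule omega_line_ge[OF fin])
        (use sub S(2) h_adj h_eq F in \<open>auto simp: edge_graph_def cliqueb_def subset_iff\<close>)
    ultimately show "k \<le> omega_line (edge_graph ?F)" by simp
  qed
  with perfect sub game_index_eq_omega_iff[OF fin, of Bob]
  have "alice_wins ?F adjacent k Bob Map.empty"
    unfolding line_perfect_def by (metis edge_graph_def sgraph.select_convs(2))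
  moreover have "bij_betw h {..<?n} ?F" using inj F by (simp add: bij_betw_def)
  ultimately have "alice_wins {..<?n} (shares_end es) k Bob (decode (replicate ?n 0))"
    by (rule alice_wins_transfer) (use h_adj in \<open>auto simp: decode_def\<close>)
  moreover have "bob_beats es k 3 (replicate ?n 0)" using bad by (simp add: bad_pattern_def)
  ultimately show False using bob_beats_loses by simp
qed

abbreviation "P5_P2 \<equiv> [(5,6),(0,1),(1,2),(2,3),(3,4)] :: pattern"
abbreviation "C4_P2 \<equiv> [(4,5),(0,1),(1,2),(2,3),(0,3)] :: pattern"
abbreviation "P6 \<equiv> [(2,3),(0,1),(1,2),(3,4),(4,5)] :: pattern"
abbreviation "C5 \<equiv> [(0,1),(1,2),(2,3),(3,4),(0,4)] :: pattern"
abbreviation "Bull \<equiv> [(0,1),(1,2),(0,2),(0,3),(1,4)] :: pattern"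
abbreviation "Diamond \<equiv> [(0,1),(0,2),(0,3),(1,2),(1,3)] :: pattern"
abbreviation "F1 \<equiv> [(0,1),(0,2),(0,3),(2,4),(2,5),(3,6),(3,7)] :: pattern"

text \<open>The winning first move of Bob is the first edge of each pattern.\<close>

lemma bad_patterns:
  "bad_pattern P5_P2 7 2" "bad_pattern C4_P2 6 2" "bad_pattern P6 6 2" "bad_pattern C5 5 2"
  "bad_pattern Bull 5 3" "bad_pattern Diamond 4 3"
  by code_simp+

text \<open>After Bob colours \<open>vu\<close>, he can block \<open>vw1\<close> or
  \<open>vw2\<close> at once unless Alice repeats his colour on a leaf edge, say at
  \<open>w1\<close>. Then a second colour on a leaf edge at \<open>w2\<close> forces her to give
  \<open>vw2\<close> the third one, and Bob blocks \<open>vw1\<close> with the second colour on the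
  other leaf edge at \<open>w1\<close>.\<close>

lemma bad_F1: "bad_pattern F1 8 3" by code_simp

section \<open>Graphs without paths on five vertices and cycles on four vertices\<close>

locale edge_set =
  fixes E :: "'a set set"
  assumes finite_E: "finite E" and card_edge: "e \<in> E \<Longrightarrow> card e = 2"
begin

abbreviation R :: "'a \<Rightarrow> 'a \<Rightarrow> bool" where
  "R x y \<equiv> {x, y} \<in> E"

lemma R_sym: "R x y \<Longrightarrow> R y x"
  by (simp add: insert_commute)

lemma R_irrefl: "\<not> R x x"
  using card_edge by fastforce

lemma R_neq: "R x y \<Longrightarrow> x \<noteq> y"
  using R_irrefl by blast

lemma edge_cases:
  assumes "e \<in> E"
  obtains x y where "e = {x, y}" "R x y" "x \<noteq> y"
  using card_edge[OF assms] assms by (auto simp: card_2_iff)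

definition N :: "'a \<Rightarrow> 'a set" where
  "N x = {y. R x y}"

lemma finite_N: "finite (N x)"
proof (rule finite_subset)
  show "N x \<subseteq> \<Union>E" by (auto simp: N_def)
  show "finite (\<Union>E)" using finite_E card_edge by (auto simp: card_ge_0_finite)
qed

end

definition double_star_edges :: "'a \<Rightarrow> 'a \<Rightarrow> 'a set \<Rightarrow> 'a set \<Rightarrow> 'a set set" where
  "double_star_edges w1 w2 X Y = {{w1, w2}} \<union> (\<lambda>x. {w1, x}) ` X \<union> (\<lambda>y. {w2, y}) ` Y"

definition vase_edges :: "'a \<Rightarrow> 'a \<Rightarrow> 'a \<Rightarrow> 'a set \<Rightarrow> 'a set set" where
  "vase_edges w1 w2 w3 X = {{w1, w2}, {w2, w3}, {w1, w3}} \<union> (\<lambda>x. {w1, x}) ` X"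

definition candy_edges :: "'a \<Rightarrow> 'a \<Rightarrow> 'a set \<Rightarrow> 'a set \<Rightarrow> 'a set \<Rightarrow> 'a set set" where
  "candy_edges v1 v2 W X Y =
     (\<lambda>x. {v1, x}) ` W \<union> (\<lambda>x. {v2, x}) ` W \<union> (\<lambda>x. {v1, x}) ` X \<union> (\<lambda>y. {v2, y}) ` Y"

definition shooting_star_edges :: "'a \<Rightarrow> 'a \<Rightarrow> 'a \<Rightarrow> 'a \<Rightarrow> 'a set \<Rightarrow> 'a set \<Rightarrow> 'a set set" where
  "shooting_star_edges v w a b X Y =
     {{w, v}, {v, a}, {a, b}} \<union> (\<lambda>x. {w, x}) ` X \<union> (\<lambda>y. {v, y}) ` Y"

definition double_vase_edges :: "'a \<Rightarrow> 'a \<Rightarrow> 'a \<Rightarrow> 'a \<Rightarrow> 'a \<Rightarrow> 'a set \<Rightarrow> 'a set set" where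
  "double_vase_edges v x1 x2 y1 y2 X =
     {{v, x1}, {x1, x2}, {x2, v}, {v, y1}, {y1, y2}, {y2, v}} \<union> (\<lambda>x. {v, x}) ` X"

definition amaryllis_edges :: "'a \<Rightarrow> 'a \<Rightarrow> 'a \<Rightarrow> 'a \<Rightarrow> 'a set \<Rightarrow> 'a set \<Rightarrow> 'a set set" where
  "amaryllis_edges v w c1 c2 X Y =
     {{w, v}, {v, c1}, {c1, c2}, {c2, v}} \<union> (\<lambda>x. {w, x}) ` X \<union> (\<lambda>y. {v, y}) ` Y"

definition vertices_distinct :: "'a list \<Rightarrow> 'a set list \<Rightarrow> bool" where
  "vertices_distinct cs Xs \<longleftrightarrow> distinct cs \<and> (\<forall>X\<in>set Xs. finite X \<and> set cs \<inter> X = {}) \<and>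
     (\<forall>i<length Xs. \<forall>j<i. Xs ! i \<inter> Xs ! j = {})"

definition double_star_set :: "'a set set \<Rightarrow> bool" where
  "double_star_set E \<longleftrightarrow> (\<exists>w1 w2 X Y. vertices_distinct [w1, w2] [X, Y] \<and> E = double_star_edges w1 w2 X Y)"

definition vase_set :: "'a set set \<Rightarrow> bool" where
  "vase_set E \<longleftrightarrow> (\<exists>w1 w2 w3 X. vertices_distinct [w1, w2, w3] [X] \<and> E = vase_edges w1 w2 w3 X)"

definition candy_set :: "'a set set \<Rightarrow> bool" where
  "candy_set E \<longleftrightarrow> (\<exists>v1 v2 W X Y. vertices_distinct [v1, v2] [W, X, Y] \<and> W \<noteq> {} \<and> E = candy_edges v1 v2 W X Y)"

definition shooting_star_set :: "'a set set \<Rightarrow> bool" where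
  "shooting_star_set E \<longleftrightarrow> (\<exists>v w a b X Y. vertices_distinct [v, w, a, b] [X, Y] \<and> E = shooting_star_edges v w a b X Y)"

definition double_vase_set :: "'a set set \<Rightarrow> bool" where
  "double_vase_set E \<longleftrightarrow> (\<exists>v x1 x2 y1 y2 X. vertices_distinct [v, x1, x2, y1, y2] [X] \<and> E = double_vase_edges v x1 x2 y1 y2 X)"

definition amaryllis_set :: "'a set set \<Rightarrow> bool" where
  "amaryllis_set E \<longleftrightarrow> (\<exists>v w c1 c2 X Y. vertices_distinct [v, w, c1, c2] [X, Y] \<and> E = amaryllis_edges v w c1 c2 X Y)"

context edge_set
begin

definition P5_C4_free :: bool where
  "P5_C4_free \<longleftrightarrow>
     (\<forall>a b c d e. distinct [a, b, c, d, e] \<longrightarrow> R a b \<longrightarrow> R b c \<longrightarrow> R c d \<longrightarrow> R d e \<longrightarrow> False) \<and>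
     (\<forall>a b c d. distinct [a, b, c, d] \<longrightarrow> R a b \<longrightarrow> R b c \<longrightarrow> R c d \<longrightarrow> R d a \<longrightarrow> False)"

text \<open>The edge set of a union of connected components.\<close>

definition closed_part :: "'a set set \<Rightarrow> bool" where
  "closed_part S \<longleftrightarrow> S \<subseteq> E \<and> (\<forall>e\<in>S. \<forall>x\<in>e. \<forall>y. R x y \<longrightarrow> {x, y} \<in> S)"

text \<open>A pendant neighbour \<open>p\<close> of \<open>x\<close> with a further neighbour
  \<open>q\<close> would yield the path \<open>q\<close>, \<open>p\<close>, \<open>x\<close>,
  \<open>y\<close>, \<open>z\<close>, so all remaining neighbours of \<open>x\<close> are
  leaves.\<close>

lemma vase_part:
  assumes free: P5_C4_free and tri: "R x y" "R y z" "R x z"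
    and y: "N y \<subseteq> {x, z}" and z: "N z \<subseteq> {x, y}"
  shows "closed_part (vase_edges x y z (N x - {y, z})) \<and> vase_set (vase_edges x y z (N x - {y, z}))"
proof
  have neq: "x \<noteq> y" "y \<noteq> z" "x \<noteq> z" using tri R_neq by auto
  have leaf: "q = x" if "p \<in> N x - {y, z}" "R p q" for p q
  proof (rule ccontr)
    assume "q \<noteq> x"
    moreover have "p \<notin> N y" "p \<notin> N z" using that y z R_neq by (auto simp: N_def)
    then have "q \<noteq> y" "q \<noteq> z" using R_sym[OF that(2)] by (auto simp: N_def)
    moreover have "p \<noteq> x" "p \<noteq> q" using that R_neq by (auto simp: N_def)
    moreover have "R q p" "R p x" using that R_sym by (auto simp: N_def)
    ultimately show False
      using free tri neq that(1) unfolding P5_C4_free_def by (metis DiffE distinct_length_2_or_more distinct_singleton insertCI)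
  qed
  show "closed_part (vase_edges x y z (N x - {y, z}))"
    unfolding closed_part_def
  proof (intro conjI ballI allI impI)
    show "vase_edges x y z (N x - {y, z}) \<subseteq> E" using tri by (auto simp: vase_edges_def N_def)
    fix e u w assume e: "e \<in> vase_edges x y z (N x - {y, z})" "u \<in> e" "R u w"
    then consider "u = x" | "u = y" | "u = z" | "u \<in> N x - {y, z}" by (auto simp: vase_edges_def)
    then show "{u, w} \<in> vase_edges x y z (N x - {y, z})"
    proof cases
      case 1
      then show ?thesis using e(3) by (auto simp: vase_edges_def N_def)
    next
      case 2
      then show ?thesis using e(3) y by (auto simp: vase_edges_def N_def insert_commute)
    next
      case 3
      then show ?thesis using e(3) z by (auto simp: vase_edges_def N_def insert_commute)
    next
      case 4
      with leaf[OF 4 e(3)] show ?thesis by (auto simp: vase_edges_def insert_commute)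
    qed
  qed
  show "vase_set (vase_edges x y z (N x - {y, z}))"
    unfolding vase_set_def
    by (intro exI[of _ x] exI[of _ y] exI[of _ z] exI[of _ "N x - {y, z}"])
      (use neq finite_N R_irrefl in \<open>auto simp: vertices_distinct_def N_def\<close>)
qed

text \<open>Neighbours \<open>p\<close> and \<open>q\<close> outside the triangle at two of its
  vertices \<open>a\<close> and \<open>b\<close> give the path \<open>p\<close>, \<open>a\<close>,
  \<open>c\<close>, \<open>b\<close>, \<open>q\<close>, or a 4-cycle if they coincide. So at most
  one triangle vertex has neighbours outside, and it becomes the centre of a vase.\<close>

lemma triangle_part:
  assumes free: P5_C4_free and tri: "R x y" "R y z" "R x z"
  shows "\<exists>S. {x, y} \<in> S \<and> closed_part S \<and> vase_set S"
proof -
  have two: False if "R a b" "R b c" "R a c" "R a p" "R b q" "p \<notin> {b, c}" "q \<notin> {a, c}" for a b c p q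
  proof -
    have neq: "a \<noteq> b" "b \<noteq> c" "a \<noteq> c" "a \<noteq> p" "b \<noteq> q" using that R_neq by blast+
    have s: "R p a" "R c b" using that R_sym by blast+
    show False
    proof (cases "p = q")
      case True
      with that neq s have "distinct [p, a, c, b]" "R b p" by (auto intro: R_sym)
      with free that s show False unfolding P5_C4_free_def by blast
    next
      case False
      with that neq have "distinct [p, a, c, b, q]" by auto
      with free that s show False unfolding P5_C4_free_def by blast
    qed
  qed
  have s: "R y x" "R z y" "R z x" using tri R_sym by blast+
  have case1: ?thesis if "N y \<subseteq> {x, z}" "N z \<subseteq> {x, y}"
    using vase_part[OF free tri that]
    by (intro exI[of _ "vase_edges x y z (N x - {y, z})"]) (auto simp: vase_edges_def)
  have case2: ?thesis if "N x \<subseteq> {y, z}" "N z \<subseteq> {y, x}"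
    using vase_part[OF free s(1) tri(3) tri(2) that]
    by (intro exI[of _ "vase_edges y x z (N y - {x, z})"]) (auto simp: vase_edges_def insert_commute)
  have case3: ?thesis if "N x \<subseteq> {z, y}" "N y \<subseteq> {z, x}"
    using vase_part[OF free s(3) tri(1) s(2) that]
    by (intro exI[of _ "vase_edges z x y (N z - {x, y})"]) (auto simp: vase_edges_def insert_commute)
  have x: "N x \<subseteq> {y, z} \<or> N y \<subseteq> {x, z}"
    using two[OF tri] by (auto simp: N_def)
  have y: "N x \<subseteq> {y, z} \<or> N z \<subseteq> {x, y}"
    using two[OF tri(3) s(2) tri(1)] by (auto simp: N_def)
  have z: "N y \<subseteq> {x, z} \<or> N z \<subseteq> {x, y}"
    using two[OF tri(2) s(3) s(1)] by (auto simp: N_def)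
  from x y z consider "N y \<subseteq> {x, z}" "N z \<subseteq> {x, y}" | "N x \<subseteq> {y, z}" "N z \<subseteq> {x, y}"
    | "N x \<subseteq> {y, z}" "N y \<subseteq> {x, z}" by blast
  then show ?thesis
    by cases (use case1 case2 case3 in \<open>simp_all add: insert_commute\<close>)
qed

lemma closed_partD: "closed_part S \<Longrightarrow> {x, y} \<in> S \<Longrightarrow> R x z \<Longrightarrow> {x, z} \<in> S"
  unfolding closed_part_def by blast

lemma double_star_part:
  assumes edge: "R w1 w2" and disj: "N w1 \<inter> N w2 = {}"
    and leaf1: "\<And>x. x \<in> N w1 - {w2} \<Longrightarrow> N x \<subseteq> {w1}" and leaf2: "\<And>y. y \<in> N w2 - {w1} \<Longrightarrow> N y \<subseteq> {w2}"
  shows "\<exists>S. {w1, w2} \<in> S \<and> closed_part S \<and> double_star_set S"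
proof (intro exI conjI)
  let ?S = "double_star_edges w1 w2 (N w1 - {w2}) (N w2 - {w1})"
  show "{w1, w2} \<in> ?S" by (simp add: double_star_edges_def)
  show "closed_part ?S"
    unfolding closed_part_def
  proof (intro conjI ballI allI impI)
    show "?S \<subseteq> E" using edge by (auto simp: double_star_edges_def N_def)
    fix e u w assume e: "e \<in> ?S" "u \<in> e" "R u w"
    then consider "u = w1" | "u = w2" | "u \<in> N w1 - {w2}" | "u \<in> N w2 - {w1}"
      by (auto simp: double_star_edges_def)
    then show "{u, w} \<in> ?S"
    proof cases
      case 3
      with leaf1[OF 3] e(3) have "w = w1" by (auto simp: N_def)
      with 3 show ?thesis by (auto simp: double_star_edges_def insert_commute)
    next
      case 4
      with leaf2[OF 4] e(3) have "w = w2" by (auto simp: N_def)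
      with 4 show ?thesis by (auto simp: double_star_edges_def insert_commute)
    qed (use e(3) in \<open>auto simp: double_star_edges_def N_def insert_commute\<close>)
  qed
  show "double_star_set ?S"
    unfolding double_star_set_def
    by (intro exI[of _ w1] exI[of _ w2] exI[of _ "N w1 - {w2}"] exI[of _ "N w2 - {w1}"])
      (use R_neq[OF edge] finite_N R_irrefl disj in \<open>auto simp: vertices_distinct_def N_def less_Suc_eq\<close>)
qed

text \<open>A neighbour \<open>p\<close> of one end with a further neighbour \<open>q\<close>
  extends through the edge to a neighbour of the other end: this is a path on five vertices, or a
  4-cycle if \<open>q\<close> is that neighbour.\<close>

lemma central_edge_part:
  assumes free: P5_C4_free and edge: "R w1 w2" and disj: "N w1 \<inter> N w2 = {}"
    and xy: "R w1 x" "x \<noteq> w2" "R w2 y" "y \<noteq> w1"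
  shows "\<exists>S. {w1, w2} \<in> S \<and> closed_part S \<and> double_star_set S"
proof -
  have leaf: "N p \<subseteq> {u}" if "R u w" "N u \<inter> N w = {}" "p \<in> N u - {w}" "R w y" "y \<noteq> u" for u w p y
  proof (rule ccontr)
    assume "\<not> N p \<subseteq> {u}"
    then obtain q where q: "R p q" "q \<noteq> u" by (auto simp: N_def)
    have neq: "u \<noteq> w" "p \<noteq> u" "p \<noteq> w" "p \<noteq> q" "w \<noteq> y" "p \<noteq> y" "q \<noteq> w"
      using that q R_neq R_sym by (auto simp: N_def)
    have r: "R q p" "R p u" "R u p" "R y w" using that q R_sym by (auto simp: N_def)
    show False
    proof (cases "q = y")
      case True
      with neq that(5) have "distinct [p, u, w, q]" by auto
      with free r that True show False unfolding P5_C4_free_def by blast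
    next
      case False
      with neq q that have "distinct [q, p, u, w, y]" by auto
      with free r that show False unfolding P5_C4_free_def by blast
    qed
  qed
  show ?thesis
    by (rule double_star_part[OF edge disj leaf[OF edge disj _ xy(3,4)] leaf[OF R_sym[OF edge] _ _ xy(1,2)]])
      (use disj in auto)
qed

text \<open>A pendant edge \<open>ab\<close> need not be the central edge of its component. If
  another neighbour \<open>c\<close> of \<open>a\<close> is not a leaf, the part is built around
  \<open>ac\<close> and contains \<open>ab\<close> because it is closed.\<close>

lemma edge_part:
  assumes free: P5_C4_free and ab: "R a b"
  shows "\<exists>S. {a, b} \<in> S \<and> closed_part S \<and> (double_star_set S \<or> vase_set S)"
proof -
  have pendant: "\<exists>S. {a, b} \<in> S \<and> closed_part S \<and> (double_star_set S \<or> vase_set S)"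
    if ab: "R a b" and N: "N b \<subseteq> {a}" for a b
  proof (cases "\<forall>c\<in>N a - {b}. N c \<subseteq> {a}")
    case True
    have "N a \<inter> N b = {}" using N R_irrefl by (auto simp: N_def)
    from double_star_part[OF ab this] True N show ?thesis by blast
  next
    case False
    then obtain c d where c: "R a c" "c \<noteq> b" "R c d" "d \<noteq> a" by (auto simp: N_def)
    have "\<exists>S. {a, c} \<in> S \<and> closed_part S \<and> (double_star_set S \<or> vase_set S)"
    proof (cases "N a \<inter> N c = {}")
      case True
      from central_edge_part[OF free c(1) True ab _ c(3,4)] c(2) show ?thesis by blast
    next
      case False
      then obtain e where "R a e" "R c e" by (auto simp: N_def)
      with triangle_part[OF free c(1)] show ?thesis by blast
    qed
    with closed_partD[OF _ _ ab] show ?thesis by blast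
  qed
  show ?thesis
  proof (cases "N a \<inter> N b = {}")
    case False
    then obtain c where "R a c" "R b c" by (auto simp: N_def)
    with triangle_part[OF free ab] show ?thesis by blast
  next
    case True
    show ?thesis
    proof (cases "N a \<subseteq> {b} \<or> N b \<subseteq> {a}")
      case False
      then obtain x y where "R a x" "x \<noteq> b" "R b y" "y \<noteq> a" by (auto simp: N_def)
      with central_edge_part[OF free ab True] show ?thesis by blast
    next
      case True
      with pendant[OF ab] pendant[OF R_sym[OF ab]] show ?thesis by (auto simp: insert_commute)
    qed
  qed
qed

end

section \<open>Graphs without forbidden edge-induced subgraphs\<close>

context edge_set
begin

definition pattern_free :: bool where
  "pattern_free \<longleftrightarrow> \<not> embeds E 7 P5_P2 \<and> \<not> embeds E 6 C4_P2 \<and> \<not> embeds E 6 P6 \<and>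
     \<not> embeds E 5 C5 \<and> \<not> embeds E 5 Bull \<and> \<not> embeds E 4 Diamond \<and> \<not> embeds E 8 F1"

end

lemma embeds_listI:
  assumes "distinct vs" "length vs = n" "\<forall>(i, j)\<in>set es. {vs ! i, vs ! j} \<in> E"
  shows "embeds E n es"
  unfolding embeds_def pattern_edge_def
  by (rule exI[of _ "(!) vs"]) (use assms in \<open>auto intro: inj_on_nth\<close>)

lemma embeds_listD:
  assumes "embeds E n es" "\<forall>(i, j)\<in>set es. i < n \<and> j < n"
  shows "\<exists>vs. distinct vs \<and> length vs = n \<and> (\<forall>(i, j)\<in>set es. {vs ! i, vs ! j} \<in> E)"
proof -
  obtain g where g: "inj_on g {..<n}" "pattern_edge g ` set es \<subseteq> E"
    using assms(1) by (auto simp: embeds_def)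
  have "{map g [0..<n] ! i, map g [0..<n] ! j} \<in> E" if "(i, j) \<in> set es" for i j
  proof -
    have "pattern_edge g (i, j) \<in> E" using g(2) that by blast
    moreover have "i < n" "j < n" using assms(2) that by auto
    ultimately show ?thesis by (simp add: pattern_edge_def)
  qed
  then show ?thesis
    by (intro exI[of _ "map g [0..<n]"]) (use g(1) in \<open>auto simp: distinct_map atLeast0LessThan\<close>)
qed

locale pattern_free_set = edge_set +
  assumes free: pattern_free
begin

lemma no_P5_P2:
  assumes "distinct [a, b, c, d, e, f, g]" "R a b" "R b c" "R c d" "R d e" "R f g"
  shows False
  using free embeds_listI[OF assms(1), of 7 P5_P2 E] assms(2-) by (auto simp: pattern_free_def)

lemma no_C4_P2:
  assumes "distinct [a, b, c, d, e, f]" "R a b" "R b c" "R c d" "R d a" "R e f"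
  shows False
  using free embeds_listI[OF assms(1), of 6 C4_P2 E] assms(2-) by (auto simp: pattern_free_def insert_commute)

lemma no_P6:
  assumes "distinct [a, b, c, d, e, f]" "R a b" "R b c" "R c d" "R d e" "R e f"
  shows False
  using free embeds_listI[OF assms(1), of 6 P6 E] assms(2-) by (auto simp: pattern_free_def)

lemma no_C5:
  assumes "distinct [a, b, c, d, e]" "R a b" "R b c" "R c d" "R d e" "R e a"
  shows False
  using free embeds_listI[OF assms(1), of 5 C5 E] assms(2-) by (auto simp: pattern_free_def insert_commute)

lemma no_Bull:
  assumes "distinct [x, y, z, p, q]" "R x y" "R y z" "R x z" "R x p" "R y q"
  shows False
  using free embeds_listI[OF assms(1), of 5 Bull E] assms(2-) by (auto simp: pattern_free_def)

lemma no_Diamond: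
  assumes "distinct [x, y, z, p]" "R x y" "R x z" "R x p" "R y z" "R y p"
  shows False
  using free embeds_listI[OF assms(1), of 4 Diamond E] assms(2-) by (auto simp: pattern_free_def)

lemma no_F1:
  assumes "distinct [v, u, w1, w2, a1, a2, b1, b2]" "R v u" "R v w1" "R v w2" "R w1 a1" "R w1 a2" "R w2 b1" "R w2 b2"
  shows False
  using free embeds_listI[OF assms(1), of 8 F1 E] assms(2-) by (auto simp: pattern_free_def)

text \<open>Outside neighbours at two triangle vertices form a bull if they differ and a diamond if
  they coincide.\<close>

lemma triangle_outside:
  assumes "R a b" "R b c" "R a c" "R a p" "p \<notin> {b, c}"
  shows "N b \<subseteq> {a, c}"
proof
  fix q assume "q \<in> N b"
  then have q: "R b q" by (simp add: N_def)
  show "q \<in> {a, c}"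
  proof (rule ccontr)
    assume "q \<notin> {a, c}"
    with assms q have "distinct [a, b, c, p]" "distinct [a, b, c, q]" using R_neq by auto
    then show False using no_Bull[of a b c p q] no_Diamond[of a b c p] assms q by (cases "p = q") auto
  qed
qed

text \<open>The triangle is attached to the rest only at \<open>v\<close>, so any path
  \<open>v\<close>, \<open>a\<close>, \<open>b\<close> leaving it extends to the five-vertex path
  \<open>y\<close>, \<open>z\<close>, \<open>v\<close>, \<open>a\<close>, \<open>b\<close>.
  Excluding an edge disjoint from this path, and a sixth vertex on it, fixes the whole
  graph.\<close>

lemma triangle_case_apex:
  assumes tri: "R v y" "R y z" "R v z" and N: "N y \<subseteq> {v, z}" "N z \<subseteq> {v, y}" and "\<not> P5_C4_free"
  shows "double_vase_set E \<or> amaryllis_set E"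
proof -
  have neq: "v \<noteq> y" "y \<noteq> z" "v \<noteq> z" using tri R_neq by auto
  have Ny: "u = v \<or> u = z" if "R y u" for u using N that by (auto simp: N_def)
  have Nz: "u = v \<or> u = y" if "R z u" for u using N that by (auto simp: N_def)
  have Ny': "u = v \<or> u = z" if "R u y" for u using Ny R_sym that by blast
  have Nz': "u = v \<or> u = y" if "R u z" for u using Nz R_sym that by blast
  \<comment> \<open>Otherwise the component \<open>U\<close> of the triangle is a vase and contains
    neither of the two subgraphs. A five-vertex path or a 4-cycle outside \<open>U\<close> is
    disjoint from the edge \<open>yz\<close> and forms a forbidden union with it.\<close>
  have "\<exists>a b. R v a \<and> a \<notin> {y, z} \<and> R a b \<and> b \<noteq> v"
  proof (rule ccontr)
    assume "\<not> ?thesis"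
    then have leaf: "b = v" if "R v a" "a \<noteq> y" "a \<noteq> z" "R a b" for a b using that by blast
    define U where "U = {v, y, z} \<union> N v"
    have U: "b \<in> U" if "a \<in> U" "R a b" for a b
      using that Ny Nz leaf unfolding U_def N_def by blast
    \<comment> \<open>In \<open>U\<close> only the triangle vertices have two neighbours. So the
      inner vertices of a five-vertex path would be \<open>v\<close>, \<open>y\<close>,
      \<open>z\<close>, and an end next to \<open>y\<close> or \<open>z\<close> could only be a
      triangle vertex already used; a 4-cycle would not fit at all.\<close>
    have deg: "a \<in> {v, y, z}" if "a \<in> U" "R a b" "R a c" "b \<noteq> c" for a b c
      using that leaf unfolding U_def N_def by blast
    have "P5_C4_free" unfolding P5_C4_free_def
    proof (intro conjI allI impI)
      fix a b c d e assume d: "distinct [a, b, c, d, e]" and p: "R a b" "R b c" "R c d" "R d e"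
      have s: "R b a" "R c b" "R d c" "R e d" using p R_sym by blast+
      have "{a, b, c, d, e} \<inter> {y, z} \<noteq> {}"
        using no_P5_P2[of a b c d e y z] d p tri(2) neq by auto
      then have "{a, b, c, d, e} \<inter> U \<noteq> {}" unfolding U_def by blast
      then have "a \<in> U" "b \<in> U" "c \<in> U" "d \<in> U" "e \<in> U" using U p s by blast+
      then have "b \<in> {v, y, z}" "c \<in> {v, y, z}" "d \<in> {v, y, z}"
        using deg[of b a c] deg[of c b d] deg[of d c e] p s d by auto
      then show False using d p s Ny Nz Ny' Nz' by (auto; blast)
    next
      fix a b c d assume d: "distinct [a, b, c, d]" and p: "R a b" "R b c" "R c d" "R d a"
      have s: "R b a" "R c b" "R d c" "R a d" using p R_sym by blast+
      have "{a, b, c, d} \<inter> {y, z} \<noteq> {}"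
        using no_C4_P2[of a b c d y z] d p tri(2) neq by auto
      then have "{a, b, c, d} \<inter> U \<noteq> {}" unfolding U_def by blast
      then have "a \<in> U" "b \<in> U" "c \<in> U" "d \<in> U" using U p s by blast+
      then have "a \<in> {v, y, z}" "b \<in> {v, y, z}" "c \<in> {v, y, z}" "d \<in> {v, y, z}"
        using deg[of a b d] deg[of b a c] deg[of c b d] deg[of d c a] p s d by auto
      then show False using d by auto
    qed
    with assms(6) show False by blast
  qed
  then obtain a b where ab: "R v a" "a \<notin> {y, z}" "R a b" "b \<noteq> v" by blast
  \<comment> \<open>The path \<open>y\<close>, \<open>z\<close>, \<open>v\<close>, \<open>a\<close>,
    \<open>b'\<close> has five vertices, so no edge may be disjoint from it; only \<open>yz\<close>
    and edges at \<open>v\<close> avoid the pair \<open>a\<close>, \<open>b'\<close>.\<close>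
  have meets: "f \<in> {a, b'} \<or> g \<in> {a, b'}"
    if "R f g" "f \<noteq> v" "g \<noteq> v" "(f, g) \<notin> {(y, z), (z, y)}" "R a b'" "b' \<noteq> v" for f g b'
  proof (rule ccontr)
    assume n: "\<not> ?thesis"
    have "f \<notin> {y, z}" "g \<notin> {y, z}" using that(1-4) Ny[of g] Nz[of g] Ny'[of f] Nz'[of f] by blast+
    moreover have "b' \<notin> {y, z}" using that(5) ab(2) Ny'[of a] Nz'[of a] R_neq[OF ab(1)] by blast
    ultimately have "distinct [y, z, v, a, b', f, g]"
      using n neq ab that R_neq[OF that(1)] R_neq[OF that(5)] R_neq[OF ab(1)] by auto
    from no_P5_P2[OF this tri(2) R_sym[OF tri(3)] ab(1) that(5) that(1)] show False .
  qed
  have nyz: "b' \<notin> {y, z}" if "R a b'" for b' using that ab(2) Ny'[of a] Nz'[of a] R_neq[OF ab(1)] by blast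
  show ?thesis
  proof (cases "\<exists>b. R a b \<and> b \<noteq> v \<and> R v b")
    case True
    then obtain b where b: "R a b" "b \<noteq> v" "R v b" by blast
    have Na: "N a \<subseteq> {v, b}" "N b \<subseteq> {v, a}"
      using triangle_outside[of v a b y] triangle_outside[of v b a y] ab b tri nyz[OF b(1)] R_sym by auto
    have "E = double_vase_edges v y z a b (N v - {y, z, a, b})"
    proof
      show "E \<subseteq> double_vase_edges v y z a b (N v - {y, z, a, b})"
      proof
        fix e assume "e \<in> E"
        then obtain f g where fg: "e = {f, g}" "R f g" by (rule edge_cases)
        have star: "{v, h} \<in> double_vase_edges v y z a b (N v - {y, z, a, b})" if "R v h" for h
        proof (cases "h \<in> {y, z, a, b}")
          case True
          then show ?thesis by (auto simp: double_vase_edges_def insert_commute)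
        next
          case False
          then show ?thesis using that by (auto simp: double_vase_edges_def N_def)
        qed
        show "e \<in> double_vase_edges v y z a b (N v - {y, z, a, b})"
        proof (cases "f = v \<or> g = v \<or> e = {y, z}")
          case True
          moreover have "{y, z} \<in> double_vase_edges v y z a b (N v - {y, z, a, b})"
            by (simp add: double_vase_edges_def)
          ultimately show ?thesis
            using star[of g] star[of f] fg R_sym[OF fg(2)] by (metis insert_commute)
        next
          case False
          then have "(f, g) \<notin> {(y, z), (z, y)}" using fg(1) by (auto simp: insert_commute)
          with False meets[OF fg(2) _ _ _ b(1,2)] have "f \<in> {a, b} \<or> g \<in> {a, b}" by blast
          moreover have "g = b" if "f = a" using that Na(1) fg(2) False by (auto simp: N_def)
          moreover have "g = a" if "f = b" using that Na(2) fg(2) False by (auto simp: N_def)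
          moreover have "f = b" if "g = a" using that Na(1) R_sym[OF fg(2)] False by (auto simp: N_def)
          moreover have "f = a" if "g = b" using that Na(2) R_sym[OF fg(2)] False by (auto simp: N_def)
          ultimately have "{f, g} = {a, b}" by blast
          then show ?thesis using fg by (simp add: double_vase_edges_def)
        qed
      qed
      show "double_vase_edges v y z a b (N v - {y, z, a, b}) \<subseteq> E"
        using tri ab b R_sym by (auto simp: double_vase_edges_def N_def insert_commute)
    qed
    moreover have "vertices_distinct [v, y, z, a, b] [N v - {y, z, a, b}]"
      using neq ab b nyz[OF b(1)] R_neq[OF ab(1)] R_neq[OF b(1)] finite_N R_irrefl by (auto simp: vertices_distinct_def N_def)
    ultimately show ?thesis unfolding double_vase_set_def by blast
  next
    case False
    \<comment> \<open>An edge at \<open>b\<close> leading away from \<open>a\<close> and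
      \<open>v\<close> would prolong the path to six vertices.\<close>
    have contains: "f = a \<or> g = a" if fg: "R f g" "f \<noteq> v" "g \<noteq> v" "(f, g) \<notin> {(y, z), (z, y)}" for f g
    proof -
      have no: False if "R b c" "c \<noteq> a" "c \<noteq> v" for c
      proof -
        have "c \<notin> {y, z}" using Ny'[of b] Nz'[of b] that(1) nyz[OF ab(3)] ab(4) by auto
        then have "distinct [y, z, v, a, b, c]"
          using neq ab that nyz[OF ab(3)] R_neq[OF ab(1)] R_neq[OF ab(3)] R_neq[OF that(1)] by auto
        from no_P6[OF this tri(2) R_sym[OF tri(3)] ab(1,3) that(1)] show False .
      qed
      from meets[OF fg ab(3,4)] no[of f] no[of g] fg R_sym[OF fg(1)] show ?thesis by auto
    qed
    have "E = amaryllis_edges v a y z (N a - {v}) (N v - {a, y, z})"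
    proof
      show "E \<subseteq> amaryllis_edges v a y z (N a - {v}) (N v - {a, y, z})"
      proof
        fix e assume "e \<in> E"
        then obtain f g where fg: "e = {f, g}" "R f g" by (rule edge_cases)
        have star: "{v, h} \<in> amaryllis_edges v a y z (N a - {v}) (N v - {a, y, z})" if "R v h" for h
        proof (cases "h \<in> {a, y, z}")
          case True
          then show ?thesis by (auto simp: amaryllis_edges_def insert_commute)
        next
          case False
          then show ?thesis using that by (auto simp: amaryllis_edges_def N_def)
        qed
        show "e \<in> amaryllis_edges v a y z (N a - {v}) (N v - {a, y, z})"
        proof (cases "f = v \<or> g = v \<or> e = {y, z}")
          case True
          moreover have "{y, z} \<in> amaryllis_edges v a y z (N a - {v}) (N v - {a, y, z})"
            by (simp add: amaryllis_edges_def)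
          ultimately show ?thesis
            using star[of g] star[of f] fg R_sym[OF fg(2)] by (metis insert_commute)
        next
          case False
          then have "(f, g) \<notin> {(y, z), (z, y)}" using fg(1) by (auto simp: insert_commute)
          with contains[OF fg(2)] False have "f = a \<or> g = a" by blast
          then obtain h where "e = {a, h}" "R a h" "h \<noteq> v"
            using fg R_sym[OF fg(2)] False by (metis insert_commute)
          then show ?thesis by (auto simp: amaryllis_edges_def N_def)
        qed
      qed
      show "amaryllis_edges v a y z (N a - {v}) (N v - {a, y, z}) \<subseteq> E"
        using tri ab by (auto simp: amaryllis_edges_def N_def insert_commute)
    qed
    moreover have "vertices_distinct [v, a, y, z] [N a - {v}, N v - {a, y, z}]"
      using neq ab nyz False R_neq[OF ab(1)] finite_N R_irrefl
      by (auto simp: vertices_distinct_def N_def less_Suc_eq)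
    ultimately show ?thesis unfolding amaryllis_set_def by blast
  qed
qed

lemma triangle_case:
  assumes tri: "R x y" "R y z" "R x z" and "\<not> P5_C4_free"
  shows "double_vase_set E \<or> amaryllis_set E"
proof -
  have s: "R y x" "R z y" "R z x" using tri R_sym by blast+
  have x: "N x \<subseteq> {y, z} \<or> N y \<subseteq> {x, z}" using triangle_outside[OF tri] by (auto simp: N_def)
  have y: "N x \<subseteq> {y, z} \<or> N z \<subseteq> {x, y}" using triangle_outside[OF tri(3) s(2) tri(1)] by (auto simp: N_def)
  have z: "N y \<subseteq> {x, z} \<or> N z \<subseteq> {x, y}" using triangle_outside[OF tri(2) s(3) s(1)] by (auto simp: N_def)
  from x y z consider "N y \<subseteq> {x, z}" "N z \<subseteq> {x, y}" | "N x \<subseteq> {y, z}" "N z \<subseteq> {y, x}"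
    | "N x \<subseteq> {z, y}" "N y \<subseteq> {z, x}" by blast
  then show ?thesis
  proof cases
    case 1
    from triangle_case_apex[OF tri this assms(4)] show ?thesis .
  next
    case 2
    from triangle_case_apex[OF s(1) tri(3) tri(2) this assms(4)] show ?thesis .
  next
    case 3
    from triangle_case_apex[OF s(3) tri(1) s(2) this assms(4)] show ?thesis .
  qed
qed

text \<open>The two centres form one side of a bipartition. Their common neighbours are the middle
  vertices, and all other neighbours are leaves.\<close>

lemma candyI:
  assumes "v1 \<noteq> v2" "R v1 w" "R v2 w" and ends: "\<And>f g. R f g \<Longrightarrow> (f \<in> {v1, v2}) \<noteq> (g \<in> {v1, v2})"
  shows "candy_set E"
proof -
  have "E = candy_edges v1 v2 (N v1 \<inter> N v2) (N v1 - N v2) (N v2 - N v1)"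
  proof
    show "E \<subseteq> candy_edges v1 v2 (N v1 \<inter> N v2) (N v1 - N v2) (N v2 - N v1)"
    proof
      fix e assume "e \<in> E"
      then obtain f g where fg: "e = {f, g}" "R f g" by (rule edge_cases)
      with ends[OF fg(2)] obtain h u where hu: "e = {h, u}" "h \<in> {v1, v2}" "R h u"
        by (metis insert_commute)
      then show "e \<in> candy_edges v1 v2 (N v1 \<inter> N v2) (N v1 - N v2) (N v2 - N v1)"
        by (auto simp: candy_edges_def N_def)
    qed
  qed (auto simp: candy_edges_def N_def)
  moreover have "vertices_distinct [v1, v2] [N v1 \<inter> N v2, N v1 - N v2, N v2 - N v1]"
    using assms(1) ends finite_N R_irrefl[of v1] R_irrefl[of v2] by (auto simp: vertices_distinct_def less_Suc_eq N_def numeral_3_eq_3)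
  moreover have "w \<in> N v1 \<inter> N v2" using assms(2,3) by (simp add: N_def)
  ultimately show ?thesis unfolding candy_set_def by blast
qed

text \<open>Every edge meets the 4-cycle because an edge disjoint from it is forbidden. As
  \<open>b\<close> and \<open>d\<close> have no neighbours off the cycle, every edge meets
  \<open>{a, c}\<close>, and \<open>ac\<close> itself would create a triangle.\<close>

lemma C4_case_inner:
  assumes notri: "\<And>x y z. R x y \<Longrightarrow> R y z \<Longrightarrow> R x z \<Longrightarrow> False"
    and d: "distinct [a, b, c, d]" and C: "R a b" "R b c" "R c d" "R d a" and N: "N b \<subseteq> {a, c}" "N d \<subseteq> {a, c}"
  shows "candy_set E"
proof (rule candyI[of a c b])
  have s: "R b a" "R c b" "R d c" "R a d" using C R_sym by blast+
  show "R a b" "R c b" "a \<noteq> c" using C s d by auto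
  fix f g assume fg: "R f g"
  have "{a, b, c, d} \<inter> {f, g} \<noteq> {}"
    using no_C4_P2[of a b c d f g] d C fg R_neq[OF fg] by auto
  moreover have "g \<in> {a, c}" if "f \<in> {b, d}" using that fg N by (auto simp: N_def)
  moreover have "f \<in> {a, c}" if "g \<in> {b, d}" using that R_sym[OF fg] N by (auto simp: N_def)
  moreover have "\<not> R a c" "\<not> R c a" using notri[of a b c] C R_sym by blast+
  then have "f \<notin> {a, c} \<or> g \<notin> {a, c}" using fg R_neq[OF fg] by auto
  moreover have "{a, c} \<inter> {b, d} = {}" using d by auto
  ultimately show "(f \<in> {a, c}) \<noteq> (g \<in> {a, c})" by auto
qed

text \<open>Two consecutive cycle vertices \<open>x\<close>, \<open>y\<close> cannot both have
  neighbours \<open>p\<close>, \<open>q\<close> off the cycle: going round the long way,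
  \<open>p\<close>, \<open>x\<close>, \<open>w\<close>, \<open>z\<close>, \<open>y\<close>,
  \<open>q\<close> would be a path on six vertices. Hence some opposite pair has none.\<close>

lemma C4_case:
  assumes notri: "\<And>x y z. R x y \<Longrightarrow> R y z \<Longrightarrow> R x z \<Longrightarrow> False"
    and d: "distinct [a, b, c, d]" and C: "R a b" "R b c" "R c d" "R d a"
  shows "candy_set E"
proof -
  have s: "R b a" "R c b" "R d c" "R a d" using C R_sym by blast+
  have adj: "N x \<subseteq> {y, w} \<or> N y \<subseteq> {x, z}"
    if d: "distinct [x, y, z, w]" and C: "R x y" "R y z" "R z w" "R w x" for x y z w
  proof (rule ccontr)
    assume "\<not> ?thesis"
    then obtain p q where pq: "R x p" "p \<notin> {y, w}" "R y q" "q \<notin> {x, z}" by (auto simp: N_def)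
    have s: "R y x" "R z y" "R w z" "R x w" "R p x" using C pq R_sym by blast+
    have "p \<noteq> q" using notri[of x y p] C pq by blast
    moreover have "p \<noteq> z" "q \<noteq> w" using notri[of x y z] notri[of y z w] C pq s by blast+
    ultimately have "distinct [p, x, w, z, y, q]" using d pq R_neq[OF pq(1)] R_neq[OF pq(3)] by auto
    from no_P6[OF this s(5) s(4) s(3) s(2) pq(3)] show False .
  qed
  have "N a \<subseteq> {b, d} \<or> N b \<subseteq> {a, c}" "N b \<subseteq> {c, a} \<or> N c \<subseteq> {b, d}"
    "N c \<subseteq> {d, b} \<or> N d \<subseteq> {c, a}" "N d \<subseteq> {a, c} \<or> N a \<subseteq> {d, b}"
    using adj[of a b c d] adj[of b c d a] adj[of c d a b] adj[of d a b c] d C by auto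
  then consider "N b \<subseteq> {a, c}" "N d \<subseteq> {a, c}" | "N c \<subseteq> {b, d}" "N a \<subseteq> {b, d}" by blast
  then show ?thesis
  proof cases
    case 1
    from C4_case_inner[OF notri d C 1] show ?thesis .
  next
    case 2
    have "distinct [b, c, d, a]" using d by auto
    from C4_case_inner[OF notri this C(2,3,4,1) 2] show ?thesis .
  qed
qed

text \<open>Without triangles and 4-cycles the graph is a tree-like neighbourhood of the path: every
  edge meets one of the three inner vertices, whose further neighbours are leaves. If the middle
  vertex has no leaf this is a candy; otherwise excluding the caterpillar limits the degree of
  \<open>p2\<close> or \<open>p4\<close>.\<close>

lemma P5_case:
  assumes notri: "\<And>x y z. R x y \<Longrightarrow> R y z \<Longrightarrow> R x z \<Longrightarrow> False"
    and noC4: "\<And>a b c d. distinct [a, b, c, d] \<Longrightarrow> R a b \<Longrightarrow> R b c \<Longrightarrow> R c d \<Longrightarrow> R d a \<Longrightarrow> False"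
    and d: "distinct [p1, p2, p3, p4, p5]" and P: "R p1 p2" "R p2 p3" "R p3 p4" "R p4 p5"
  shows "candy_set E \<or> shooting_star_set E"
proof -
  \<comment> \<open>A second neighbour of an end vertex closes a cycle of length 3, 4 or 5, or
    prolongs the path to six vertices.\<close>
  have ends: "N p1 \<subseteq> {p2}"
    if d: "distinct [p1, p2, p3, p4, p5]" and P: "R p1 p2" "R p2 p3" "R p3 p4" "R p4 p5" for p1 p2 p3 p4 p5
  proof (rule ccontr)
    assume "\<not> ?thesis"
    then obtain q where q: "R p1 q" "q \<noteq> p2" by (auto simp: N_def)
    have "q \<noteq> p3" using notri[of p1 p2 p3] P q by blast
    moreover have "q \<noteq> p4" using noC4[of p1 p2 p3 p4] d P q R_sym[OF q(1)] by auto
    moreover have "q \<noteq> p5" using no_C5[of p1 p2 p3 p4 p5] d P q R_sym[OF q(1)] by auto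
    ultimately have "distinct [q, p1, p2, p3, p4, p5]" using d q R_neq[OF q(1)] by auto
    from no_P6[OF this R_sym[OF q(1)] P] show False .
  qed
  \<comment> \<open>Any further neighbour of \<open>p2\<close> can replace \<open>p1\<close> as the
    end of the path, so what holds for end vertices applies to it.\<close>
  have leaf: "N q \<subseteq> {p2}"
    if d: "distinct [p1, p2, p3, p4, p5]" and P: "R p1 p2" "R p2 p3" "R p3 p4" "R p4 p5" and q: "q \<in> N p2 - {p3}" for p1 p2 p3 p4 p5 q
  proof -
    have q: "R p2 q" "q \<noteq> p3" using q by (auto simp: N_def)
    have "q \<noteq> p4" using notri[of p2 p3 p4] P q by blast
    moreover have "q \<noteq> p5" using noC4[of p2 p3 p4 p5] d P q R_sym[OF q(1)] by auto
    ultimately have "distinct [q, p2, p3, p4, p5]" using d q R_neq[OF q(1)] by auto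
    from ends[OF this R_sym[OF q(1)] P(2-4)] show ?thesis .
  qed
  have s: "R p2 p1" "R p3 p2" "R p4 p3" "R p5 p4" using P R_sym by blast+
  have d': "distinct [p5, p4, p3, p2, p1]" using d by auto
  have N1: "N p1 \<subseteq> {p2}" and N5: "N p5 \<subseteq> {p4}" using ends[OF d P] ends[OF d' s(4,3,2,1)] by auto
  have L2: "N q \<subseteq> {p2}" if "q \<in> N p2 - {p3}" for q by (rule leaf[OF d P that])
  have L4: "N q \<subseteq> {p4}" if "q \<in> N p4 - {p3}" for q by (rule leaf[OF d' s(4,3,2,1) that])
  have meets: "{f, g} \<inter> {p2, p3, p4} \<noteq> {}" if fg: "R f g" for f g
  proof (rule ccontr)
    assume n: "\<not> ?thesis"
    have "f \<noteq> p1" "f \<noteq> p5" "g \<noteq> p1" "g \<noteq> p5"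
      using n fg R_sym[OF fg] N1 N5 by (auto simp: N_def)
    with n d R_neq[OF fg] have "distinct [p1, p2, p3, p4, p5, f, g]" by auto
    from no_P5_P2[OF this P fg] show False .
  qed
  have no24: "\<not> R p2 p4" "\<not> R p4 p2" using notri[of p2 p3 p4] P R_sym by blast+
  have L3: "r = p3" if q: "q \<in> N p3 - {p2, p4}" "R q r" for q r
  proof (rule ccontr)
    assume "r \<noteq> p3"
    have q': "R p3 q" "q \<noteq> p2" "q \<noteq> p4" "q \<noteq> p3" using q R_neq by (auto simp: N_def)
    have "r \<noteq> p2" "r \<noteq> p4" using notri[of p3 q p2] notri[of p3 q p4] q q' P s by blast+
    with meets[OF q(2)] \<open>r \<noteq> p3\<close> q' show False by auto
  qed
  show ?thesis
  proof (cases "N p3 \<subseteq> {p2, p4}")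
    case True
    have "candy_set E"
    proof (rule candyI[of p2 p4 p3])
      show "p2 \<noteq> p4" "R p2 p3" "R p4 p3" using d P s by auto
      fix f g assume fg: "R f g"
      have "g \<in> {p2, p4}" if "f = p3" using that fg True by (auto simp: N_def)
      moreover have "f \<in> {p2, p4}" if "g = p3" using that R_sym[OF fg] True by (auto simp: N_def)
      moreover have "f \<notin> {p2, p4} \<or> g \<notin> {p2, p4}" using fg no24 R_neq[OF fg] by auto
      ultimately show "(f \<in> {p2, p4}) \<noteq> (g \<in> {p2, p4})" using meets[OF fg] d by auto
    qed
    then show ?thesis ..
  next
    case False
    then obtain u where u: "R p3 u" "u \<noteq> p2" "u \<noteq> p4" by (auto simp: N_def)
    \<comment> \<open>\<open>x\<close> and \<open>y\<close> are \<open>p2\<close> and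
      \<open>p4\<close> in either order: \<open>y\<close> is the one with a single pendant edge
      \<open>yz\<close>, and \<open>x\<close> carries the remaining leaves.\<close>
    have star: "shooting_star_set E"
      if x: "{x, y} = {p2, p4}" "N y \<subseteq> {p3, z}" "R y z" "z \<noteq> p3" "N z \<subseteq> {y}" "N x \<inter> N y \<subseteq> {p3}" for x y z
    proof -
      have xy: "x \<noteq> y" "R p3 x" "R p3 y" "x \<noteq> p3" "y \<noteq> p3" "\<not> R x y" "\<not> R y x"
        using x(1) d P s no24 by (auto simp: doubleton_eq_iff)
      have z: "z \<noteq> x" "z \<noteq> y" "R z y" "\<not> R p3 z" using x(3) xy R_neq R_sym notri[of p3 y z] by auto
      have meets': "f \<in> {x, y, p3} \<or> g \<in> {x, y, p3}" if "R f g" for f g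
        using meets[OF that] x(1) by auto
      have "E = shooting_star_edges p3 x y z (N x - {p3}) (N p3 - {x, y})"
      proof
        show "shooting_star_edges p3 x y z (N x - {p3}) (N p3 - {x, y}) \<subseteq> E"
          using xy x(3) R_sym by (auto simp: shooting_star_edges_def N_def insert_commute)
        show "E \<subseteq> shooting_star_edges p3 x y z (N x - {p3}) (N p3 - {x, y})"
        proof
          fix e assume "e \<in> E"
          then obtain f g where fg: "e = {f, g}" "R f g" by (rule edge_cases)
          then obtain h k where hk: "e = {h, k}" "R h k" "h \<in> {x, y, p3}"
            using meets'[OF fg(2)] by (metis insert_commute)
          then show "e \<in> shooting_star_edges p3 x y z (N x - {p3}) (N p3 - {x, y})"
            using x(2) by (auto simp: shooting_star_edges_def N_def insert_commute)
        qed
      qed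
      moreover have "vertices_distinct [p3, x, y, z] [N x - {p3}, N p3 - {x, y}]"
        using xy z x(5) finite_N R_irrefl notri[of p3 x] R_sym[of x z]
        by (auto simp: vertices_distinct_def N_def less_Suc_eq)
      ultimately show ?thesis unfolding shooting_star_set_def by blast
    qed
    have disj: "N p2 \<inter> N p4 \<subseteq> {p3}"
    proof
      fix q assume q: "q \<in> N p2 \<inter> N p4"
      show "q \<in> {p3}"
      proof (rule ccontr)
        assume "q \<notin> {p3}"
        with q L2[of q] R_sym[of p4 q] d show False by (auto simp: N_def)
      qed
    qed
    \<comment> \<open>Two leaves at \<open>p2\<close>, two at \<open>p4\<close> and the leaf
      \<open>u\<close> at \<open>p3\<close> would form the 3-caterpillar.\<close>
    have "N p2 \<subseteq> {p3, p1} \<or> N p4 \<subseteq> {p3, p5}"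
    proof (rule ccontr)
      assume "\<not> ?thesis"
      then obtain a b where ab: "R p2 a" "a \<noteq> p3" "a \<noteq> p1" "R p4 b" "b \<noteq> p3" "b \<noteq> p5" by (auto simp: N_def)
      have "a \<noteq> b" using disj ab by (auto simp: N_def)
      moreover have "a \<noteq> p4" "b \<noteq> p2" using ab no24 by auto
      moreover have "u \<noteq> a" "u \<noteq> b" using notri[of p3 p2 u] notri[of p3 p4 u] u ab P s by blast+
      moreover have "u \<noteq> p1" "u \<noteq> p5" using N1 N5 R_sym[OF u(1)] d by (auto simp: N_def)
      moreover have "a \<noteq> p5" "b \<noteq> p1" using N1 N5 R_sym[OF ab(1)] R_sym[OF ab(4)] d by (auto simp: N_def)
      ultimately have "distinct [p3, u, p2, p4, p1, a, p5, b]"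
        using d ab u R_neq[OF ab(1)] R_neq[OF ab(4)] R_neq[OF u(1)] by auto
      from no_F1[OF this u(1) s(2) P(3) s(1) ab(1) P(4) ab(4)] show False .
    qed
    then have "shooting_star_set E"
    proof
      assume "N p2 \<subseteq> {p3, p1}"
      then show ?thesis by (intro star[of p4 p2 p1]) (use N1 s d disj in auto)
    next
      assume "N p4 \<subseteq> {p3, p5}"
      then show ?thesis by (intro star[of p2 p4 p5]) (use N5 P d disj in auto)
    qed
    then show ?thesis ..
  qed
qed

theorem classification:
  "P5_C4_free \<or> candy_set E \<or> shooting_star_set E \<or> double_vase_set E \<or> amaryllis_set E"
proof (cases "P5_C4_free \<or> (\<exists>x y z. R x y \<and> R y z \<and> R x z)")
  case True
  then show ?thesis using triangle_case by blast
next
  case False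
  then have notri: "\<And>x y z. R x y \<Longrightarrow> R y z \<Longrightarrow> R x z \<Longrightarrow> False" and nf: "\<not> P5_C4_free" by blast+
  show ?thesis
  proof (cases "\<exists>a b c d. distinct [a, b, c, d] \<and> R a b \<and> R b c \<and> R c d \<and> R d a")
    case True
    then obtain a b c d where C: "distinct [a, b, c, d]" "R a b" "R b c" "R c d" "R d a" by blast
    have "candy_set E" by (rule C4_case[OF _ C]) (rule notri)
    then show ?thesis by blast
  next
    case no: False
    with nf obtain p1 p2 p3 p4 p5 where P: "distinct [p1, p2, p3, p4, p5]" "R p1 p2" "R p2 p3" "R p3 p4" "R p4 p5"
      unfolding P5_C4_free_def by blast
    have "candy_set E \<or> shooting_star_set E"
      by (rule P5_case[OF _ _ P]) (use notri no in blast)+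
    then show ?thesis by blast
  qed
qed

end

section \<open>The permitted shapes avoid the forbidden patterns\<close>

context edge_set
begin

lemma embeds_obtain_list:
  assumes "embeds E n es" "\<forall>(i, j)\<in>set es. i < n \<and> j < n"
  obtains vs where "distinct vs" "length vs = n" "\<forall>(i, j)\<in>set es. R (vs ! i) (vs ! j)"
  using embeds_listD[OF assms] by blast

lemma pattern_freeI:
  assumes "\<And>a b c d e f g. distinct [a, b, c, d, e, f, g] \<Longrightarrow> R a b \<Longrightarrow> R b c \<Longrightarrow> R c d \<Longrightarrow> R d e \<Longrightarrow> R f g \<Longrightarrow> False"
    and "\<And>a b c d e f. distinct [a, b, c, d, e, f] \<Longrightarrow> R a b \<Longrightarrow> R b c \<Longrightarrow> R c d \<Longrightarrow> R a d \<Longrightarrow> R e f \<Longrightarrow> False"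
    and "\<And>a b c d e f. distinct [a, b, c, d, e, f] \<Longrightarrow> R a b \<Longrightarrow> R b c \<Longrightarrow> R c d \<Longrightarrow> R d e \<Longrightarrow> R e f \<Longrightarrow> False"
    and "\<And>a b c d e. distinct [a, b, c, d, e] \<Longrightarrow> R a b \<Longrightarrow> R b c \<Longrightarrow> R c d \<Longrightarrow> R d e \<Longrightarrow> R a e \<Longrightarrow> False"
    and "\<And>x y z p q. distinct [x, y, z, p, q] \<Longrightarrow> R x y \<Longrightarrow> R y z \<Longrightarrow> R x z \<Longrightarrow> R x p \<Longrightarrow> R y q \<Longrightarrow> False"
    and "\<And>x y z p. distinct [x, y, z, p] \<Longrightarrow> R x y \<Longrightarrow> R x z \<Longrightarrow> R x p \<Longrightarrow> R y z \<Longrightarrow> R y p \<Longrightarrow> False"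
    and "\<And>v u w1 w2 a1 a2 b1 b2. distinct [v, u, w1, w2, a1, a2, b1, b2] \<Longrightarrow> R v u \<Longrightarrow> R v w1 \<Longrightarrow> R v w2 \<Longrightarrow>
      R w1 a1 \<Longrightarrow> R w1 a2 \<Longrightarrow> R w2 b1 \<Longrightarrow> R w2 b2 \<Longrightarrow> False"
  shows pattern_free
  unfolding pattern_free_def
proof (intro conjI notI)
  assume e: "embeds E 7 P5_P2"
  obtain vs where vs: "distinct vs" "length vs = 7" "\<forall>(i, j)\<in>set P5_P2. R (vs ! i) (vs ! j)"
    by (rule embeds_obtain_list[OF e]) auto
  then obtain a b c d e f g where "vs = [a, b, c, d, e, f, g]"
    by (auto simp: numeral_eq_Suc length_Suc_conv)
  with vs assms(1)[of a b c d e f g] show False by simp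
next
  assume e: "embeds E 6 C4_P2"
  obtain vs where vs: "distinct vs" "length vs = 6" "\<forall>(i, j)\<in>set C4_P2. R (vs ! i) (vs ! j)"
    by (rule embeds_obtain_list[OF e]) auto
  then obtain a b c d e f where "vs = [a, b, c, d, e, f]"
    by (auto simp: numeral_eq_Suc length_Suc_conv)
  with vs assms(2)[of a b c d e f] show False by simp
next
  assume e: "embeds E 6 P6"
  obtain vs where vs: "distinct vs" "length vs = 6" "\<forall>(i, j)\<in>set P6. R (vs ! i) (vs ! j)"
    by (rule embeds_obtain_list[OF e]) auto
  then obtain a b c d e f where "vs = [a, b, c, d, e, f]"
    by (auto simp: numeral_eq_Suc length_Suc_conv)
  with vs assms(3)[of a b c d e f] show False by simp
next
  assume e: "embeds E 5 C5"
  obtain vs where vs: "distinct vs" "length vs = 5" "\<forall>(i, j)\<in>set C5. R (vs ! i) (vs ! j)"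
    by (rule embeds_obtain_list[OF e]) auto
  then obtain a b c d e where "vs = [a, b, c, d, e]"
    by (auto simp: numeral_eq_Suc length_Suc_conv)
  with vs assms(4)[of a b c d e] show False by simp
next
  assume e: "embeds E 5 Bull"
  obtain vs where vs: "distinct vs" "length vs = 5" "\<forall>(i, j)\<in>set Bull. R (vs ! i) (vs ! j)"
    by (rule embeds_obtain_list[OF e]) auto
  then obtain a b c d e where "vs = [a, b, c, d, e]"
    by (auto simp: numeral_eq_Suc length_Suc_conv)
  with vs assms(5)[of a b c d e] show False by simp
next
  assume e: "embeds E 4 Diamond"
  obtain vs where vs: "distinct vs" "length vs = 4" "\<forall>(i, j)\<in>set Diamond. R (vs ! i) (vs ! j)"
    by (rule embeds_obtain_list[OF e]) auto
  then obtain a b c d where "vs = [a, b, c, d]"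
    by (auto simp: numeral_eq_Suc length_Suc_conv)
  with vs assms(6)[of a b c d] show False by simp
next
  assume e: "embeds E 8 F1"
  obtain vs where vs: "distinct vs" "length vs = 8" "\<forall>(i, j)\<in>set F1. R (vs ! i) (vs ! j)"
    by (rule embeds_obtain_list[OF e]) auto
  then obtain a b c d e f g h where "vs = [a, b, c, d, e, f, g, h]"
    by (auto simp: numeral_eq_Suc length_Suc_conv)
  with vs assms(7)[of a b c d e f g h] show False by simp
qed

lemma P5_C4_free_imp_pattern_free:
  assumes P5_C4_free
  shows pattern_free
proof -
  have P5: False if "distinct [a, b, c, d, e]" "R a b" "R b c" "R c d" "R d e" for a b c d e
    using assms that unfolding P5_C4_free_def by blast
  have C4: False if "distinct [a, b, c, d]" "R a b" "R b c" "R c d" "R d a" for a b c d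
    using assms that unfolding P5_C4_free_def by blast
  show ?thesis
  proof (rule pattern_freeI)
    fix a b c d e f g assume "distinct [a, b, c, d, e, f, g]" "R a b" "R b c" "R c d" "R d e" "R f g"
    then show False using P5[of a b c d e] by simp
  next
    fix a b c d e f assume "distinct [a, b, c, d, e, f]" "R a b" "R b c" "R c d" "R a d" "R e f"
    then show False using C4[of a b c d] R_sym by simp
  next
    fix a b c d e f assume "distinct [a, b, c, d, e, f]" "R a b" "R b c" "R c d" "R d e" "R e f"
    then show False using P5[of a b c d e] by simp
  next
    fix a b c d e assume "distinct [a, b, c, d, e]" "R a b" "R b c" "R c d" "R d e" "R a e"
    then show False using P5[of a b c d e] by simp
  next
    fix x y z p q assume "distinct [x, y, z, p, q]" "R x y" "R y z" "R x z" "R x p" "R y q"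
    then show False using P5[of p x z y q] R_sym by auto
  next
    fix x y z p assume "distinct [x, y, z, p]" "R x y" "R x z" "R x p" "R y z" "R y p"
    then show False using C4[of x z y p] R_sym by auto
  next
    fix v u w1 w2 a1 a2 b1 b2
    assume "distinct [v, u, w1, w2, a1, a2, b1, b2]" "R v u" "R v w1" "R v w2" "R w1 a1" "R w1 a2" "R w2 b1" "R w2 b2"
    then show False using P5[of a1 w1 v w2 b1] R_sym by auto
  qed
qed

text \<open>Every edge has exactly one end among the two centres. Each forbidden graph either
  contains an odd cycle or has no set of two vertices that meets all its edges.\<close>

lemma candy_pattern_free:
  assumes "candy_set E"
  shows pattern_free
proof -
  obtain v1 v2 W X Y where vd: "vertices_distinct [v1, v2] [W, X, Y]" and E: "E = candy_edges v1 v2 W X Y"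
    using assms unfolding candy_set_def by blast
  have neq: "v1 \<noteq> v2" "v1 \<notin> W" "v2 \<notin> W" "v1 \<notin> X" "v2 \<notin> X" "v1 \<notin> Y" "v2 \<notin> Y"
    using vd by (auto simp: vertices_distinct_def)
  have ends: "(f \<in> {v1, v2}) \<noteq> (g \<in> {v1, v2})" if "R f g" for f g
  proof -
    from that consider x where "x \<in> W \<union> X" "{f, g} = {v1, x}" | x where "x \<in> W \<union> Y" "{f, g} = {v2, x}"
      unfolding E candy_edges_def by blast
    then show ?thesis by cases (use neq in \<open>auto simp: doubleton_eq_iff\<close>)
  qed
  show ?thesis
    by (rule pattern_freeI) ((drule ends)+, auto)+
qed

lemma double_vase_pattern_free:
  assumes "double_vase_set E"
  shows pattern_free
proof -
  obtain v x1 x2 y1 y2 X where vd: "vertices_distinct [v, x1, x2, y1, y2] [X]"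
    and E: "E = double_vase_edges v x1 x2 y1 y2 X"
    using assms by (auto simp: double_vase_set_def)
  have neq: "distinct [v, x1, x2, y1, y2]" using vd by (simp add: vertices_distinct_def)
  have ends: "f = v \<or> g = v \<or> f = x1 \<and> g = x2 \<or> f = x2 \<and> g = x1 \<or> f = y1 \<and> g = y2 \<or> f = y2 \<and> g = y1"
    if "R f g" for f g
    using that unfolding E double_vase_edges_def by (auto simp: doubleton_eq_iff)
  show ?thesis
    by (rule pattern_freeI) ((drule ends)+, use neq in auto)+
qed

text \<open>A shooting star is an amaryllis without one of the two triangle edges at
  \<open>v\<close>. This description of the edges fits both, so one case analysis serves both
  families.\<close>

lemma pattern_free_if_ends:
  assumes neq: "distinct [v, w, c1, c2]" "{v, w, c1, c2} \<inter> X = {}"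
    and ends: "\<And>f g. R f g \<Longrightarrow> f = v \<and> g \<notin> X \<or> g = v \<and> f \<notin> X \<or> f = w \<and> g \<in> X \<or> g = w \<and> f \<in> X \<or>
      f = c1 \<and> g = c2 \<or> f = c2 \<and> g = c1"
  shows pattern_free
  by (rule pattern_freeI) ((drule ends)+, use neq in auto)+

lemma amaryllis_pattern_free:
  assumes "amaryllis_set E"
  shows pattern_free
proof -
  obtain v w c1 c2 X Y where vd: "vertices_distinct [v, w, c1, c2] [X, Y]"
    and E: "E = amaryllis_edges v w c1 c2 X Y"
    using assms unfolding amaryllis_set_def by blast
  have neq: "distinct [v, w, c1, c2]" "{v, w, c1, c2} \<inter> X = {}" "w \<notin> Y" "X \<inter> Y = {}"
    using vd by (auto simp: vertices_distinct_def less_Suc_eq)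
  show ?thesis
  proof (rule pattern_free_if_ends[OF neq(1,2)])
    fix f g assume "R f g"
    then consider "{f, g} = {w, v}" | "{f, g} = {v, c1}" | "{f, g} = {c1, c2}" | "{f, g} = {c2, v}"
      | x where "x \<in> X" "{f, g} = {w, x}" | y where "y \<in> Y" "{f, g} = {v, y}"
      unfolding E amaryllis_edges_def by blast
    then show "f = v \<and> g \<notin> X \<or> g = v \<and> f \<notin> X \<or> f = w \<and> g \<in> X \<or> g = w \<and> f \<in> X \<or>
      f = c1 \<and> g = c2 \<or> f = c2 \<and> g = c1"
      by cases (use neq in \<open>auto simp: doubleton_eq_iff\<close>)
  qed
qed

lemma shooting_star_pattern_free:
  assumes "shooting_star_set E"
  shows pattern_free
proof -
  obtain v w a b X Y where vd: "vertices_distinct [v, w, a, b] [X, Y]"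
    and E: "E = shooting_star_edges v w a b X Y"
    using assms unfolding shooting_star_set_def by blast
  have neq: "distinct [v, w, a, b]" "{v, w, a, b} \<inter> X = {}" "w \<notin> Y" "X \<inter> Y = {}"
    using vd by (auto simp: vertices_distinct_def less_Suc_eq)
  show ?thesis
  proof (rule pattern_free_if_ends[OF neq(1,2)])
    fix f g assume "R f g"
    then consider "{f, g} = {w, v}" | "{f, g} = {v, a}" | "{f, g} = {a, b}"
      | x where "x \<in> X" "{f, g} = {w, x}" | y where "y \<in> Y" "{f, g} = {v, y}"
      unfolding E shooting_star_edges_def by blast
    then show "f = v \<and> g \<notin> X \<or> g = v \<and> f \<notin> X \<or> f = w \<and> g \<in> X \<or> g = w \<and> f \<in> X \<or>
      f = a \<and> g = b \<or> f = b \<and> g = a"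
      by cases (use neq in \<open>auto simp: doubleton_eq_iff\<close>)
  qed
qed

lemma double_star_P5_C4_free:
  assumes "double_star_set S"
  shows "\<lbrakk>distinct [a, b, c, d, e]; {a, b} \<in> S; {b, c} \<in> S; {c, d} \<in> S; {d, e} \<in> S\<rbrakk> \<Longrightarrow> False"
    "\<lbrakk>distinct [a, b, c, d]; {a, b} \<in> S; {b, c} \<in> S; {c, d} \<in> S; {d, a} \<in> S\<rbrakk> \<Longrightarrow> False"
proof -
  obtain w1 w2 X Y where vd: "vertices_distinct [w1, w2] [X, Y]" and S: "S = double_star_edges w1 w2 X Y"
    using assms unfolding double_star_set_def by blast
  have neq: "w1 \<noteq> w2" "{w1, w2} \<inter> X = {}" "{w1, w2} \<inter> Y = {}" "X \<inter> Y = {}"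
    using vd by (auto simp: vertices_distinct_def less_Suc_eq)
  have ends: "f = w1 \<and> g = w2 \<or> f = w2 \<and> g = w1 \<or> f = w1 \<and> g \<in> X \<or> f \<in> X \<and> g = w1 \<or> f = w2 \<and> g \<in> Y \<or> f \<in> Y \<and> g = w2"
    if "{f, g} \<in> S" for f g
  proof -
    from that consider "{f, g} = {w1, w2}" | x where "x \<in> X" "{f, g} = {w1, x}" | y where "y \<in> Y" "{f, g} = {w2, y}"
      unfolding S double_star_edges_def by blast
    then show ?thesis by cases (auto simp: doubleton_eq_iff)
  qed
  show "\<lbrakk>distinct [a, b, c, d, e]; {a, b} \<in> S; {b, c} \<in> S; {c, d} \<in> S; {d, e} \<in> S\<rbrakk> \<Longrightarrow> False"
    by ((drule ends)+, use neq in auto)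
  show "\<lbrakk>distinct [a, b, c, d]; {a, b} \<in> S; {b, c} \<in> S; {c, d} \<in> S; {d, a} \<in> S\<rbrakk> \<Longrightarrow> False"
    by ((drule ends)+, use neq in auto)
qed

lemma vase_P5_C4_free:
  assumes "vase_set S"
  shows "\<lbrakk>distinct [a, b, c, d, e]; {a, b} \<in> S; {b, c} \<in> S; {c, d} \<in> S; {d, e} \<in> S\<rbrakk> \<Longrightarrow> False"
    "\<lbrakk>distinct [a, b, c, d]; {a, b} \<in> S; {b, c} \<in> S; {c, d} \<in> S; {d, a} \<in> S\<rbrakk> \<Longrightarrow> False"
proof -
  obtain w1 w2 w3 X where vd: "vertices_distinct [w1, w2, w3] [X]" and S: "S = vase_edges w1 w2 w3 X"
    using assms unfolding vase_set_def by blast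
  have neq: "distinct [w1, w2, w3]" "{w1, w2, w3} \<inter> X = {}"
    using vd by (auto simp: vertices_distinct_def)
  have ends: "f = w1 \<and> g = w2 \<or> f = w2 \<and> g = w1 \<or> f = w1 \<and> g = w3 \<or> f = w3 \<and> g = w1 \<or> f = w2 \<and> g = w3 \<or> f = w3 \<and> g = w2 \<or>
      f = w1 \<and> g \<in> X \<or> f \<in> X \<and> g = w1"
    if "{f, g} \<in> S" for f g
  proof -
    from that consider "{f, g} = {w1, w2}" | "{f, g} = {w2, w3}" | "{f, g} = {w1, w3}" | x where "x \<in> X" "{f, g} = {w1, x}"
      unfolding S vase_edges_def by blast
    then show ?thesis by cases (auto simp: doubleton_eq_iff)
  qed
  show "\<lbrakk>distinct [a, b, c, d, e]; {a, b} \<in> S; {b, c} \<in> S; {c, d} \<in> S; {d, e} \<in> S\<rbrakk> \<Longrightarrow> False"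
    by ((drule ends)+, use neq in auto)
  show "\<lbrakk>distinct [a, b, c, d]; {a, b} \<in> S; {b, c} \<in> S; {c, d} \<in> S; {d, a} \<in> S\<rbrakk> \<Longrightarrow> False"
    by ((drule ends)+, use neq in auto)
qed

end

section \<open>Forbidden graphs as patterns\<close>

lemma pattern_edge_comp: "pattern_edge (\<lambda>i. h (g i)) p = h ` pattern_edge g p"
  by (simp add: pattern_edge_def split: prod.split)

text \<open>\<open>f\<close> numbers the vertices of \<open>H\<close>. The graph
  \<open>edge_graph F\<close> has no isolated vertices, so \<open>cover\<close> demands the same of
  the pattern; then an injective placement of the numbers and an isomorphism from the selected edges
  determine each other.\<close>

lemma has_edge_induced_iff_embeds:
  assumes f: "bij_betw f {..<n} (verts H)" and edges: "edges H = pattern_edge f ` set es"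
    and cover: "\<Union> (pattern_edge id ` set es) = {..<n}"
  shows "has_edge_induced G H \<longleftrightarrow> embeds (edges G) n es"
proof
  have idx: "pattern_edge id p \<subseteq> {..<n}" if "p \<in> set es" for p using cover that by blast
  have pe: "pattern_edge g p = g ` pattern_edge id p" for g :: "nat \<Rightarrow> 'c" and p
    using pattern_edge_comp[of g id p] by simp
  {
    assume "has_edge_induced G H"
    then obtain F \<phi> where F: "F \<subseteq> edges G" and \<phi>: "bij_betw \<phi> (\<Union>F) (verts H)" and im: "(\<lambda>e. \<phi> ` e) ` F = edges H"
      by (auto simp: has_edge_induced_def graph_iso_def edge_graph_def)
    define g where "g i = the_inv_into (\<Union>F) \<phi> (f i)" for i
    have "inj_on g {..<n}"
    proof (rule inj_onI)
      fix i j assume ij: "i \<in> {..<n}" "j \<in> {..<n}" "g i = g j"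
      then have "f i \<in> verts H" "f j \<in> verts H" using f by (auto simp: bij_betw_def)
      then have "f i = f j"
        using ij(3) \<phi> unfolding g_def by (metis bij_betw_def f_the_inv_into_f)
      then show "i = j" using ij f by (auto simp: bij_betw_def inj_on_eq_iff)
    qed
    moreover have "pattern_edge g p \<in> edges G" if "p \<in> set es" for p
    proof -
      have "pattern_edge f p \<in> edges H" using that edges by blast
      then obtain e where e: "e \<in> F" "\<phi> ` e = pattern_edge f p" unfolding im[symmetric] by blast
      have "pattern_edge g p = the_inv_into (\<Union>F) \<phi> ` \<phi> ` e"
        unfolding e(2) g_def pattern_edge_comp ..
      also have "\<dots> = (\<lambda>x. x) ` e"
        unfolding image_image
        by (rule image_cong) (use e(1) \<phi> in \<open>auto simp: bij_betw_def intro!: the_inv_into_f_f\<close>)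
      also have "\<dots> = e" by simp
      finally show ?thesis using e(1) F by blast
    qed
    ultimately show "embeds (edges G) n es" by (auto simp: embeds_def)
  }
  {
    assume "embeds (edges G) n es"
    then obtain g where g: "inj_on g {..<n}" "pattern_edge g ` set es \<subseteq> edges G" by (auto simp: embeds_def)
    let ?F = "pattern_edge g ` set es"
    let ?\<phi> = "\<lambda>x. f (the_inv_into {..<n} g x)"
    have U: "\<Union>?F = g ` {..<n}"
    proof -
      have "\<Union>?F = g ` \<Union> (pattern_edge id ` set es)" unfolding pe[of g] by blast
      then show ?thesis by (simp add: cover)
    qed
    have "bij_betw (the_inv_into {..<n} g) (g ` {..<n}) {..<n}"
      using g(1) by (intro bij_betw_the_inv_into) (simp add: bij_betw_def)
    from bij_betw_trans[OF this f] have "bij_betw ?\<phi> (\<Union>?F) (verts H)" by (simp add: U comp_def)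
    moreover have "?\<phi> ` pattern_edge g p = pattern_edge f p" if "p \<in> set es" for p
      unfolding pe[of g] pe[of f] image_image
      by (rule image_cong) (use idx[OF that] g(1) in \<open>auto simp: the_inv_into_f_f subset_iff\<close>)
    then have "(\<lambda>e. ?\<phi> ` e) ` ?F = edges H" unfolding edges image_image by (rule image_cong[OF refl])
    ultimately have "graph_iso (edge_graph ?F) H"
      unfolding graph_iso_def by (intro exI[of _ ?\<phi>]) (simp add: edge_graph_def)
    then show "has_edge_induced G H" using g(2) by (auto simp: has_edge_induced_def)
  }
qed

lemma path_graph_eq: "path_graph n = \<lparr>verts = {..<n}, edges = (\<lambda>i. {i, i + 1}) ` {..<n - 1}\<rparr>"
  by (auto simp: path_graph_def)

lemma cycle_graph_eq: "cycle_graph n = \<lparr>verts = {..<n}, edges = (\<lambda>i. {i, (i + 1) mod n}) ` {..<n}\<rparr>"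
  by (auto simp: cycle_graph_def)

lemma bij_betw_sum_nat:
  fixes m n :: nat
  shows "bij_betw (\<lambda>i. if i < m then Inl i else Inr (i - m)) {..<m + n} (Inl ` {..<m} \<union> Inr ` {..<n})"
  by (rule bij_betw_byWitness[where f' = "\<lambda>x. case x of Inl i \<Rightarrow> i | Inr j \<Rightarrow> m + j"]) auto

lemma forbidden_patterns:
  "has_edge_induced G (disjoint_union (path_graph 5) (path_graph 2)) \<longleftrightarrow> embeds (edges G) 7 P5_P2"
  "has_edge_induced G (disjoint_union (cycle_graph 4) (path_graph 2)) \<longleftrightarrow> embeds (edges G) 6 C4_P2"
  "has_edge_induced G (path_graph 6) \<longleftrightarrow> embeds (edges G) 6 P6"
  "has_edge_induced G (cycle_graph 5) \<longleftrightarrow> embeds (edges G) 5 C5"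
  "has_edge_induced G bull \<longleftrightarrow> embeds (edges G) 5 Bull"
  "has_edge_induced G diamond \<longleftrightarrow> embeds (edges G) 4 Diamond"
  "has_edge_induced G caterpillar_F1 \<longleftrightarrow> embeds (edges G) 8 F1"
proof -
  note lt = lessThan_nat_numeral lessThan_Suc
  have edges: "edges (path_graph 5) = {{0,1},{1,2},{2,3},{3,4}}" "edges (path_graph 2) = {{0,1}}"
    "edges (path_graph 6) = {{0,1},{1,2},{2,3},{3,4},{4,5}}"
    "edges (cycle_graph 4) = {{0,1},{1,2},{2,3},{0,3}}"
    "edges (cycle_graph 5) = {{0,1},{1,2},{2,3},{3,4},{0,4}}"
    by (simp_all add: path_graph_eq cycle_graph_eq lt numeral_2_eq_2[symmetric] insert_commute)
  have verts: "verts (path_graph n) = {..<n}" "verts (cycle_graph n) = {..<n}" for n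
    by (simp_all add: path_graph_def cycle_graph_def)
  note defs = disjoint_union_def edges verts pattern_edge_def
  show "has_edge_induced G (disjoint_union (path_graph 5) (path_graph 2)) \<longleftrightarrow> embeds (edges G) 7 P5_P2"
  proof (rule has_edge_induced_iff_embeds[of "\<lambda>i. if i < 5 then Inl i else Inr (i - 5)"])
    show "bij_betw (\<lambda>i. if i < 5 then Inl i else Inr (i - 5)) {..<7} (verts (disjoint_union (path_graph 5) (path_graph 2)))"
      using bij_betw_sum_nat[of 5 2] by (simp add: defs)
  qed (simp_all add: defs lt insert_commute)
  show "has_edge_induced G (disjoint_union (cycle_graph 4) (path_graph 2)) \<longleftrightarrow> embeds (edges G) 6 C4_P2"
  proof (rule has_edge_induced_iff_embeds[of "\<lambda>i. if i < 4 then Inl i else Inr (i - 4)"])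
    show "bij_betw (\<lambda>i. if i < 4 then Inl i else Inr (i - 4)) {..<6} (verts (disjoint_union (cycle_graph 4) (path_graph 2)))"
      using bij_betw_sum_nat[of 4 2] by (simp add: defs)
  qed (simp_all add: defs lt insert_commute)
  show "has_edge_induced G (path_graph 6) \<longleftrightarrow> embeds (edges G) 6 P6"
    by (rule has_edge_induced_iff_embeds[of id]) (simp_all add: defs lt numeral_2_eq_2 insert_commute)
  show "has_edge_induced G (cycle_graph 5) \<longleftrightarrow> embeds (edges G) 5 C5"
    by (rule has_edge_induced_iff_embeds[of id]) (simp_all add: defs lt numeral_2_eq_2 insert_commute)
  show "has_edge_induced G bull \<longleftrightarrow> embeds (edges G) 5 Bull"
    by (rule has_edge_induced_iff_embeds[of id])
      (simp_all add: bull_def edge_graph_def pattern_edge_def lt bij_betw_def numeral_2_eq_2 insert_commute)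
  show "has_edge_induced G diamond \<longleftrightarrow> embeds (edges G) 4 Diamond"
    by (rule has_edge_induced_iff_embeds[of id])
      (simp_all add: diamond_def edge_graph_def pattern_edge_def lt bij_betw_def numeral_2_eq_2 insert_commute)
  show "has_edge_induced G caterpillar_F1 \<longleftrightarrow> embeds (edges G) 8 F1"
    by (rule has_edge_induced_iff_embeds[of id])
      (simp_all add: caterpillar_F1_def edge_graph_def pattern_edge_def lt bij_betw_def numeral_2_eq_2 insert_commute)
qed

section \<open>Labelled graphs\<close>

lemma image_shapes:
  "(`) h ` double_star_edges w1 w2 X Y = double_star_edges (h w1) (h w2) (h ` X) (h ` Y)"
  "(`) h ` vase_edges w1 w2 w3 X = vase_edges (h w1) (h w2) (h w3) (h ` X)"
  "(`) h ` candy_edges v1 v2 W X Y = candy_edges (h v1) (h v2) (h ` W) (h ` X) (h ` Y)"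
  "(`) h ` shooting_star_edges v w a b X Y = shooting_star_edges (h v) (h w) (h a) (h b) (h ` X) (h ` Y)"
  "(`) h ` double_vase_edges v x1 x2 y1 y2 X = double_vase_edges (h v) (h x1) (h x2) (h y1) (h y2) (h ` X)"
  "(`) h ` amaryllis_edges v w c1 c2 X Y = amaryllis_edges (h v) (h w) (h c1) (h c2) (h ` X) (h ` Y)"
  by (simp_all add: double_star_edges_def vase_edges_def candy_edges_def shooting_star_edges_def
      double_vase_edges_def amaryllis_edges_def image_Un image_image)

lemma label_graphs:
  "double_star m n = edge_graph (double_star_edges (Core 1) (Core 2) (LeafX ` {..<m}) (LeafY ` {..<n}))"
  "vase n = edge_graph (vase_edges (Core 1) (Core 2) (Core 3) (LeafX ` {..<n}))"
  "candy m n1 n2 = edge_graph (candy_edges (Core 1) (Core 2) (Mid ` {..<m}) (LeafX ` {..<n1}) (LeafY ` {..<n2}))"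
  "shooting_star m n = edge_graph
     (shooting_star_edges (Core 1) (Core 2) (Core 3) (Core 4) (LeafX ` {..<m}) (LeafY ` {..<n}))"
  "double_vase n = edge_graph
     (double_vase_edges (Core 1) (Core 2) (Core 3) (Core 4) (Core 5) (LeafX ` {..<n}))"
  "amaryllis m n = edge_graph
     (amaryllis_edges (Core 1) (Core 2) (Core 3) (Core 4) (LeafX ` {..<m}) (LeafY ` {..<n}))"
proof -
  have p: "pendants v l n = (\<lambda>x. {v, x}) ` l ` {..<n}" for v l n by (auto simp: pendants_def)
  have c: "{{v, Mid j} | v j. v \<in> {Core 1, Core 2} \<and> j < m} =
    (\<lambda>x. {Core 1, x}) ` Mid ` {..<m} \<union> (\<lambda>x. {Core 2, x}) ` Mid ` {..<m}" for m by auto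
  show "double_star m n = edge_graph (double_star_edges (Core 1) (Core 2) (LeafX ` {..<m}) (LeafY ` {..<n}))"
    by (simp only: double_star_def double_star_edges_def p)
  show "vase n = edge_graph (vase_edges (Core 1) (Core 2) (Core 3) (LeafX ` {..<n}))"
    by (simp only: vase_def vase_edges_def p)
  show "candy m n1 n2 = edge_graph (candy_edges (Core 1) (Core 2) (Mid ` {..<m}) (LeafX ` {..<n1}) (LeafY ` {..<n2}))"
    by (simp only: candy_def candy_edges_def p c)
  show "shooting_star m n = edge_graph
     (shooting_star_edges (Core 1) (Core 2) (Core 3) (Core 4) (LeafX ` {..<m}) (LeafY ` {..<n}))"
    by (simp only: shooting_star_def shooting_star_edges_def p)
  show "double_vase n = edge_graph
     (double_vase_edges (Core 1) (Core 2) (Core 3) (Core 4) (Core 5) (LeafX ` {..<n}))"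
    by (simp only: double_vase_def double_vase_edges_def p)
  show "amaryllis m n = edge_graph
     (amaryllis_edges (Core 1) (Core 2) (Core 3) (Core 4) (LeafX ` {..<m}) (LeafY ` {..<n}))"
    by (simp only: amaryllis_def amaryllis_edges_def p)
qed

text \<open>The inverse of the isomorphism places the labels in the graph, so the edges of
  \<open>C\<close> become an image of the labelled shape and \<open>image_shapes\<close>
  applies.\<close>

lemma graph_iso_edge_graphD:
  assumes "graph_iso C (edge_graph L)" "\<And>e. e \<in> edges C \<Longrightarrow> e \<subseteq> verts C"
  obtains h where "inj_on h (\<Union>L)" "edges C = (`) h ` L"
proof -
  obtain \<phi> where \<phi>: "bij_betw \<phi> (verts C) (\<Union>L)" and im: "(`) \<phi> ` edges C = L"
    using assms(1) by (auto simp: graph_iso_def edge_graph_def)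
  let ?h = "the_inv_into (verts C) \<phi>"
  have "?h ` \<phi> ` e = e" if "e \<in> edges C" for e
  proof -
    have "?h ` \<phi> ` e = (\<lambda>x. x) ` e"
      unfolding image_image
      by (rule image_cong) (use assms(2)[OF that] \<phi> in \<open>auto simp: bij_betw_def intro!: the_inv_into_f_f\<close>)
    then show ?thesis by simp
  qed
  then have "(`) ?h ` (`) \<phi> ` edges C = (\<lambda>x. x) ` edges C"
    unfolding image_image[of "(`) ?h"] by (intro image_cong) simp_all
  then have "edges C = (`) ?h ` L" by (simp add: im)
  moreover have "inj_on ?h (\<Union>L)"
    using bij_betw_the_inv_into[OF \<phi>] by (simp add: bij_betw_def)
  ultimately show ?thesis using that by blast
qed

lemma graph_iso_edge_graphI:
  assumes "inj_on h (\<Union>L)" "S = (`) h ` L"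
  shows "graph_iso (edge_graph S) (edge_graph L)"
proof -
  let ?g = "the_inv_into (\<Union>L) h"
  have "\<Union>S = h ` \<Union>L" using assms(2) by blast
  then have "bij_betw ?g (\<Union>S) (\<Union>L)"
    using assms(1) by (intro bij_betw_the_inv_into) (simp add: bij_betw_def)
  moreover have "?g ` h ` e = e" if "e \<in> L" for e
  proof -
    have "?g ` h ` e = (\<lambda>x. x) ` e"
      unfolding image_image
      by (rule image_cong) (use that assms(1) in \<open>auto intro!: the_inv_into_f_f\<close>)
    then show ?thesis by simp
  qed
  then have "(`) ?g ` S = (\<lambda>x. x) ` L"
    unfolding assms(2) image_image[of "(`) ?g"] by (intro image_cong) simp_all
  ultimately show ?thesis
    unfolding graph_iso_def by (intro exI[of _ ?g]) (simp add: edge_graph_def)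
qed

lemma vertices_distinct_image:
  assumes "vertices_distinct cs Xs" "inj_on h (set cs \<union> \<Union>(set Xs))"
  shows "vertices_distinct (map h cs) (map ((`) h) Xs)"
  unfolding vertices_distinct_def
proof (intro conjI ballI allI impI)
  show "distinct (map h cs)"
    using assms by (auto simp: distinct_map vertices_distinct_def intro: inj_on_subset)
  fix Y assume "Y \<in> set (map ((`) h) Xs)"
  then obtain X where X: "X \<in> set Xs" "Y = h ` X" by auto
  with assms(1) show "finite Y" by (simp add: vertices_distinct_def)
  have "h ` (set cs \<inter> X) = h ` set cs \<inter> h ` X"
    by (rule inj_on_image_Int[OF assms(2)]) (use X in auto)
  then show "set (map h cs) \<inter> Y = {}" using assms(1) X by (simp add: vertices_distinct_def)
next
  fix i j assume ij: "i < length (map ((`) h) Xs)" "j < i"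
  have "h ` (Xs ! i \<inter> Xs ! j) = h ` (Xs ! i) \<inter> h ` (Xs ! j)"
    by (rule inj_on_image_Int[OF assms(2)]) (use ij in \<open>auto intro!: UnI2 bexI[OF _ nth_mem]\<close>)
  then show "map ((`) h) Xs ! i \<inter> map ((`) h) Xs ! j = {}"
    using assms(1) ij by (simp add: vertices_distinct_def)
qed

lemma inj_on_disjoint_Un:
  "inj_on f A \<Longrightarrow> inj_on f B \<Longrightarrow> f ` A \<inter> f ` B = {} \<Longrightarrow> inj_on f (A \<union> B)"
  unfolding inj_on_def by blast

text \<open>One injection for all six families: the three sets receive the labels
  \<open>Mid\<close>, \<open>LeafX\<close> and \<open>LeafY\<close>, and a family that lacks one of
  these kinds supplies the empty set.\<close>

lemma labelling:
  assumes "vertices_distinct cs [W, X, Y]"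
  shows "\<exists>h. inj_on h (Core ` {1..length cs} \<union> Mid ` {..<card W} \<union> LeafX ` {..<card X} \<union> LeafY ` {..<card Y}) \<and>
    (\<forall>i. h (Core (Suc i)) = cs ! i) \<and> h ` Mid ` {..<card W} = W \<and> h ` LeafX ` {..<card X} = X \<and>
    h ` LeafY ` {..<card Y} = Y"
proof -
  have fin: "finite W" "finite X" "finite Y" and d: "distinct cs" "set cs \<inter> W = {}" "set cs \<inter> X = {}" "set cs \<inter> Y = {}"
    "W \<inter> X = {}" "W \<inter> Y = {}" "X \<inter> Y = {}"
    using assms unfolding vertices_distinct_def by (simp_all add: less_Suc_eq all_conj_distrib) blast+
  obtain fW fX fY where f: "bij_betw fW {..<card W} W" "bij_betw fX {..<card X} X" "bij_betw fY {..<card Y} Y"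
    using ex_bij_betw_nat_finite[OF fin(1)] ex_bij_betw_nat_finite[OF fin(2)] ex_bij_betw_nat_finite[OF fin(3)]
    by (auto simp: atLeast0LessThan)
  \<comment> \<open>The core labels start at 1 and list positions at 0, hence the index
    \<open>i - 1\<close>.\<close>
  define h where "h l = (case l of Core i \<Rightarrow> cs ! (i - 1) | Mid j \<Rightarrow> fW j | LeafX j \<Rightarrow> fX j | LeafY j \<Rightarrow> fY j)" for l
  have im: "h ` Mid ` {..<card W} = W" "h ` LeafX ` {..<card X} = X" "h ` LeafY ` {..<card Y} = Y"
    using f by (auto simp: h_def image_image bij_betw_def)
  have core: "h ` Core ` {1..length cs} \<subseteq> set cs" by (auto simp: h_def)
  have "inj_on h (Core ` {1..length cs})"
    using d(1) by (auto simp: inj_on_def h_def nth_eq_iff_index_eq)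
  moreover have "inj_on h (Mid ` {..<card W})" "inj_on h (LeafX ` {..<card X})" "inj_on h (LeafY ` {..<card Y})"
    using f by (auto simp: inj_on_def h_def bij_betw_def)
  ultimately have "inj_on h (Core ` {1..length cs} \<union> Mid ` {..<card W} \<union> LeafX ` {..<card X} \<union> LeafY ` {..<card Y})"
  proof (intro inj_on_disjoint_Un)
    have core': "h ` Core ` {1..length cs} \<inter> Z = {}" if "set cs \<inter> Z = {}" for Z using core that by blast
    show "h ` Core ` {1..length cs} \<inter> h ` Mid ` {..<card W} = {}" unfolding im by (rule core'[OF d(2)])
    show "h ` (Core ` {1..length cs} \<union> Mid ` {..<card W}) \<inter> h ` LeafX ` {..<card X} = {}"
      unfolding image_Un im Int_Un_distrib2 using core'[OF d(3)] core'[OF d(4)] d(5-7) by simp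
    show "h ` (Core ` {1..length cs} \<union> Mid ` {..<card W} \<union> LeafX ` {..<card X}) \<inter> h ` LeafY ` {..<card Y} = {}"
      unfolding image_Un im Int_Un_distrib2 using core'[OF d(3)] core'[OF d(4)] d(5-7) by simp
  qed
  moreover have "h (Core (Suc i)) = cs ! i" for i by (simp add: h_def)
  ultimately show ?thesis using im by blast
qed

lemma double_star_set_if_is_double_star:
  assumes "is_double_star C" "\<And>e. e \<in> edges C \<Longrightarrow> e \<subseteq> verts C"
  shows "double_star_set (edges C)"
proof -
  obtain m n where iso: "graph_iso C (double_star m n)"
    using assms(1) by (auto simp: is_double_star_def)
  obtain h where h: "inj_on h (\<Union>(double_star_edges (Core 1) (Core 2) (LeafX ` {..<m}) (LeafY ` {..<n})))"
    "edges C = (`) h ` double_star_edges (Core 1) (Core 2) (LeafX ` {..<m}) (LeafY ` {..<n})"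
    using graph_iso_edge_graphD[OF iso[unfolded label_graphs] assms(2)] by blast
  have "vertices_distinct (map h [Core 1, Core 2]) (map ((`) h) [LeafX ` {..<m}, LeafY ` {..<n}])"
    by (intro vertices_distinct_image inj_on_subset[OF h(1)])
      (auto simp: vertices_distinct_def less_Suc_eq double_star_edges_def)
  
  then show ?thesis unfolding double_star_set_def h(2) image_shapes list.map by blast
qed

lemma is_double_star_if_double_star_set:
  assumes "double_star_set (S :: 'a set set)"
  shows "is_double_star (edge_graph S)"
proof -
  obtain w1 w2 X Y where vd: "vertices_distinct [w1, w2] [X, Y]" and S: "S = double_star_edges w1 w2 X Y"
    using assms unfolding double_star_set_def by blast
  have "vertices_distinct [w1, w2] [{}, X, Y]"
    using vd by (auto simp: vertices_distinct_def less_Suc_eq)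
  from labelling[OF this] obtain h where h: "inj_on h (Core ` {1..length [w1, w2]} \<union> Mid ` {..<card ({} :: 'a set)} \<union> LeafX ` {..<card X} \<union> LeafY ` {..<card Y})"
    "\<forall>i. h (Core (Suc i)) = [w1, w2] ! i" "h ` Mid ` {..<card ({} :: 'a set)} = {}" "h ` LeafX ` {..<card X} = X" "h ` LeafY ` {..<card Y} = Y"
    by (elim exE conjE)
  have core: "h (Core 1) = w1" "h (Core 2) = w2"
    using h(2)[rule_format, of 0] h(2)[rule_format, of 1] by (simp_all add: numeral_eq_Suc)
  have "graph_iso (edge_graph S) (double_star (card X) (card Y))"
    unfolding label_graphs
  proof (rule graph_iso_edge_graphI)
    show "inj_on h (\<Union>(double_star_edges (Core 1) (Core 2) (LeafX ` {..<card X}) (LeafY ` {..<card Y})))"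
      by (rule inj_on_subset[OF h(1)]) (auto simp: double_star_edges_def)
  qed (simp only: S image_shapes core h(3-5))
  
  then show ?thesis unfolding is_double_star_def by blast
qed

lemma vase_set_if_is_vase:
  assumes "is_vase C" "\<And>e. e \<in> edges C \<Longrightarrow> e \<subseteq> verts C"
  shows "vase_set (edges C)"
proof -
  obtain n where iso: "graph_iso C (vase n)"
    using assms(1) by (auto simp: is_vase_def)
  obtain h where h: "inj_on h (\<Union>(vase_edges (Core 1) (Core 2) (Core 3) (LeafX ` {..<n})))"
    "edges C = (`) h ` vase_edges (Core 1) (Core 2) (Core 3) (LeafX ` {..<n})"
    using graph_iso_edge_graphD[OF iso[unfolded label_graphs] assms(2)] by blast
  have "vertices_distinct (map h [Core 1, Core 2, Core 3]) (map ((`) h) [LeafX ` {..<n}])"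
    by (intro vertices_distinct_image inj_on_subset[OF h(1)])
      (auto simp: vertices_distinct_def less_Suc_eq vase_edges_def)
  
  then show ?thesis unfolding vase_set_def h(2) image_shapes list.map by blast
qed

lemma is_vase_if_vase_set:
  assumes "vase_set (S :: 'a set set)"
  shows "is_vase (edge_graph S)"
proof -
  obtain w1 w2 w3 X where vd: "vertices_distinct [w1, w2, w3] [X]" and S: "S = vase_edges w1 w2 w3 X"
    using assms unfolding vase_set_def by blast
  have "vertices_distinct [w1, w2, w3] [{}, X, {}]"
    using vd by (auto simp: vertices_distinct_def less_Suc_eq)
  from labelling[OF this] obtain h where h: "inj_on h (Core ` {1..length [w1, w2, w3]} \<union> Mid ` {..<card ({} :: 'a set)} \<union> LeafX ` {..<card X} \<union> LeafY ` {..<card ({} :: 'a set)})"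
    "\<forall>i. h (Core (Suc i)) = [w1, w2, w3] ! i" "h ` Mid ` {..<card ({} :: 'a set)} = {}" "h ` LeafX ` {..<card X} = X" "h ` LeafY ` {..<card ({} :: 'a set)} = {}"
    by (elim exE conjE)
  have core: "h (Core 1) = w1" "h (Core 2) = w2" "h (Core 3) = w3"
    using h(2)[rule_format, of 0] h(2)[rule_format, of 1] h(2)[rule_format, of 2] by (simp_all add: numeral_eq_Suc)
  have "graph_iso (edge_graph S) (vase (card X))"
    unfolding label_graphs
  proof (rule graph_iso_edge_graphI)
    show "inj_on h (\<Union>(vase_edges (Core 1) (Core 2) (Core 3) (LeafX ` {..<card X})))"
      by (rule inj_on_subset[OF h(1)]) (auto simp: vase_edges_def)
  qed (simp only: S image_shapes core h(3-5))
  
  then show ?thesis unfolding is_vase_def by blast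
qed

lemma candy_set_if_is_candy:
  assumes "is_candy C" "\<And>e. e \<in> edges C \<Longrightarrow> e \<subseteq> verts C"
  shows "candy_set (edges C)"
proof -
  obtain m n1 n2 where m: "1 \<le> m" and iso: "graph_iso C (candy m n1 n2)"
    using assms(1) by (auto simp: is_candy_def)
  obtain h where h: "inj_on h (\<Union>(candy_edges (Core 1) (Core 2) (Mid ` {..<m}) (LeafX ` {..<n1}) (LeafY ` {..<n2})))"
    "edges C = (`) h ` candy_edges (Core 1) (Core 2) (Mid ` {..<m}) (LeafX ` {..<n1}) (LeafY ` {..<n2})"
    using graph_iso_edge_graphD[OF iso[unfolded label_graphs] assms(2)] by blast
  have "vertices_distinct (map h [Core 1, Core 2]) (map ((`) h) [Mid ` {..<m}, LeafX ` {..<n1}, LeafY ` {..<n2}])"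
    by (intro vertices_distinct_image inj_on_subset[OF h(1)])
      (use m in \<open>auto simp: vertices_distinct_def less_Suc_eq candy_edges_def lessThan_empty_iff\<close>)
  moreover have "h ` Mid ` {..<m} \<noteq> {}" using m by (auto simp: lessThan_empty_iff)
  ultimately show ?thesis unfolding candy_set_def h(2) image_shapes list.map by blast
qed

lemma is_candy_if_candy_set:
  assumes "candy_set (S :: 'a set set)"
  shows "is_candy (edge_graph S)"
proof -
  obtain v1 v2 W X Y where vd: "vertices_distinct [v1, v2] [W, X, Y]" and ne: "W \<noteq> {}" and S: "S = candy_edges v1 v2 W X Y"
    using assms unfolding candy_set_def by blast
  have "vertices_distinct [v1, v2] [W, X, Y]"
    using vd by (auto simp: vertices_distinct_def less_Suc_eq)
  from labelling[OF this] obtain h where h: "inj_on h (Core ` {1..length [v1, v2]} \<union> Mid ` {..<card W} \<union> LeafX ` {..<card X} \<union> LeafY ` {..<card Y})"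
    "\<forall>i. h (Core (Suc i)) = [v1, v2] ! i" "h ` Mid ` {..<card W} = W" "h ` LeafX ` {..<card X} = X" "h ` LeafY ` {..<card Y} = Y"
    by (elim exE conjE)
  have "card W \<noteq> 0" using ne vd by (simp add: vertices_distinct_def)
  have core: "h (Core 1) = v1" "h (Core 2) = v2"
    using h(2)[rule_format, of 0] h(2)[rule_format, of 1] by (simp_all add: numeral_eq_Suc)
  have "graph_iso (edge_graph S) (candy (card W) (card X) (card Y))"
    unfolding label_graphs
  proof (rule graph_iso_edge_graphI)
    show "inj_on h (\<Union>(candy_edges (Core 1) (Core 2) (Mid ` {..<card W}) (LeafX ` {..<card X}) (LeafY ` {..<card Y})))"
      by (rule inj_on_subset[OF h(1)]) (use \<open>card W \<noteq> 0\<close> in \<open>auto simp: candy_edges_def lessThan_empty_iff\<close>)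
  qed (simp only: S image_shapes core h(3-5))
  moreover have "1 \<le> card W" using \<open>card W \<noteq> 0\<close> by simp
  ultimately show ?thesis unfolding is_candy_def by blast
qed

lemma shooting_star_set_if_is_shooting_star:
  assumes "is_shooting_star C" "\<And>e. e \<in> edges C \<Longrightarrow> e \<subseteq> verts C"
  shows "shooting_star_set (edges C)"
proof -
  obtain m n where iso: "graph_iso C (shooting_star m n)"
    using assms(1) by (auto simp: is_shooting_star_def)
  obtain h where h: "inj_on h (\<Union>(shooting_star_edges (Core 1) (Core 2) (Core 3) (Core 4) (LeafX ` {..<m}) (LeafY ` {..<n})))"
    "edges C = (`) h ` shooting_star_edges (Core 1) (Core 2) (Core 3) (Core 4) (LeafX ` {..<m}) (LeafY ` {..<n})"
    using graph_iso_edge_graphD[OF iso[unfolded label_graphs] assms(2)] by blast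
  have "vertices_distinct (map h [Core 1, Core 2, Core 3, Core 4]) (map ((`) h) [LeafX ` {..<m}, LeafY ` {..<n}])"
    by (intro vertices_distinct_image inj_on_subset[OF h(1)])
      (auto simp: vertices_distinct_def less_Suc_eq shooting_star_edges_def)
  
  then show ?thesis unfolding shooting_star_set_def h(2) image_shapes list.map by blast
qed

lemma is_shooting_star_if_shooting_star_set:
  assumes "shooting_star_set (S :: 'a set set)"
  shows "is_shooting_star (edge_graph S)"
proof -
  obtain v w a b X Y where vd: "vertices_distinct [v, w, a, b] [X, Y]" and S: "S = shooting_star_edges v w a b X Y"
    using assms unfolding shooting_star_set_def by blast
  have "vertices_distinct [v, w, a, b] [{}, X, Y]"
    using vd by (auto simp: vertices_distinct_def less_Suc_eq)
  from labelling[OF this] obtain h where h: "inj_on h (Core ` {1..length [v, w, a, b]} \<union> Mid ` {..<card ({} :: 'a set)} \<union> LeafX ` {..<card X} \<union> LeafY ` {..<card Y})"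
    "\<forall>i. h (Core (Suc i)) = [v, w, a, b] ! i" "h ` Mid ` {..<card ({} :: 'a set)} = {}" "h ` LeafX ` {..<card X} = X" "h ` LeafY ` {..<card Y} = Y"
    by (elim exE conjE)
  have core: "h (Core 1) = v" "h (Core 2) = w" "h (Core 3) = a" "h (Core 4) = b"
    using h(2)[rule_format, of 0] h(2)[rule_format, of 1] h(2)[rule_format, of 2] h(2)[rule_format, of 3] by (simp_all add: numeral_eq_Suc)
  have "graph_iso (edge_graph S) (shooting_star (card X) (card Y))"
    unfolding label_graphs
  proof (rule graph_iso_edge_graphI)
    show "inj_on h (\<Union>(shooting_star_edges (Core 1) (Core 2) (Core 3) (Core 4) (LeafX ` {..<card X}) (LeafY ` {..<card Y})))"
      by (rule inj_on_subset[OF h(1)]) (auto simp: shooting_star_edges_def)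
  qed (simp only: S image_shapes core h(3-5))
  
  then show ?thesis unfolding is_shooting_star_def by blast
qed

lemma double_vase_set_if_is_double_vase:
  assumes "is_double_vase C" "\<And>e. e \<in> edges C \<Longrightarrow> e \<subseteq> verts C"
  shows "double_vase_set (edges C)"
proof -
  obtain n where iso: "graph_iso C (double_vase n)"
    using assms(1) by (auto simp: is_double_vase_def)
  obtain h where h: "inj_on h (\<Union>(double_vase_edges (Core 1) (Core 2) (Core 3) (Core 4) (Core 5) (LeafX ` {..<n})))"
    "edges C = (`) h ` double_vase_edges (Core 1) (Core 2) (Core 3) (Core 4) (Core 5) (LeafX ` {..<n})"
    using graph_iso_edge_graphD[OF iso[unfolded label_graphs] assms(2)] by blast
  have "vertices_distinct (map h [Core 1, Core 2, Core 3, Core 4, Core 5]) (map ((`) h) [LeafX ` {..<n}])"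
    by (intro vertices_distinct_image inj_on_subset[OF h(1)])
      (auto simp: vertices_distinct_def less_Suc_eq double_vase_edges_def)
  
  then show ?thesis unfolding double_vase_set_def h(2) image_shapes list.map by blast
qed

lemma is_double_vase_if_double_vase_set:
  assumes "double_vase_set (S :: 'a set set)"
  shows "is_double_vase (edge_graph S)"
proof -
  obtain v x1 x2 y1 y2 X where vd: "vertices_distinct [v, x1, x2, y1, y2] [X]" and S: "S = double_vase_edges v x1 x2 y1 y2 X"
    using assms unfolding double_vase_set_def by blast
  have "vertices_distinct [v, x1, x2, y1, y2] [{}, X, {}]"
    using vd by (auto simp: vertices_distinct_def less_Suc_eq)
  from labelling[OF this] obtain h where h: "inj_on h (Core ` {1..length [v, x1, x2, y1, y2]} \<union> Mid ` {..<card ({} :: 'a set)} \<union> LeafX ` {..<card X} \<union> LeafY ` {..<card ({} :: 'a set)})"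
    "\<forall>i. h (Core (Suc i)) = [v, x1, x2, y1, y2] ! i" "h ` Mid ` {..<card ({} :: 'a set)} = {}" "h ` LeafX ` {..<card X} = X" "h ` LeafY ` {..<card ({} :: 'a set)} = {}"
    by (elim exE conjE)
  have core: "h (Core 1) = v" "h (Core 2) = x1" "h (Core 3) = x2" "h (Core 4) = y1" "h (Core 5) = y2"
    using h(2)[rule_format, of 0] h(2)[rule_format, of 1] h(2)[rule_format, of 2] h(2)[rule_format, of 3] h(2)[rule_format, of 4] by (simp_all add: numeral_eq_Suc)
  have "graph_iso (edge_graph S) (double_vase (card X))"
    unfolding label_graphs
  proof (rule graph_iso_edge_graphI)
    show "inj_on h (\<Union>(double_vase_edges (Core 1) (Core 2) (Core 3) (Core 4) (Core 5) (LeafX ` {..<card X})))"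
      by (rule inj_on_subset[OF h(1)]) (auto simp: double_vase_edges_def)
  qed (simp only: S image_shapes core h(3-5))
  
  then show ?thesis unfolding is_double_vase_def by blast
qed

lemma amaryllis_set_if_is_amaryllis:
  assumes "is_amaryllis C" "\<And>e. e \<in> edges C \<Longrightarrow> e \<subseteq> verts C"
  shows "amaryllis_set (edges C)"
proof -
  obtain m n where iso: "graph_iso C (amaryllis m n)"
    using assms(1) by (auto simp: is_amaryllis_def)
  obtain h where h: "inj_on h (\<Union>(amaryllis_edges (Core 1) (Core 2) (Core 3) (Core 4) (LeafX ` {..<m}) (LeafY ` {..<n})))"
    "edges C = (`) h ` amaryllis_edges (Core 1) (Core 2) (Core 3) (Core 4) (LeafX ` {..<m}) (LeafY ` {..<n})"
    using graph_iso_edge_graphD[OF iso[unfolded label_graphs] assms(2)] by blast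
  have "vertices_distinct (map h [Core 1, Core 2, Core 3, Core 4]) (map ((`) h) [LeafX ` {..<m}, LeafY ` {..<n}])"
    by (intro vertices_distinct_image inj_on_subset[OF h(1)])
      (auto simp: vertices_distinct_def less_Suc_eq amaryllis_edges_def)
  
  then show ?thesis unfolding amaryllis_set_def h(2) image_shapes list.map by blast
qed

lemma is_amaryllis_if_amaryllis_set:
  assumes "amaryllis_set (S :: 'a set set)"
  shows "is_amaryllis (edge_graph S)"
proof -
  obtain v w c1 c2 X Y where vd: "vertices_distinct [v, w, c1, c2] [X, Y]" and S: "S = amaryllis_edges v w c1 c2 X Y"
    using assms unfolding amaryllis_set_def by blast
  have "vertices_distinct [v, w, c1, c2] [{}, X, Y]"
    using vd by (auto simp: vertices_distinct_def less_Suc_eq)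
  from labelling[OF this] obtain h where h: "inj_on h (Core ` {1..length [v, w, c1, c2]} \<union> Mid ` {..<card ({} :: 'a set)} \<union> LeafX ` {..<card X} \<union> LeafY ` {..<card Y})"
    "\<forall>i. h (Core (Suc i)) = [v, w, c1, c2] ! i" "h ` Mid ` {..<card ({} :: 'a set)} = {}" "h ` LeafX ` {..<card X} = X" "h ` LeafY ` {..<card Y} = Y"
    by (elim exE conjE)
  have core: "h (Core 1) = v" "h (Core 2) = w" "h (Core 3) = c1" "h (Core 4) = c2"
    using h(2)[rule_format, of 0] h(2)[rule_format, of 1] h(2)[rule_format, of 2] h(2)[rule_format, of 3] by (simp_all add: numeral_eq_Suc)
  have "graph_iso (edge_graph S) (amaryllis (card X) (card Y))"
    unfolding label_graphs
  proof (rule graph_iso_edge_graphI)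
    show "inj_on h (\<Union>(amaryllis_edges (Core 1) (Core 2) (Core 3) (Core 4) (LeafX ` {..<card X}) (LeafY ` {..<card Y})))"
      by (rule inj_on_subset[OF h(1)]) (auto simp: amaryllis_edges_def)
  qed (simp only: S image_shapes core h(3-5))
  
  then show ?thesis unfolding is_amaryllis_def by blast
qed

section \<open>Components\<close>

lemma edge_set_edges:
  assumes "fin_simple_graph G"
  shows "edge_set (edges G)"
proof
  have "edges G \<subseteq> Pow (verts G)" using assms by (auto simp: fin_simple_graph_def)
  then show "finite (edges G)" using assms finite_subset by (auto simp: fin_simple_graph_def)
qed (use assms in \<open>auto simp: fin_simple_graph_def\<close>)

lemma forbidden_free_iff: "fin_simple_graph G \<Longrightarrow> forbidden_free G \<longleftrightarrow> edge_set.pattern_free (edges G)"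
  unfolding forbidden_free_def forbidden_patterns edge_set.pattern_free_def[OF edge_set_edges] ..

lemma linked_refl: "linked G u u"
  by (simp add: linked_def)

lemma linked_edge: "{u, v} \<in> edges G \<Longrightarrow> linked G u v"
  unfolding linked_def by blast

lemma linked_trans: "linked G u v \<Longrightarrow> linked G v w \<Longrightarrow> linked G u w"
  unfolding linked_def by (rule rtranclp_trans)

lemma linked_sym: "linked G u v \<Longrightarrow> linked G v u"
  unfolding linked_def
proof (induction rule: rtranclp_induct)
  case (step y z)
  then have "{z, y} \<in> edges G" by (simp add: insert_commute)
  then show ?case using step.IH by (rule converse_rtranclp_into_rtranclp)
qed simp

lemma linked_step: "linked G u v \<Longrightarrow> {v, w} \<in> edges G \<Longrightarrow> linked G u w"
  by (rule linked_trans[OF _ linked_edge])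

text \<open>Every shape is connected, because each vertex is linked to a fixed centre. This is what
  turns a closed part of one of these shapes into a single component.\<close>

lemma shape_linked:
  assumes "double_star_set S \<or> vase_set S \<or> candy_set S \<or> shooting_star_set S \<or> double_vase_set S \<or> amaryllis_set S"
    and sub: "S \<subseteq> edges G" and xy: "x \<in> \<Union>S" "y \<in> \<Union>S"
  shows "linked G x y"
proof -
  have "\<exists>r. \<forall>x\<in>\<Union>S. linked G r x"
    using assms(1)
  proof (elim disjE)
    assume "double_star_set S"
    then obtain w1 w2 X Y where S: "S = double_star_edges w1 w2 X Y" by (auto simp: double_star_set_def)
    have w: "linked G w1 w2" using sub by (intro linked_edge) (auto simp: S double_star_edges_def)
    have "linked G w1 x" if "x \<in> X" for x using that sub by (intro linked_edge) (auto simp: S double_star_edges_def)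
    moreover have "linked G w1 x" if "x \<in> Y" for x using that sub by (intro linked_step[OF w]) (auto simp: S double_star_edges_def)
    ultimately show ?thesis using w linked_refl by (intro exI[of _ w1]) (auto simp: S double_star_edges_def)
  next
    assume "vase_set S"
    then obtain w1 w2 w3 X where S: "S = vase_edges w1 w2 w3 X" by (auto simp: vase_set_def)
    have w: "linked G w1 w2" "linked G w1 w3" using sub by (auto intro!: linked_edge simp: S vase_edges_def)
    have "linked G w1 x" if "x \<in> X" for x using that sub by (intro linked_edge) (auto simp: S vase_edges_def)
    then show ?thesis using w linked_refl by (intro exI[of _ w1]) (auto simp: S vase_edges_def)
  next
    assume "candy_set S"
    then obtain v1 v2 W X Y where S: "S = candy_edges v1 v2 W X Y" and "W \<noteq> {}" unfolding candy_set_def by blast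
    then obtain m where m: "m \<in> W" by blast
    have W: "linked G v1 x" if "x \<in> W \<union> X" for x using that sub by (intro linked_edge) (auto simp: S candy_edges_def)
    have v: "linked G v1 v2"
      using m sub by (intro linked_step[OF W[of m]]) (auto simp: S candy_edges_def insert_commute)
    have "linked G v1 x" if "x \<in> Y" for x using that sub by (intro linked_step[OF v]) (auto simp: S candy_edges_def)
    then show ?thesis using W v linked_refl by (intro exI[of _ v1]) (auto simp: S candy_edges_def)
  next
    assume "shooting_star_set S"
    then obtain v w a b X Y where S: "S = shooting_star_edges v w a b X Y" by (auto simp: shooting_star_set_def)
    have w: "linked G v w" "linked G v a"
      using sub by (auto intro!: linked_edge simp: S shooting_star_edges_def insert_commute)
    have b: "linked G v b" using sub by (intro linked_step[OF w(2)]) (auto simp: S shooting_star_edges_def)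
    have "linked G v x" if "x \<in> X" for x using that sub by (intro linked_step[OF w(1)]) (auto simp: S shooting_star_edges_def)
    moreover have "linked G v x" if "x \<in> Y" for x using that sub by (intro linked_edge) (auto simp: S shooting_star_edges_def)
    ultimately show ?thesis using w b linked_refl by (intro exI[of _ v]) (auto simp: S shooting_star_edges_def)
  next
    assume "double_vase_set S"
    then obtain v x1 x2 y1 y2 X where S: "S = double_vase_edges v x1 x2 y1 y2 X" by (auto simp: double_vase_set_def)
    have w: "linked G v x1" "linked G v x2" "linked G v y1" "linked G v y2"
      using sub by (auto intro!: linked_edge simp: S double_vase_edges_def insert_commute)
    have "linked G v x" if "x \<in> X" for x using that sub by (intro linked_edge) (auto simp: S double_vase_edges_def)
    then show ?thesis using w linked_refl by (intro exI[of _ v]) (auto simp: S double_vase_edges_def)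
  next
    assume "amaryllis_set S"
    then obtain v w c1 c2 X Y where S: "S = amaryllis_edges v w c1 c2 X Y" by (auto simp: amaryllis_set_def)
    have w: "linked G v w" "linked G v c1" "linked G v c2"
      using sub by (auto intro!: linked_edge simp: S amaryllis_edges_def insert_commute)
    have "linked G v x" if "x \<in> X" for x using that sub by (intro linked_step[OF w(1)]) (auto simp: S amaryllis_edges_def)
    moreover have "linked G v x" if "x \<in> Y" for x using that sub by (intro linked_edge) (auto simp: S amaryllis_edges_def)
    ultimately show ?thesis using w linked_refl by (intro exI[of _ v]) (auto simp: S amaryllis_edges_def)
  qed
  then obtain r where "linked G r x" "linked G r y" using xy by blast
  then show ?thesis by (rule linked_trans[OF linked_sym])
qed

lemma edges_component_subset: "fin_simple_graph G \<Longrightarrow> e \<in> edges (component_of G v) \<Longrightarrow> e \<subseteq> verts (component_of G v)"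
  by (auto simp: component_of_def fin_simple_graph_def)

text \<open>A closed set of edges cannot be left along an edge, so it contains the component; being
  linked, it contains nothing else.\<close>

lemma component_eqI:
  assumes G: "fin_simple_graph G" and closed: "edge_set.closed_part (edges G) S"
    and lk: "\<And>x y. x \<in> \<Union>S \<Longrightarrow> y \<in> \<Union>S \<Longrightarrow> linked G x y" and v: "linked G v a" "a \<in> \<Union>S"
  shows "component_of G v = edge_graph S"
proof -
  interpret edge_set "edges G" using G by (rule edge_set_edges)
  have sub: "S \<subseteq> edges G" and cl: "\<And>e x y. e \<in> S \<Longrightarrow> x \<in> e \<Longrightarrow> R x y \<Longrightarrow> {x, y} \<in> S"
    using closed unfolding closed_part_def by blast+
  have reach: "u \<in> \<Union>S" if "linked G a u" for u
    using that[unfolded linked_def] v(2)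
  proof (induction rule: rtranclp_induct)
    case (step y z)
    then obtain e where "e \<in> S" "y \<in> e" by blast
    from cl[OF this step.hyps(2)] show ?case by blast
  qed
  have lv: "linked G v u \<longleftrightarrow> u \<in> \<Union>S" for u
  proof
    assume "linked G v u"
    from linked_trans[OF linked_sym[OF v(1)] this] show "u \<in> \<Union>S" by (rule reach)
  next
    assume "u \<in> \<Union>S"
    from linked_trans[OF v(1) lk[OF v(2) this]] show "linked G v u" .
  qed
  have "e \<in> edges G \<and> (\<forall>u\<in>e. linked G v u) \<longleftrightarrow> e \<in> S" for e
  proof
    assume e: "e \<in> edges G \<and> (\<forall>u\<in>e. linked G v u)"
    then obtain x y where xy: "e = {x, y}" "R x y" by (auto elim: edge_cases)
    then have "linked G v x" using e xy(1) by simp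
    then obtain f where "f \<in> S" "x \<in> f" unfolding lv by blast
    from cl[OF this xy(2)] show "e \<in> S" unfolding xy(1) .
  next
    assume "e \<in> S"
    then have "e \<in> edges G" "\<forall>u\<in>e. u \<in> \<Union>S" using sub by blast+
    then show "e \<in> edges G \<and> (\<forall>u\<in>e. linked G v u)" unfolding lv by blast
  qed
  moreover have "u \<in> verts G" if "u \<in> \<Union>S" for u
    using that sub G unfolding fin_simple_graph_def by blast
  ultimately show ?thesis
    unfolding component_of_def edge_graph_def using lv by auto
qed

lemma P5_C4_free_component:
  assumes G: "fin_simple_graph G" and free: "edge_set.P5_C4_free (edges G)" and "edges (component_of G v) \<noteq> {}"
  shows "\<exists>S. component_of G v = edge_graph S \<and> edge_set.closed_part (edges G) S \<and> (double_star_set S \<or> vase_set S)"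
proof -
  interpret edge_set "edges G" using G by (rule edge_set_edges)
  from assms(3) obtain e where e: "e \<in> edges G" "\<forall>u\<in>e. linked G v u" by (auto simp: component_of_def)
  then obtain a b where ab: "e = {a, b}" "R a b" by (auto elim: edge_cases)
  from edge_part[OF free ab(2)] obtain S where S: "{a, b} \<in> S" "closed_part S" "double_star_set S \<or> vase_set S" by blast
  have sub: "S \<subseteq> edges G" using S(2) by (simp add: closed_part_def)
  have "component_of G v = edge_graph S"
    by (rule component_eqI[OF G S(2) shape_linked[OF _ sub], of v a]) (use S e ab in blast)+
  with S show ?thesis by blast
qed

text \<open>In the absence of five-vertex paths and 4-cycles the shape is found component by
  component. Otherwise the classification describes all edges at once by a connected shape, so there
  is only one nontrivial component.\<close>

lemma permitted_if_pattern_free: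
  assumes G: "fin_simple_graph G" and free: "edge_set.pattern_free (edges G)"
  shows "permitted_structure G"
proof -
  interpret pattern_free_set "edges G"
    using edge_set_edges[OF G] free by (simp add: pattern_free_set_def pattern_free_set_axioms_def)
  show ?thesis
  proof (cases P5_C4_free)
    case True
    have "is_double_star C \<or> is_vase C \<or> is_isolated_vertex C" if C: "C \<in> components G" for C
    proof -
      obtain v where v: "v \<in> verts G" "C = component_of G v" using C by (auto simp: components_def)
      show ?thesis
      proof (cases "edges C = {}")
        case True
        have "u = v" if "linked G v u" for u
          using that[unfolded linked_def]
        proof (cases rule: converse_rtranclpE)
          case (step w)
          have "linked G v w" using step(1) by (rule linked_edge)
          then have "{v, w} \<in> edges C" using step(1) linked_refl by (simp add: v(2) component_of_def)
          with True show ?thesis by simp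
        qed simp
        then have "verts C = {v}" using v linked_refl by (auto simp: component_of_def)
        with True have "C = \<lparr>verts = {v}, edges = {}\<rparr>" by simp
        then show ?thesis unfolding is_isolated_vertex_def by blast
      next
        case False
        then obtain S where S: "C = edge_graph S" "double_star_set S \<or> vase_set S"
          using P5_C4_free_component[OF G True, of v] v(2) by blast
        from S(2) show ?thesis unfolding S(1)
          using is_double_star_if_double_star_set[of S] is_vase_if_vase_set[of S] by blast
      qed
    qed
    then show ?thesis unfolding permitted_structure_def by blast
  next
    case False
    with classification have shape: "candy_set (edges G) \<or> shooting_star_set (edges G) \<or> double_vase_set (edges G) \<or> amaryllis_set (edges G)"
      by blast
    have "C = edge_graph (edges G)" if C: "C \<in> nontrivial_components G" for C
    proof -
      obtain v where v: "C = component_of G v" "edges C \<noteq> {}"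
        using C unfolding nontrivial_components_def components_def by blast
      then obtain e where e: "e \<in> edges G" "\<forall>u\<in>e. linked G v u" by (auto simp: component_of_def)
      then obtain a b where ab: "e = {a, b}" "R a b" by (auto elim: edge_cases)
      have closed: "closed_part (edges G)" by (simp add: closed_part_def)
      show ?thesis unfolding v(1)
        by (rule component_eqI[OF G closed shape_linked[OF _ order_refl], of v a]) (use shape e ab in blast)+
    qed
    then have sub: "nontrivial_components G \<subseteq> {edge_graph (edges G)}" by blast
    then have "card (nontrivial_components G) \<le> 1" using card_mono[OF _ sub] by simp
    moreover have "is_candy (edge_graph (edges G)) \<or> is_shooting_star (edge_graph (edges G)) \<or>
        is_double_vase (edge_graph (edges G)) \<or> is_amaryllis (edge_graph (edges G))"
      using shape is_candy_if_candy_set is_shooting_star_if_shooting_star_set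
        is_double_vase_if_double_vase_set is_amaryllis_if_amaryllis_set by blast
    moreover have "C = edge_graph (edges G)" if "C \<in> nontrivial_components G" for C
      using sub that by blast
    ultimately show ?thesis unfolding permitted_structure_def by (intro disjI2) auto
  qed
qed

text \<open>Paths and cycles lie within one component, which settles the case of double stars and
  vases. With a single nontrivial component, its edges are all edges of \<open>G\<close>, and the
  result for its shape applies directly.\<close>

lemma pattern_free_if_permitted:
  fixes G :: "'a sgraph"
  assumes G: "fin_simple_graph G" and perm: "permitted_structure G"
  shows "edge_set.pattern_free (edges G)"
proof -
  interpret edge_set "edges G" using G by (rule edge_set_edges)
  have vertex: "a \<in> verts G" if "R a b" for a b using that G by (auto simp: fin_simple_graph_def)
  have P5_C4: pattern_free
    if "\<forall>C\<in>components G. double_star_set (edges C) \<or> vase_set (edges C) \<or> edges C = {}"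
  proof (rule P5_C4_free_imp_pattern_free)
    show P5_C4_free unfolding P5_C4_free_def
    proof (intro conjI allI impI)
      fix a b c d e assume dis: "distinct [a, b, c, d, e]" and p: "R a b" "R b c" "R c d" "R d e"
      let ?S = "edges (component_of G a)"
      have l: "linked G a b" "linked G a c" "linked G a d" "linked G a e" using p linked_edge linked_step by metis+
      with p linked_refl have S: "{a, b} \<in> ?S" "{b, c} \<in> ?S" "{c, d} \<in> ?S" "{d, e} \<in> ?S"
        by (auto simp: component_of_def)
      have "double_star_set ?S \<or> vase_set ?S"
        using that vertex[OF p(1)] S(1) by (auto simp: components_def)
      then show False
        using double_star_P5_C4_free(1)[OF _ dis S] vase_P5_C4_free(1)[OF _ dis S] by blast
    next
      fix a b c d assume dis: "distinct [a, b, c, d]" and p: "R a b" "R b c" "R c d" "R d a"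
      let ?S = "edges (component_of G a)"
      have l: "linked G a b" "linked G a c" "linked G a d" using p linked_edge linked_step by metis+
      with p linked_refl have S: "{a, b} \<in> ?S" "{b, c} \<in> ?S" "{c, d} \<in> ?S" "{d, a} \<in> ?S"
        by (auto simp: component_of_def)
      have "double_star_set ?S \<or> vase_set ?S"
        using that vertex[OF p(1)] S(1) by (auto simp: components_def)
      then show False
        using double_star_P5_C4_free(2)[OF _ dis S] vase_P5_C4_free(2)[OF _ dis S] by blast
    qed
  qed
  have sub: "e \<subseteq> verts C" if "C \<in> components G" "e \<in> edges C" for C e
    using that edges_component_subset[OF G] by (auto simp: components_def)
  have ds: "double_star_set (edges C)" if "C \<in> components G" "is_double_star C" for C
    using double_star_set_if_is_double_star[OF that(2) sub[OF that(1)]] .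
  have vs: "vase_set (edges C)" if "C \<in> components G" "is_vase C" for C
    using vase_set_if_is_vase[OF that(2) sub[OF that(1)]] .
  from perm show ?thesis
    unfolding permitted_structure_def
  proof
    assume "\<forall>C\<in>components G. is_double_star C \<or> is_vase C \<or> is_isolated_vertex C"
    moreover have "edges C = {}" if "is_isolated_vertex C" for C :: "'a sgraph"
      using that by (auto simp: is_isolated_vertex_def)
    ultimately have "\<forall>C\<in>components G. double_star_set (edges C) \<or> vase_set (edges C) \<or> edges C = {}"
      using ds vs by blast
    then show ?thesis by (rule P5_C4)
  next
    assume one: "card (nontrivial_components G) \<le> 1 \<and>
      (\<forall>C\<in>nontrivial_components G. is_double_star C \<or> is_vase C \<or> is_candy C \<or> is_shooting_star C \<or>
         is_double_vase C \<or> is_amaryllis C)"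
    have fin: "finite (nontrivial_components G)"
      using G by (simp add: nontrivial_components_def components_def fin_simple_graph_def)
    show ?thesis
    proof (cases "nontrivial_components G = {}")
      case True
      then show ?thesis by (intro P5_C4) (auto simp: nontrivial_components_def)
    next
      case False
      then obtain C where C: "nontrivial_components G = {C}"
        using one fin card_0_eq[OF fin] by (metis One_nat_def card_1_singletonE le_SucE le_zero_eq)
      then have CG: "C \<in> components G" by (auto simp: nontrivial_components_def)
      have "edges G \<subseteq> edges C"
      proof
        fix e assume "e \<in> edges G"
        then obtain x y where e: "e = {x, y}" "R x y" by (rule edge_cases)
        then have "e \<in> edges (component_of G x)"
          using linked_refl linked_edge[OF e(2)] by (auto simp: component_of_def)
        moreover from this have "component_of G x \<in> nontrivial_components G"
          using vertex[OF e(2)] by (auto simp: nontrivial_components_def components_def)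
        ultimately show "e \<in> edges C" using C by simp
      qed
      moreover have "edges C \<subseteq> edges G" using CG by (auto simp: components_def component_of_def)
      ultimately have EC: "edges C = edges G" by blast
      have only: "C' = C \<or> edges C' = {}" if "C' \<in> components G" for C'
        using that C unfolding nontrivial_components_def by blast
      have "is_double_star C \<or> is_vase C \<or> is_candy C \<or> is_shooting_star C \<or> is_double_vase C \<or> is_amaryllis C"
        using one C by simp
      then show ?thesis
      proof (elim disjE)
        assume "is_double_star C"
        then show ?thesis
          by (intro P5_C4) (use ds[OF CG] only in blast)
      next
        assume "is_vase C"
        then show ?thesis
          by (intro P5_C4) (use vs[OF CG] only in blast)
      next
        assume "is_candy C"
        from candy_set_if_is_candy[OF this sub[OF CG]] show ?thesis by (intro candy_pattern_free) (simp add: EC)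
      next
        assume "is_shooting_star C"
        from shooting_star_set_if_is_shooting_star[OF this sub[OF CG]] show ?thesis
          by (intro shooting_star_pattern_free) (simp add: EC)
      next
        assume "is_double_vase C"
        from double_vase_set_if_is_double_vase[OF this sub[OF CG]] show ?thesis
          by (intro double_vase_pattern_free) (simp add: EC)
      next
        assume "is_amaryllis C"
        from amaryllis_set_if_is_amaryllis[OF this sub[OF CG]] show ?thesis
          by (intro amaryllis_pattern_free) (simp add: EC)
      qed
    qed
  qed
qed

theorem forbidden_free_iff_permitted:
  assumes "fin_simple_graph G"
  shows "forbidden_free G \<longleftrightarrow> permitted_structure G"
  unfolding forbidden_free_iff[OF assms]
  using permitted_if_pattern_free[OF assms] pattern_free_if_permitted[OF assms] by (rule iffI)

section \<open>Winning strategies of Alice on the permitted graphs\<close>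

text \<open>Stars and triangles are the cliques of a line graph, so these assumptions express that
  \<open>k\<close> is at least the clique number.\<close>

locale line_game = edge_set +
  fixes k :: nat
  assumes star_le: "card {e \<in> E. x \<in> e} \<le> k"
    and triangle_le: "R x y \<Longrightarrow> R y z \<Longrightarrow> R x z \<Longrightarrow> 3 \<le> k"
begin

sublocale game: colouring_game E adjacent k
  by unfold_locales (use finite_E in \<open>auto simp: adjacent_def\<close>)

definition star :: "'a \<Rightarrow> 'a set set" where
  "star x = {e \<in> E. x \<in> e}"

lemma card_star: "card (star x) \<le> k"
  using star_le by (simp add: star_def)

lemma finite_star: "finite (star x)"
  using finite_E by (simp add: star_def)

lemma nbrs_edge: "R x y \<Longrightarrow> game.nbrs {x, y} = star x \<union> star y - {{x, y}}"
  by (auto simp: game.nbrs_def star_def adjacent_def)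

lemma closed_star:
  assumes "closed_part S" "x \<in> \<Union>S"
  shows "star x = {e \<in> S. x \<in> e}"
proof -
  have "e \<in> S" if e: "e \<in> E" "x \<in> e" for e
  proof -
    obtain y where y: "e = {x, y}" "R x y"
      using edge_cases[OF e(1)] e(2) R_sym by (metis empty_iff insert_commute insert_iff)
    with assms show ?thesis unfolding closed_part_def by blast
  qed
  moreover have "S \<subseteq> E" using assms(1) by (simp add: closed_part_def)
  ultimately show ?thesis by (auto simp: star_def)
qed

lemma card_nbrs_pendant:
  assumes "R x y" "star y = {{x, y}}"
  shows "game.nbrs {x, y} = star x - {{x, y}}" "game.safe c {x, y}"
proof -
  show nb: "game.nbrs {x, y} = star x - {{x, y}}" using nbrs_edge[OF assms(1)] assms(2) by auto
  have "{x, y} \<in> star x" using assms(1) by (simp add: star_def)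
  from card_Diff1_less[OF finite_star this] card_star[of x]
  show "game.safe c {x, y}" by (intro game.safe_few_nbrs) (simp add: nb)
qed

lemma star_pendant:
  assumes "E = F \<union> (\<lambda>x. {w, x}) ` X" "x \<in> X" "x \<noteq> w" "x \<notin> \<Union>F"
  shows "star x = {{w, x}}"
proof
  show "star x \<subseteq> {{w, x}}"
  proof
    fix e assume "e \<in> star x"
    then have "e \<in> E" "x \<in> e" by (simp_all add: star_def)
    then have "e \<in> F \<union> (\<lambda>x. {w, x}) ` X" "x \<in> e" unfolding assms(1) .
    with assms(3,4) show "e \<in> {{w, x}}" by auto
  qed
  have "{w, x} \<in> E" using assms(1,2) by blast
  then show "{{w, x}} \<subseteq> star x" by (simp add: star_def)
qed

text \<open>A pendant edge has fewer than \<open>k\<close> neighbours and is safe. At the start the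
  central edge sees no colour, so it can wait if \<open>2 <= k\<close>; for smaller \<open>k\<close>
  the stars at both ends consist of that edge alone.\<close>

lemma double_star_settled:
  assumes closed: "closed_part S" and "double_star_set S"
  shows "game.settled Map.empty S"
proof -
  obtain w1 w2 X Y where vd: "vertices_distinct [w1, w2] [X, Y]" and S: "S = double_star_edges w1 w2 X Y"
    using assms(2) unfolding double_star_set_def by blast
  have neq: "w1 \<noteq> w2" "w1 \<notin> X" "w2 \<notin> X" "w1 \<notin> Y" "w2 \<notin> Y" "X \<inter> Y = {}"
    using vd by (auto simp: vertices_distinct_def less_Suc_eq)
  have SE: "S \<subseteq> E" using closed by (simp add: closed_part_def)
  have U: "\<Union>S = {w1, w2} \<union> X \<union> Y" by (auto simp: S double_star_edges_def)
  have mem: "e \<in> S \<longleftrightarrow> e = {w1, w2} \<or> (\<exists>x\<in>X. e = {w1, x}) \<or> (\<exists>y\<in>Y. e = {w2, y})" for e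
    by (auto simp: S double_star_edges_def)
  have star: "star x = {e \<in> S. x \<in> e}" if "x \<in> {w1, w2} \<union> X \<union> Y" for x
    using closed_star[OF closed] that unfolding U by blast
  have pX: "star x = {{w1, x}}" if "x \<in> X" for x
    using that neq star[of x] by (auto simp: mem)
  have pY: "star y = {{w2, y}}" if "y \<in> Y" for y
    using that neq star[of y] by (auto simp: mem)
  have R: "x \<in> X \<Longrightarrow> R w1 x" "y \<in> Y \<Longrightarrow> R w2 y" for x y using SE mem by blast+
  have leaf: "game.safe c e" if "e \<in> S" "e \<noteq> {w1, w2}" for c e
  proof -
    from that consider x where "x \<in> X" "e = {w1, x}" | y where "y \<in> Y" "e = {w2, y}"
      unfolding mem by blast
    then show ?thesis by cases (simp_all add: card_nbrs_pendant(2) pX pY R)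
  qed
  have edge: "R w1 w2" using SE mem by blast
  have "{w1, w2} \<in> star w1" "{w1, w2} \<in> star w2" using edge by (auto simp: star_def)
  have nb: "game.nbrs {w1, w2} = star w1 \<union> star w2 - {{w1, w2}}" by (rule nbrs_edge[OF edge])
  show ?thesis
  proof (cases "2 \<le> k")
    case True
    have "game.seen Map.empty {w1, w2} = {}" by (simp add: game.seen_def)
    moreover have "\<forall>e\<in>S. e = {w1, w2} \<or> game.safe Map.empty e" using leaf by blast
    moreover have "{w1, w2} \<in> S" using mem by blast
    ultimately have "game.tense Map.empty S"
      unfolding game.tense_def using True by (intro bexI[of _ "{w1, w2}"]) simp_all
    then show ?thesis by (simp add: game.settled_def)
  next
    case False
    have "star w = {{w1, w2}}" if "w \<in> {w1, w2}" for w
    proof -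
      have e: "{w1, w2} \<in> star w" using that edge by (auto simp: star_def)
      moreover have "card (star w) \<le> 1" using card_star[of w] False by simp
      ultimately show ?thesis using finite_star[of w] card_le_Suc0_iff_eq[OF finite_star[of w]] by auto
    qed
    then have "star w1 = {{w1, w2}}" "star w2 = {{w1, w2}}" by blast+
    with card_nbrs_pendant(2)[OF edge] leaf show ?thesis
      unfolding game.settled_def game.calm_def by blast
  qed
qed

text \<open>A bare triangle is calm, since each edge has two neighbours and \<open>3 <= k\<close>.
  With a leaf the vase is \<open>vase_like\<close>, where the leaf is what Alice needs for answering
  a move on the edge opposite the centre.\<close>

lemma vase_settled:
  assumes closed: "closed_part S" and "vase_set S"
  shows "game.settled Map.empty S"
proof -
  obtain w1 w2 w3 X where vd: "vertices_distinct [w1, w2, w3] [X]" and S: "S = vase_edges w1 w2 w3 X"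
    using assms(2) unfolding vase_set_def by blast
  have neq: "w1 \<noteq> w2" "w1 \<noteq> w3" "w2 \<noteq> w3" "w1 \<notin> X" "w2 \<notin> X" "w3 \<notin> X"
    using vd by (auto simp: vertices_distinct_def)
  have SE: "S \<subseteq> E" using closed by (simp add: closed_part_def)
  have U: "\<Union>S = {w1, w2, w3} \<union> X" by (auto simp: S vase_edges_def)
  define p q g L where defs: "p = {w1, w2}" "q = {w1, w3}" "g = {w2, w3}" "L = (\<lambda>x. {w1, x}) ` X"
  have S': "S = {p, q, g} \<union> L" unfolding S vase_edges_def defs by blast
  have star: "star x = {e \<in> S. x \<in> e}" if "x \<in> {w1, w2, w3} \<union> X" for x
    using closed_star[OF closed] that unfolding U by blast
  have L: "w1 \<in> l" "w2 \<notin> l" "w3 \<notin> l" if "l \<in> L" for l using that neq by (auto simp: defs)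
  have pqg: "w1 \<in> p" "w1 \<in> q" "w1 \<notin> g" "w2 \<in> p" "w2 \<notin> q" "w2 \<in> g" "w3 \<notin> p" "w3 \<in> q" "w3 \<in> g"
    using neq by (auto simp: defs)
  have d: "p \<noteq> q" "g \<noteq> p" "g \<noteq> q" "p \<notin> L" "q \<notin> L" "g \<notin> L" using L pqg by blast+
  have s1: "star w1 = {p, q} \<union> L" using star[of w1] L pqg by (auto simp: S')
  have s2: "star w2 = {p, g}" using star[of w2] L pqg by (auto simp: S')
  have s3: "star w3 = {q, g}" using star[of w3] L pqg by (auto simp: S')
  have sX: "star x = {{w1, x}}" if "x \<in> X" for x
    using star[of x] that neq by (auto simp: S' defs)
  have e: "R w1 w2" "R w1 w3" "R w2 w3" using SE S' unfolding defs by blast+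
  have "game.nbrs p = star w1 \<union> star w2 - {p}" "game.nbrs q = star w1 \<union> star w3 - {q}"
    "game.nbrs g = star w2 \<union> star w3 - {g}"
    unfolding defs(1-3) using nbrs_edge e by blast+
  then have nb: "game.nbrs p = S - {p}" "game.nbrs q = S - {q}" "game.nbrs g = {p, q}"
    using d by (auto simp: s1 s2 s3 S')
  have nbL: "game.nbrs l = {p, q} \<union> L - {l}" if l: "l \<in> L" for l
  proof -
    obtain x where x: "x \<in> X" "l = {w1, x}" using l by (auto simp: defs)
    have "R w1 x" using l x(2) SE S' by blast
    from card_nbrs_pendant(1)[OF this sX[OF x(1)]] show ?thesis unfolding s1 x(2) .
  qed
  have k3: "3 \<le> k" using triangle_le[OF e(1,3,2)] .
  show ?thesis
  proof (cases "X = {}")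
    case True
    then have "L = {}" by (simp add: defs)
    then have "game.nbrs p = {q, g}" "game.nbrs q = {p, g}" using nb(1,2) d by (auto simp: S')
    with nb(3) k3 d have "game.safe Map.empty p" "game.safe Map.empty q" "game.safe Map.empty g"
      by (intro game.safe_few_nbrs; simp)+
    then show ?thesis using \<open>L = {}\<close> unfolding game.settled_def game.calm_def by (auto simp: S')
  next
    case False
    then have "L \<noteq> {}" by (simp add: defs)
    have "finite L" using finite_star[of w1] s1 by simp
    then have "card L + 2 \<le> k"
      using card_star[of w1] d unfolding s1 by simp
    then have "game.vase_like S"
      unfolding game.vase_like_def using S' \<open>L \<noteq> {}\<close> d k3 nb nbL
      by (intro exI[of _ p] exI[of _ q] exI[of _ g] exI[of _ L]) simp
    then show ?thesis by (simp add: game.settled_def)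
  qed
qed

lemma closed_E: "closed_part E"
  by (simp add: closed_part_def)

lemma candy_wins:
  assumes "candy_set E"
  shows "game.wins Bob Map.empty"
proof -
  obtain v1 v2 W X Y where vd: "vertices_distinct [v1, v2] [W, X, Y]" and "W \<noteq> {}"
    and E: "E = candy_edges v1 v2 W X Y" using assms unfolding candy_set_def by blast
  have neq: "v1 \<noteq> v2" "v1 \<notin> W" "v2 \<notin> W" "v1 \<notin> X" "v2 \<notin> X" "v1 \<notin> Y" "v2 \<notin> Y"
    using vd by (auto simp: vertices_distinct_def)
  have mem: "e \<in> E \<longleftrightarrow> (\<exists>x\<in>W \<union> X. e = {v1, x}) \<or> (\<exists>x\<in>W \<union> Y. e = {v2, x})" for e
    unfolding E candy_edges_def by blast
  have A: "star v1 = (\<lambda>x. {v1, x}) ` (W \<union> X)" using neq by (auto simp: star_def mem)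
  have B: "star v2 = (\<lambda>x. {v2, x}) ` (W \<union> Y)" using neq by (auto simp: star_def mem)
  have AB: "{v1, x} \<noteq> {v2, y}" if "x \<in> W \<union> X" for x y using that neq by (auto simp: doubleton_eq_iff)
  have adj: "x = y" if "x \<in> W \<union> X" "y \<in> W \<union> Y" "adjacent {v1, x} {v2, y} \<or> adjacent {v2, y} {v1, x}" for x y
    using that neq by (auto simp: adjacent_def)
  interpret candy: candy_game E adjacent k "star v1" "star v2"
  proof
    show "E = star v1 \<union> star v2" unfolding A B by (auto simp: mem)
    show "star v1 \<inter> star v2 = {}" unfolding A B using AB by blast
    show "game.nbrs e \<inter> star v1 = star v1 - {e}" if "e \<in> star v1" for e
      using that by (auto simp: game.nbrs_def star_def adjacent_def)
    show "game.nbrs e \<inter> star v2 = star v2 - {e}" if "e \<in> star v2" for e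
      using that by (auto simp: game.nbrs_def star_def adjacent_def)
    show "f = f'" if ef: "e \<in> star v1" "f \<in> star v2" "f' \<in> star v2" "adjacent e f" "adjacent e f'" for e f f'
    proof -
      obtain x y z where "e = {v1, x}" "x \<in> W \<union> X" "f = {v2, y}" "y \<in> W \<union> Y" "f' = {v2, z}" "z \<in> W \<union> Y"
        using ef(1-3) unfolding A B by blast
      with adj[of x y] adj[of x z] ef(4,5) show ?thesis by blast
    qed
    show "e = e'" if ef: "f \<in> star v2" "e \<in> star v1" "e' \<in> star v1" "adjacent f e" "adjacent f e'" for e e' f
    proof -
      obtain x y z where "f = {v2, x}" "x \<in> W \<union> Y" "e = {v1, y}" "y \<in> W \<union> X" "e' = {v1, z}" "z \<in> W \<union> X"
        using ef(1-3) unfolding A B by blast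
      with adj[of y x] adj[of z x] ef(4,5) show ?thesis by blast
    qed
  qed
  \<comment> \<open>A middle vertex has an edge to either centre, and its star yields
    \<open>2 <= k\<close>.\<close>
  obtain m where m: "m \<in> W" using \<open>W \<noteq> {}\<close> by blast
  then have sub: "{{v1, m}, {v2, m}} \<subseteq> star m" by (auto simp: star_def mem)
  have "{v1, m} \<noteq> {v2, m}" using AB[of m m] m by blast
  then have "2 \<le> card (star m)" using card_mono[OF finite_star sub] by simp
  then have "2 \<le> k" using card_star[of m] by simp
  with card_star show ?thesis by (intro candy.candy_wins) auto
qed

lemma shooting_star_wins:
  assumes "shooting_star_set E"
  shows "game.wins Bob Map.empty"
proof -
  obtain v w a b X Y where vd: "vertices_distinct [v, w, a, b] [X, Y]"
    and E: "E = shooting_star_edges v w a b X Y" using assms unfolding shooting_star_set_def by blast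
  have neq: "distinct [v, w, a, b]" "v \<notin> X" "w \<notin> X" "a \<notin> X" "b \<notin> X" "v \<notin> Y" "w \<notin> Y" "a \<notin> Y" "b \<notin> Y"
    "X \<inter> Y = {}" "finite X" "finite Y" using vd by (auto simp: vertices_distinct_def less_Suc_eq)
  show ?thesis
  proof (cases "X = {}")
    case True
    \<comment> \<open>Without leaves at \<open>w\<close> the central edge is \<open>va\<close>, and
      \<open>w\<close> is one more leaf at \<open>v\<close>.\<close>
    have "E = double_star_edges v a (insert w Y) {b}"
      unfolding E shooting_star_edges_def double_star_edges_def True by (auto simp: insert_commute)
    moreover have "vertices_distinct [v, a] [insert w Y, {b}]"
      using neq by (auto simp: vertices_distinct_def less_Suc_eq)
    ultimately have "double_star_set E" unfolding double_star_set_def by blast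
    from double_star_settled[OF closed_E this] show ?thesis by (rule game.settled_V_wins)
  next
    case False
    define e0 p g LX LY where defs: "e0 = {w, v}" "p = {v, a}" "g = {a, b}"
      "LX = (\<lambda>x. {w, x}) ` X" "LY = (\<lambda>y. {v, y}) ` Y"
    have E': "E = {e0, p, g} \<union> LX \<union> LY" unfolding E shooting_star_edges_def defs by blast
    have mem: "e \<in> E \<longleftrightarrow> e = e0 \<or> e = p \<or> e = g \<or> e \<in> LX \<or> e \<in> LY" for e using E' by simp
    have core: "w \<in> e0" "v \<in> e0" "a \<notin> e0" "b \<notin> e0" "v \<in> p" "a \<in> p" "w \<notin> p" "b \<notin> p"
      "a \<in> g" "b \<in> g" "v \<notin> g" "w \<notin> g" using neq by (auto simp: defs)
    have LX: "w \<in> l" "v \<notin> l" "a \<notin> l" "b \<notin> l" if "l \<in> LX" for l using that neq by (auto simp: defs)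
    have LY: "v \<in> l" "w \<notin> l" "a \<notin> l" "b \<notin> l" if "l \<in> LY" for l using that neq by (auto simp: defs)
    have d: "p \<noteq> e0" "g \<noteq> e0" "g \<noteq> p" using core by blast+
    have dL: "e0 \<notin> LX" "p \<notin> LX" "g \<notin> LX" "e0 \<notin> LY" "p \<notin> LY" "g \<notin> LY" "LX \<inter> LY = {}"
      using core LX LY by blast+
    have sv: "star v = {e0, p} \<union> LY" using core LX LY by (auto simp: star_def mem)
    have sw: "star w = {e0} \<union> LX" using core LX LY by (auto simp: star_def mem)
    have sa: "star a = {p, g}" using core LX LY by (auto simp: star_def mem)
    have sb: "star b = {g}" using core LX LY by (auto simp: star_def mem)
    have sX: "star x = {{w, x}}" if "x \<in> X" for x
    proof (rule star_pendant[of "{e0, p, g} \<union> LY"])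
      show "E = {e0, p, g} \<union> LY \<union> (\<lambda>x. {w, x}) ` X" using E' unfolding defs by blast
    qed (use that neq in \<open>auto simp: defs\<close>)
    have sY: "star y = {{v, y}}" if "y \<in> Y" for y
    proof (rule star_pendant[of "{e0, p, g} \<union> LX"])
      show "E = {e0, p, g} \<union> LX \<union> (\<lambda>y. {v, y}) ` Y" using E' unfolding defs by blast
    qed (use that neq in \<open>auto simp: defs\<close>)
    have "R w v" "R v a" "R a b" using E' unfolding defs by blast+
    from this[THEN nbrs_edge] have nb: "game.nbrs e0 = star w \<union> star v - {e0}"
      "game.nbrs p = star v \<union> star a - {p}" "game.nbrs g = star a \<union> star b - {g}"
      unfolding defs by blast+
    show ?thesis
    proof (rule game.shooting_star_wins[of "star v" "star w" g e0 p])
      show "E = star v \<union> star w \<union> {g}" unfolding sv sw by (subst E') auto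
      show "star v \<inter> star w = {e0}" "g \<notin> star v" "g \<notin> star w" "p \<in> star v" using d dL by (auto simp: sv sw)
      show "star w \<noteq> {e0}" using False dL(1) by (auto simp: sw defs)
      show "game.nbrs e0 = star v \<union> star w - {e0}" using nb(1) by blast
      show "game.nbrs p = insert g (star v - {p})" using nb(2) d by (auto simp: sa)
      show "game.nbrs g = {p}" using nb(3) d by (auto simp: sa sb)
      show "game.nbrs e = star v - {e}" if e: "e \<in> star v - {e0, p}" for e
      proof -
        have "e \<in> LY" using e by (auto simp: sv)
        then obtain y where y: "y \<in> Y" "e = {v, y}" by (auto simp: defs)
        have "R v y" using e y(2) by (simp add: star_def)
        from card_nbrs_pendant(1)[OF this sY[OF y(1)]] show ?thesis by (simp add: y(2))
      qed
      show "game.nbrs e = star w - {e}" if e: "e \<in> star w - {e0}" for e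
      proof -
        have "e \<in> LX" using e by (auto simp: sw)
        then obtain x where x: "x \<in> X" "e = {w, x}" by (auto simp: defs)
        have "R w x" using e x(2) by (simp add: star_def)
        from card_nbrs_pendant(1)[OF this sX[OF x(1)]] show ?thesis by (simp add: x(2))
      qed
    qed (use d card_star in auto)
  qed
qed

lemma amaryllis_wins:
  assumes "amaryllis_set E"
  shows "game.wins Bob Map.empty"
proof -
  obtain v w c1 c2 X Y where vd: "vertices_distinct [v, w, c1, c2] [X, Y]"
    and E: "E = amaryllis_edges v w c1 c2 X Y" using assms unfolding amaryllis_set_def by blast
  have neq: "distinct [v, w, c1, c2]" "v \<notin> X" "w \<notin> X" "c1 \<notin> X" "c2 \<notin> X" "v \<notin> Y" "w \<notin> Y" "c1 \<notin> Y" "c2 \<notin> Y"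
    "X \<inter> Y = {}" "finite X" "finite Y" using vd by (auto simp: vertices_distinct_def less_Suc_eq)
  show ?thesis
  proof (cases "X = {}")
    case True
    \<comment> \<open>Without leaves at \<open>w\<close> this vertex is one more leaf of the vase
      centred at \<open>v\<close>.\<close>
    have "E = vase_edges v c1 c2 (insert w Y)"
      unfolding E amaryllis_edges_def vase_edges_def True insert_commute[of w v "{}"] insert_commute[of c2 v "{}"]
      by (simp add: insert_commute)
    moreover have "vertices_distinct [v, c1, c2] [insert w Y]"
      using neq by (auto simp: vertices_distinct_def)
    ultimately have "vase_set E" unfolding vase_set_def by blast
    from vase_settled[OF closed_E this] show ?thesis by (rule game.settled_V_wins)
  next
    case False
    define e0 p q g LX LY where defs: "e0 = {w, v}" "p = {v, c1}" "q = {c2, v}" "g = {c1, c2}"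
      "LX = (\<lambda>x. {w, x}) ` X" "LY = (\<lambda>y. {v, y}) ` Y"
    have E': "E = {e0, p, q, g} \<union> LX \<union> LY" unfolding E amaryllis_edges_def defs by blast
    have mem: "e \<in> E \<longleftrightarrow> e = e0 \<or> e = p \<or> e = q \<or> e = g \<or> e \<in> LX \<or> e \<in> LY" for e using E' by simp
    have core: "w \<in> e0" "v \<in> e0" "c1 \<notin> e0" "c2 \<notin> e0" "v \<in> p" "c1 \<in> p" "w \<notin> p" "c2 \<notin> p"
      "v \<in> q" "c2 \<in> q" "w \<notin> q" "c1 \<notin> q" "c1 \<in> g" "c2 \<in> g" "v \<notin> g" "w \<notin> g" using neq by (auto simp: defs)
    have LX: "w \<in> l" "v \<notin> l" "c1 \<notin> l" "c2 \<notin> l" if "l \<in> LX" for l using that neq by (auto simp: defs)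
    have LY: "v \<in> l" "w \<notin> l" "c1 \<notin> l" "c2 \<notin> l" if "l \<in> LY" for l using that neq by (auto simp: defs)
    have d: "p \<noteq> e0" "q \<noteq> e0" "p \<noteq> q" "g \<noteq> e0" "g \<noteq> p" "g \<noteq> q" using core by blast+
    have dL: "e0 \<notin> LX" "p \<notin> LX" "q \<notin> LX" "g \<notin> LX" "e0 \<notin> LY" "p \<notin> LY" "q \<notin> LY" "g \<notin> LY" "LX \<inter> LY = {}"
      using core LX LY by blast+
    have sv: "star v = {e0, p, q} \<union> LY" using core LX LY by (auto simp: star_def mem)
    have sw: "star w = {e0} \<union> LX" using core LX LY by (auto simp: star_def mem)
    have s1: "star c1 = {p, g}" using core LX LY by (auto simp: star_def mem)
    have s2: "star c2 = {q, g}" using core LX LY by (auto simp: star_def mem)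
    have sX: "star x = {{w, x}}" if "x \<in> X" for x
    proof (rule star_pendant[of "{e0, p, q, g} \<union> LY"])
      show "E = {e0, p, q, g} \<union> LY \<union> (\<lambda>x. {w, x}) ` X" using E' unfolding defs by blast
    qed (use that neq in \<open>auto simp: defs\<close>)
    have sY: "star y = {{v, y}}" if "y \<in> Y" for y
    proof (rule star_pendant[of "{e0, p, q, g} \<union> LX"])
      show "E = {e0, p, q, g} \<union> LX \<union> (\<lambda>y. {v, y}) ` Y" using E' unfolding defs by blast
    qed (use that neq in \<open>auto simp: defs\<close>)
    have "R w v" "R v c1" "R c2 v" "R c1 c2" using E' unfolding defs by blast+
    from this[THEN nbrs_edge] have nb: "game.nbrs e0 = star w \<union> star v - {e0}"
      "game.nbrs p = star v \<union> star c1 - {p}" "game.nbrs q = star c2 \<union> star v - {q}"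
      "game.nbrs g = star c1 \<union> star c2 - {g}"
      unfolding defs by blast+
    show ?thesis
    proof (rule game.amaryllis_wins[of "star v" "star w" g e0 p q])
      show "E = star v \<union> star w \<union> {g}" unfolding sv sw by (subst E') auto
      show "star v \<inter> star w = {e0}" "g \<notin> star v" "g \<notin> star w" "p \<in> star v" "q \<in> star v"
        using d dL by (auto simp: sv sw)
      show "star w \<noteq> {e0}" using False dL(1) by (auto simp: sw defs)
      show "game.nbrs e0 = star v \<union> star w - {e0}" using nb(1) by blast
      show "game.nbrs p = insert g (star v - {p})" using nb(2) d by (auto simp: s1)
      show "game.nbrs q = insert g (star v - {q})" using nb(3) d by (auto simp: s2)
      show "game.nbrs g = {p, q}" using nb(4) d by (auto simp: s1 s2)
      show "game.nbrs e = star v - {e}" if e: "e \<in> star v - {e0, p, q}" for e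
      proof -
        have "e \<in> LY" using e by (auto simp: sv)
        then obtain y where y: "y \<in> Y" "e = {v, y}" by (auto simp: defs)
        have "R v y" using e y(2) by (simp add: star_def)
        from card_nbrs_pendant(1)[OF this sY[OF y(1)]] show ?thesis by (simp add: y(2))
      qed
      show "game.nbrs e = star w - {e}" if e: "e \<in> star w - {e0}" for e
      proof -
        have "e \<in> LX" using e by (auto simp: sw)
        then obtain x where x: "x \<in> X" "e = {w, x}" by (auto simp: defs)
        have "R w x" using e x(2) by (simp add: star_def)
        from card_nbrs_pendant(1)[OF this sX[OF x(1)]] show ?thesis by (simp add: x(2))
      qed
    qed (use d card_star in auto)
  qed
qed

lemma double_vase_wins:
  assumes "double_vase_set E"
  shows "game.wins Bob Map.empty"
proof -
  obtain v x1 x2 y1 y2 X where vd: "vertices_distinct [v, x1, x2, y1, y2] [X]"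
    and E: "E = double_vase_edges v x1 x2 y1 y2 X" using assms unfolding double_vase_set_def by blast
  have neq: "distinct [v, x1, x2, y1, y2]" "v \<notin> X" "x1 \<notin> X" "x2 \<notin> X" "y1 \<notin> X" "y2 \<notin> X"
    using vd by (auto simp: vertices_distinct_def)
  define p q r s g h L where defs: "p = {v, x1}" "q = {x2, v}" "r = {v, y1}" "s = {y2, v}"
    "g = {x1, x2}" "h = {y1, y2}" "L = (\<lambda>x. {v, x}) ` X"
  have E': "E = {p, g, q, r, h, s} \<union> L" unfolding E double_vase_edges_def defs ..
  have mem: "e \<in> E \<longleftrightarrow> e = p \<or> e = q \<or> e = r \<or> e = s \<or> e = g \<or> e = h \<or> e \<in> L" for e unfolding E' by auto
  have p: "v \<in> p" "x1 \<in> p" "x2 \<notin> p" "y1 \<notin> p" "y2 \<notin> p" and q: "v \<in> q" "x1 \<notin> q" "x2 \<in> q" "y1 \<notin> q" "y2 \<notin> q"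
    and r: "v \<in> r" "x1 \<notin> r" "x2 \<notin> r" "y1 \<in> r" "y2 \<notin> r" and s: "v \<in> s" "x1 \<notin> s" "x2 \<notin> s" "y1 \<notin> s" "y2 \<in> s"
    and g: "v \<notin> g" "x1 \<in> g" "x2 \<in> g" "y1 \<notin> g" "y2 \<notin> g" and h: "v \<notin> h" "x1 \<notin> h" "x2 \<notin> h" "y1 \<in> h" "y2 \<in> h"
    using neq by (auto simp: defs)
  note core = p q r s g h
  have L: "v \<in> l" "x1 \<notin> l" "x2 \<notin> l" "y1 \<notin> l" "y2 \<notin> l" if "l \<in> L" for l using that neq by (auto simp: defs)
  have d: "distinct [p, q, r, s]" "g \<noteq> h"
    using p(2) q(2,3) r(2,4,3) s(2-5) p(4,5) q(4,5) g(2) h(2) by auto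
  have sv: "star v = {p, q, r, s} \<union> L" using core(1,6,11,16,21,26) L(1) by (auto simp: star_def mem)
  have sx: "star x1 = {p, g}" "star x2 = {q, g}" using core L(2,3) by (auto simp: star_def mem)
  have sy: "star y1 = {r, h}" "star y2 = {s, h}" using core L(4,5) by (auto simp: star_def mem)
  have sX: "star x = {{v, x}}" if "x \<in> X" for x
  proof (rule star_pendant[of "{p, g, q, r, h, s}"])
    show "E = {p, g, q, r, h, s} \<union> (\<lambda>x. {v, x}) ` X" using E' unfolding defs(7) .
  qed (use that neq in \<open>auto simp: defs\<close>)
  have gh: "g \<notin> star v" "h \<notin> star v" using g(1) h(1) by (simp_all add: star_def)
  have mv: "p \<in> star v" "q \<in> star v" "r \<in> star v" "s \<in> star v" by (simp_all add: sv)
  have "R v x1" "R x2 v" "R v y1" "R y2 v" "R x1 x2" "R y1 y2" using E' unfolding defs by blast+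
  from this[THEN nbrs_edge] have nb: "game.nbrs p = star v \<union> star x1 - {p}" "game.nbrs q = star x2 \<union> star v - {q}"
    "game.nbrs r = star v \<union> star y1 - {r}" "game.nbrs s = star y2 \<union> star v - {s}"
    "game.nbrs g = star x1 \<union> star x2 - {g}" "game.nbrs h = star y1 \<union> star y2 - {h}"
    unfolding defs by blast+
  show ?thesis
  proof (rule game.double_vase_wins[of "star v" g h p q r s])
    show "E = star v \<union> {g, h}" unfolding sv by (subst E') auto
    show "game.nbrs p = insert g (star v - {p})" "game.nbrs q = insert g (star v - {q})"
      "game.nbrs r = insert h (star v - {r})" "game.nbrs s = insert h (star v - {s})"
      "game.nbrs g = {p, q}" "game.nbrs h = {r, s}"
      unfolding nb sx sy using gh mv by blast+
    show "game.nbrs e = star v - {e}" if e: "e \<in> star v - {p, q, r, s}" for e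
    proof -
      have "e \<in> L" using e by (auto simp: sv)
      then obtain x where x: "x \<in> X" "e = {v, x}" by (auto simp: defs)
      have "R v x" using e x(2) by (simp add: star_def)
      from card_nbrs_pendant(1)[OF this sX[OF x(1)]] show ?thesis by (simp add: x(2))
    qed
    show "{p, q, r, s} \<subseteq> star v" using mv by blast
  qed (use gh d card_star in blast)+
qed

lemma P5_C4_free_wins:
  assumes P5_C4_free
  shows "game.wins Bob Map.empty"
proof -
  define G where "G = edge_graph E"
  have G: "fin_simple_graph G" "edges G = E"
    using finite_E card_edge by (auto simp: G_def edge_graph_def fin_simple_graph_def card_ge_0_finite)
  define \<K> where "\<K> = {edges (component_of G v) | v. edges (component_of G v) \<noteq> {}}"
  have part: "closed_part K \<and> (double_star_set K \<or> vase_set K)" if K: "K \<in> \<K>" for K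
  proof -
    obtain v where v: "K = edges (component_of G v)" "edges (component_of G v) \<noteq> {}"
      using K unfolding \<K>_def by blast
    from P5_C4_free_component[OF G(1) _ v(2)] assms G(2) obtain S
      where "component_of G v = edge_graph S" "closed_part S" "double_star_set S \<or> vase_set S" by auto
    with v(1) show ?thesis by (simp add: edge_graph_def)
  qed
  show ?thesis
  proof (rule game.settled_wins[of \<K>])
    show "\<Union>\<K> = E"
    proof
      show "\<Union>\<K> \<subseteq> E" using part unfolding closed_part_def by blast
      show "E \<subseteq> \<Union>\<K>"
      proof
        fix e assume e: "e \<in> E"
        then obtain x y where xy: "e = {x, y}" "R x y" by (rule edge_cases)
        then have "e \<in> edges (component_of G x)"
          using linked_refl linked_edge[of x y G] G(2) by (auto simp: component_of_def)
        then show "e \<in> \<Union>\<K>" unfolding \<K>_def by blast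
      qed
    qed
    show "game.nbrs f \<subseteq> K" if "K \<in> \<K>" "f \<in> K" for K f
    proof
      fix e assume "e \<in> game.nbrs f"
      then have e: "e \<in> E" "e \<inter> f \<noteq> {}" by (auto simp: game.nbrs_def adjacent_def)
      then obtain x where x: "x \<in> e" "x \<in> f" by blast
      then have "e \<in> star x" using e(1) by (simp add: star_def)
      with closed_star[of K x] part[OF that(1)] that(2) x(2) show "e \<in> K" by blast
    qed
    show "K \<inter> L = {}" if K: "K \<in> \<K>" and L: "L \<in> \<K>" and ne: "K \<noteq> L" for K L
    proof (rule ccontr)
      assume "K \<inter> L \<noteq> {}"
      then obtain e where e: "e \<in> K" "e \<in> L" by blast
      from K L obtain u v where uv: "K = edges (component_of G u)" "L = edges (component_of G v)"
        unfolding \<K>_def by blast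
      have "e \<in> E" using e(1) part[OF K] unfolding closed_part_def by blast
      then obtain x y where "e = {x, y}" by (rule edge_cases)
      then have "linked G u x" "linked G v x" using e uv by (auto simp: component_of_def)
      then have "linked G u z \<longleftrightarrow> linked G v z" for z
        by (meson linked_sym linked_trans)
      then have "component_of G u = component_of G v" by (simp add: component_of_def)
      with uv ne show False by simp
    qed
    show "\<forall>K\<in>\<K>. game.settled Map.empty K"
      using part double_star_settled vase_settled by blast
  qed
qed

theorem pattern_free_wins:
  assumes pattern_free
  shows "game.wins Bob Map.empty"
proof -
  interpret pattern_free_set E using assms by unfold_locales
  from classification show ?thesis
    using P5_C4_free_wins candy_wins shooting_star_wins double_vase_wins amaryllis_wins by blast
qed

end

section \<open>From the game with clique-number many colours to line perfection\<close>

lemma line_game_omega: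
  assumes "edge_set E"
  shows "line_game E (omega_line (edge_graph E))"
proof -
  interpret edge_set E by (rule assms)
  have fin: "finite (edges (edge_graph E))" using finite_E by (simp add: edge_graph_def)
  show ?thesis
  proof
    show "card {e \<in> E. x \<in> e} \<le> omega_line (edge_graph E)" for x
      by (rule omega_line_ge[OF fin]) (auto simp: edge_graph_def adjacent_def)
    show "3 \<le> omega_line (edge_graph E)" if "R x y" "R y z" "R x z" for x y z
    proof -
      have "x \<noteq> y" "y \<noteq> z" "x \<noteq> z" using that R_neq by auto
      then have "card {{x, y}, {y, z}, {x, z}} = 3" by (auto simp: doubleton_eq_iff)
      moreover have "card {{x, y}, {y, z}, {x, z}} \<le> omega_line (edge_graph E)"
        by (rule omega_line_ge[OF fin]) (use that in \<open>auto simp: edge_graph_def adjacent_def\<close>)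
      ultimately show ?thesis by simp
    qed
  qed
qed

lemma embeds_mono: "embeds E n es \<Longrightarrow> E \<subseteq> F \<Longrightarrow> embeds F n es"
  unfolding embeds_def by blast

lemma line_perfect_iff_forbidden_free:
  assumes G: "fin_simple_graph G"
  shows "line_perfect Bob None G \<longleftrightarrow> forbidden_free G"
proof
  assume "line_perfect Bob None G"
  then show "forbidden_free G"
    unfolding forbidden_free_def forbidden_patterns using bad_pattern_not_perfect bad_patterns bad_F1 by blast
next
  assume free: "forbidden_free G"
  interpret edge_set "edges G" using G by (rule edge_set_edges)
  show "line_perfect Bob None G" unfolding line_perfect_def
  proof (intro allI impI)
    fix F assume F: "F \<subseteq> edges G"
    have EF: "edge_set F"
      using F finite_E card_edge by (auto simp: edge_set_def intro: finite_subset)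
    have "edge_set.pattern_free F"
      using free F embeds_mono[OF _ F] unfolding forbidden_free_iff[OF G] pattern_free_def edge_set.pattern_free_def[OF EF]
      by blast
    then have "alice_wins F adjacent (omega_line (edge_graph F)) Bob Map.empty"
      by (rule line_game.pattern_free_wins[OF line_game_omega[OF EF]])
    moreover have "finite F" using EF by (simp add: edge_set_def)
    ultimately show "game_index Bob None (edge_graph F) = omega_line (edge_graph F)"
      by (subst game_index_eq_omega_iff) (simp_all add: edge_graph_def)
  qed
qed

theorem theorem11:
  fixes G :: "'a sgraph"
  assumes "fin_simple_graph G"
  shows "(line_perfect Bob None G \<longleftrightarrow> forbidden_free G) \<and>
         (forbidden_free G \<longleftrightarrow> permitted_structure G)"
  using line_perfect_iff_forbidden_free[OF assms] forbidden_free_iff_permitted[OF assms] by (rule conjI)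

end
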